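(* Let $X$ be $\mathbb{R}^d$, $\mathbb{C}$, $\mathbb{H}$, or $\mathbb{O}$, with a lattice $\mathcal{Z}$ that is integral, unit-generated, norm-Euclidean, nicely invertible with respect to an inversion $\iota$, and either 3-remote or 7-remote. Let $K$ be the Dirichlet region for $\mathcal{Z}$ and $T:K\to K$ the associated continued fraction map. Then: (1) there is a finite collection of sets $U_1,\dots,U_J\subset K$ such that every non-empty cylinder $C_{a_1\dots a_n}$ satisfies $T^nC_{a_1\dots a_n}=U_j$ up to a Lebesgue-null set for some $1\le j\le J$ (finite range property); (2) $T$ is an exact endomorphism and continued fraction mixing with respect to a $T$-invariant measure $\mu$ equivalent to Lebesgue measure $\lambda$; (3) the density $d\mu/d\lambda$ is piecewise analytic on the pieces of the partition of $K$ generated by $U_1,\dots,U_J$; (4) $T$ satisfies a Kuzmin-type theorem: there is $0<\alpha<1$ such that for every function $f:K\to(0,\infty)$ bounded away from $0$ and $\infty$ and Lipschitz on each cell, $A^nf=\left(\int_K f\,d\lambda\right)h+O\left(\alpha^{\sqrt n}+\sigma(\sqrt n)+\gamma(\sqrt n)\right)$.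
   Context: $\mathbb{C},\mathbb{H},\mathbb{O}$ are identified with $\mathbb{R}^2,\mathbb{R}^4,\mathbb{R}^8$; $|\cdot|$, $d$, and dot products are Euclidean in these real coordinates. An inversion is a map $\iota:X\setminus\{0\}\to X\setminus\{0\}$ with $|\iota x|=1/|x|$ and $d(\iota x,\iota y)=d(x,y)/(|x||y|)$ (equivalently $\iota(x)=\mathcal{O}(x)/|x|^2$ with $\mathcal{O}$ orthogonal); inversions are assumed to satisfy $\iota\circ\iota=\mathrm{id}$, and $\iota(0)=0$. A lattice is a discrete additive subgroup with compact quotient. The Dirichlet region is $K=\{x:d(x,0)\le d(x,z)\ \forall z\in\mathcal{Z}\}$ with a boundary choice making each $x$ have a unique $[x]\in\mathcal{Z}$ with $x-[x]\in K$; $\operatorname{rad}(K)=\sup_{x\in K}|x|$. CF map: $Tx=\iota x-[\iota x]$ ($x\ne0$), $T0=0$. Cylinders: $C_\emptyset=K$, $C_{as}=K\cap\iota(C_s+a)$ for $a\in\mathcal{Z}$ (the points whose first digits $[\iota T^{i-1}x]$ are those of the string). $\mathcal{Z}$ is: integral if $z\cdot z\in\mathbb{Z}$ for all $z\in\mathcal{Z}$; unit-generated if every element is a sum of lattice points of norm $1$; nicely invertible w.r.t. $\iota$ if $|z|^2\iota(z)\in\mathcal{Z}$ for all nonzero $z\in\mathcal{Z}$; norm-Euclidean if $\operatorname{rad}(K)<1$; 3-remote if $\inf_{x\in K}d(z,x)\ge1$ for every $z\in\mathcal{Z}$ with $|z|=\sqrt3$; 7-remote if $\inf_{x\in K}d(z/2,x)\ge1/2$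 for every $z\in\mathcal{Z}$ with $|z|=\sqrt7$. Exactness is in the usual ergodic-theoretic sense. Continued fraction mixing: with $\psi(m)=\sup\frac{|\mu(C_s\cap T^{-|s|-m}E)-\mu(C_s)\mu(E)|}{\mu(C_s)\mu(E)}$ over positive-measure cylinders $C_s$ and positive-measure Borel $E\subset K$, $\sup_{m\ge1}\psi(m)<\infty$ and $\psi(m)\to0$. In (4): cells are the atoms of the partition of $K$ generated by $U_1,\dots,U_J$; $A$ is the transfer operator on $L^1(\lambda)$ defined by $\int_{T^{-1}E}f\,d\lambda=\int_E Af\,d\lambda$; $h$ is a version of $d\mu/d\lambda$; $\sigma(m)=\sup_{|s|=m}\operatorname{diam}C_s$; $\gamma(m)=\sum\lambda(C_s)$ over strings $s$ of length $m$ with $C_s$ not contained in a single cell. *)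

theory Defs
  imports "HOL-Probability.Probability"
begin

text \<open>The ambient space X is R^d (C, H, O identified with R^2, R^4, R^8), modelled by
  an arbitrary euclidean space.  Only the Euclidean structure and the inversion are used.\<close>

definition inversion :: "('a::euclidean_space \<Rightarrow> 'a) \<Rightarrow> bool" where
  "inversion \<iota> \<longleftrightarrow>
     \<iota> 0 = 0 \<and> (\<forall>x. \<iota> (\<iota> x) = x) \<and>
     (\<forall>x. x \<noteq> 0 \<longrightarrow> \<iota> x \<noteq> 0 \<and> norm (\<iota> x) = 1 / norm x) \<and>
     (\<forall>x y. x \<noteq> 0 \<longrightarrow> y \<noteq> 0 \<longrightarrow> dist (\<iota> x) (\<iota> y) = dist x y / (norm x * norm y))"

definition lattice :: "'a::euclidean_space set \<Rightarrow> bool" where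
  "lattice Z \<longleftrightarrow>
     0 \<in> Z \<and> (\<forall>x\<in>Z. \<forall>y\<in>Z. x + y \<in> Z \<and> x - y \<in> Z) \<and>
     (\<forall>z\<in>Z. \<exists>e>0. ball z e \<inter> Z = {z}) \<and>
     (\<exists>C. compact C \<and> (\<forall>x. \<exists>z\<in>Z. \<exists>c\<in>C. x = z + c))"

definition dirichlet_closed :: "'a::euclidean_space set \<Rightarrow> 'a set" where
  "dirichlet_closed Z = {x. \<forall>z\<in>Z. dist x 0 \<le> dist x z}"

text \<open>A Dirichlet region with a boundary choice: a subset of the closed region such
  that every point has a unique lattice translate into it.\<close>
definition dirichlet_region :: "'a::euclidean_space set \<Rightarrow> 'a set \<Rightarrow> bool" where
  "dirichlet_region Z K \<longleftrightarrow> K \<subseteq> dirichlet_closed Z \<and> (\<forall>x. \<exists>!z. z \<in> Z \<and> x - z \<in> K)"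

definition nearest :: "'a::euclidean_space set \<Rightarrow> 'a set \<Rightarrow> 'a \<Rightarrow> 'a" where
  "nearest Z K x = (THE z. z \<in> Z \<and> x - z \<in> K)"

definition cfmap :: "'a::euclidean_space set \<Rightarrow> 'a set \<Rightarrow> ('a \<Rightarrow> 'a) \<Rightarrow> 'a \<Rightarrow> 'a" where
  "cfmap Z K \<iota> x = (if x = 0 then 0 else \<iota> x - nearest Z K (\<iota> x))"

fun cylinder :: "'a::euclidean_space set \<Rightarrow> ('a \<Rightarrow> 'a) \<Rightarrow> 'a list \<Rightarrow> 'a set" where
  "cylinder K \<iota> [] = K"
| "cylinder K \<iota> (a # s) = K \<inter> \<iota> ` ((\<lambda>y. y + a) ` cylinder K \<iota> s)"

definition integral_lattice :: "'a::euclidean_space set \<Rightarrow> bool" where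
  "integral_lattice Z \<longleftrightarrow> (\<forall>z\<in>Z. z \<bullet> z \<in> \<int>)"

definition unit_generated :: "'a::euclidean_space set \<Rightarrow> bool" where
  "unit_generated Z \<longleftrightarrow>
     (\<forall>z\<in>Z. \<exists>us. set us \<subseteq> {u\<in>Z. norm u = 1} \<and> sum_list us = z)"

definition nicely_invertible :: "'a::euclidean_space set \<Rightarrow> ('a \<Rightarrow> 'a) \<Rightarrow> bool" where
  "nicely_invertible Z \<iota> \<longleftrightarrow> (\<forall>z\<in>Z. z \<noteq> 0 \<longrightarrow> (norm z)\<^sup>2 *\<^sub>R \<iota> z \<in> Z)"

definition norm_euclidean :: "'a::euclidean_space set \<Rightarrow> bool" where
  "norm_euclidean K \<longleftrightarrow> (SUP x\<in>K. norm x) < 1"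

definition three_remote :: "'a::euclidean_space set \<Rightarrow> 'a set \<Rightarrow> bool" where
  "three_remote Z K \<longleftrightarrow> (\<forall>z\<in>Z. norm z = sqrt 3 \<longrightarrow> infdist z K \<ge> 1)"

definition seven_remote :: "'a::euclidean_space set \<Rightarrow> 'a set \<Rightarrow> bool" where
  "seven_remote Z K \<longleftrightarrow> (\<forall>z\<in>Z. norm z = sqrt 7 \<longrightarrow> infdist (z /\<^sub>R 2) K \<ge> 1 / 2)"

definition cells :: "'a set \<Rightarrow> (nat \<Rightarrow> 'a set) \<Rightarrow> nat \<Rightarrow> 'a set set" where
  "cells K U J = {P. P \<noteq> {} \<and> (\<exists>S\<subseteq>{1..J}.
        P = K \<inter> (\<Inter>j\<in>{1..J}. if j \<in> S then U j else K - U j))}"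

definition exact_endomorphism :: "'a measure \<Rightarrow> ('a \<Rightarrow> 'a) \<Rightarrow> bool" where
  "exact_endomorphism M T \<longleftrightarrow>
     T \<in> measurable M M \<and>
     (\<forall>E. (\<forall>n. \<exists>B\<in>sets M. E = (T ^^ n) -` B \<inter> space M) \<longrightarrow>
          measure M E = 0 \<or> measure M E = 1)"

definition transfer_of :: "'a::euclidean_space set \<Rightarrow> ('a \<Rightarrow> 'a) \<Rightarrow> ('a \<Rightarrow> real) \<Rightarrow> ('a \<Rightarrow> real) \<Rightarrow> bool" where
  "transfer_of K T f g \<longleftrightarrow>
     set_integrable lebesgue K g \<and>
     (\<forall>E\<in>sets lebesgue. E \<subseteq> K \<longrightarrow>
        (LINT x:(T -` E \<inter> K)|lebesgue. f x) = (LINT x:E|lebesgue. g x))"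

fun transfer_iter :: "'a::euclidean_space set \<Rightarrow> ('a \<Rightarrow> 'a) \<Rightarrow> nat \<Rightarrow> ('a \<Rightarrow> real) \<Rightarrow> ('a \<Rightarrow> real) \<Rightarrow> bool" where
  "transfer_iter K T 0 f g \<longleftrightarrow> set_integrable lebesgue K g \<and> (AE x in lebesgue. x \<in> K \<longrightarrow> g x = f x)"
| "transfer_iter K T (Suc n) f g \<longleftrightarrow> (\<exists>g'. transfer_iter K T n f g' \<and> transfer_of K T g' g)"

definition real_analytic_on :: "('a::euclidean_space \<Rightarrow> real) \<Rightarrow> 'a set \<Rightarrow> bool" where
  "real_analytic_on f S \<longleftrightarrow>
     (\<forall>x\<in>S. \<exists>r>0. \<exists>c :: ('a \<Rightarrow> nat) \<Rightarrow> real. \<forall>y\<in>ball x r.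
        ((\<lambda>\<alpha>. c \<alpha> * (\<Prod>b\<in>Basis. ((y - x) \<bullet> b) ^ \<alpha> b)) has_sum f y)
          {\<alpha>. \<forall>b. b \<notin> Basis \<longrightarrow> \<alpha> b = 0})"

end

theory Submission
  imports Defs
begin

text \<open>
  Writing \<open>\<iota> x = orth x / |x|\<^sup>2\<close> with \<open>orth\<close> linear and orthogonal, consider the quadratic
  functions \<open>A |x|\<^sup>2 - 2 x \<bullet> z + C\<close> with integers \<open>A\<close>, \<open>C\<close> and \<open>z\<close> in the lattice such that
  \<open>|z|\<^sup>2 - A C = 1\<close>. Translations by lattice points and the inversion permute them. By remoteness
  only those with \<open>|A|, |C| \<le> 1\<close> (respectively \<open>\<le> 2\<close>) matter in the interior of \<open>K\<close>, so finitely
  many spheres and hyperplanes cut \<open>K\<close> into cells such that every inverse branch of the map sends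
  cells into cells. Hence images of cylinders are unions of cells up to null sets.

  The transfer operator preserves the cone of functions which are log-Lipschitz on cells and
  strictly improves the Lipschitz constant. Every cell contains points \<open>z / q\<close> with \<open>q\<close> dividing
  \<open>|z|\<^sup>2\<close>; their denominators decrease along the orbit, so the orbit reaches 0, near which branches
  are full. Thus a power of the operator dominates a multiple of the integral, and subtracting
  constants gives exponential convergence in the supremum norm to the invariant density. Mixing,
  exactness and the Kuzmin theorem follow. The iterates of the operator applied to 1 are sums of
  powers of quadratic polynomials with poles at a uniform distance from the cell; uniform
  coefficient bounds for their power series pass to the limit.
\<close>

section \<open>Measure of images under Lipschitz maps and inversions\<close>

text \<open>Cell boundaries and the boundary choice of \<open>K\<close> matter only on null sets,
  yet the regularity estimates are pointwise. Everything is therefore done on an open set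
  \<open>K0\<close> of full measure, with functions into the extended nonnegative reals: the
  transfer operator is then a sum defined at every point, and identities hold everywhere on
  \<open>K0\<close>. Cells are classes of equal signs of forms. Pulling a form back along a branch
  turns its constant coefficient into the leading one, and translations fix the leading one, so only
  leading coefficients have to be controlled. The operator restricted to a cylinder keeps the
  regularity constant whatever the length of the word, which makes mixing uniform over cylinders.
  Uniform limits of analytic functions need not be analytic; hence the class of power series whose
  coefficient bounds are proportional to the value at the centre, which is closed under pointwise
  limits.\<close>

lemma emeasure_UN_countable_le:
  assumes "countable I" and A: "\<And>i. i \<in> I \<Longrightarrow> A i \<in> sets M"
  shows "emeasure M (\<Union>i\<in>I. A i) \<le> (\<integral>\<^sup>+i. emeasure M (A i) \<partial>count_space I)"
proof -
  have "emeasure M (\<Union>i\<in>I. A i) = (\<integral>\<^sup>+x. indicator (\<Union>i\<in>I. A i) x \<partial>M)"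
    using assms by (subst nn_integral_indicator) (auto intro!: sets.countable_UN')
  also have "\<dots> \<le> (\<integral>\<^sup>+x. \<integral>\<^sup>+i. indicator (A i) x \<partial>count_space I \<partial>M)"
  proof (intro nn_integral_mono)
    fix x
    show "(indicator (\<Union>i\<in>I. A i) x :: ennreal) \<le> (\<integral>\<^sup>+i. indicator (A i) x \<partial>count_space I)"
    proof (cases "x \<in> (\<Union>i\<in>I. A i)")
      case True
      then obtain j where j: "j \<in> I" "x \<in> A j" by auto
      show ?thesis
        using nn_integral_ge_point[OF j(1), of "\<lambda>i. indicator (A i) x :: ennreal"] j True by simp
    qed simp
  qed
  also have "\<dots> = (\<integral>\<^sup>+i. \<integral>\<^sup>+x. indicator (A i) x \<partial>M \<partial>count_space I)"
    using assms by (intro nn_integral_count_space_nn_integral) auto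
  also have "\<dots> = (\<integral>\<^sup>+i. emeasure M (A i) \<partial>count_space I)"
    using A by (intro nn_integral_cong) auto
  finally show ?thesis .
qed

text \<open>By Vitali's theorem \<open>S\<close> is covered, up to a null set, by disjoint balls
  inside an open set of almost the same measure, and the image of \<open>S\<close> within such a
  ball lies in a ball \<open>C\<close> times as large. Since balls go into balls the constant is
  exactly \<open>C ^ DIM('a)\<close>; the change of variables below tolerates no extra
  factor.\<close>

lemma emeasure_lipschitz_image_le:
  fixes f :: "'a::euclidean_space \<Rightarrow> 'a"
  assumes S: "S \<in> sets lebesgue" and fS: "f ` S \<in> sets lebesgue" and C: "C > 0"
    and lip: "\<And>x y. x \<in> S \<Longrightarrow> y \<in> S \<Longrightarrow> dist (f x) (f y) \<le> C * dist x y"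
  shows "emeasure lebesgue (f ` S) \<le> ennreal (C ^ DIM('a)) * emeasure lebesgue S"
proof (rule ennreal_le_epsilon)
  fix e :: real assume e: "0 < e"
  define e' where "e' = e / C ^ DIM('a)"
  have e': "e' > 0" using e C by (simp add: e'_def)
  obtain T where T: "open T" "S \<subseteq> T" "T - S \<in> lmeasurable" "emeasure lebesgue (T - S) < ennreal e'"
    using sets_lebesgue_outer_open[OF S e'] by blast
  \<comment> \<open>The centres lie in \<open>S\<close> itself, so that the Lipschitz bound compares
    the centre with every other point of \<open>S\<close> in the ball.\<close>
  define V where "V = {(x, r). x \<in> S \<and> 0 < r \<and> ball x r \<subseteq> T}"
  have vit: "\<exists>i. i \<in> V \<and> x \<in> ball (fst i) (snd i) \<and> snd i < dd"
    if xS: "x \<in> S" and dd: "0 < dd" for x and dd :: real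
  proof -
    obtain r where r: "r > 0" "ball x r \<subseteq> T"
      using openE[OF T(1)] T(2) xS by blast
    have "ball x (min r (dd/2)) \<subseteq> T" using r by auto
    then show ?thesis using r xS dd
      by (intro exI[of _ "(x, min r (dd/2))"]) (auto simp: V_def)
  qed
  obtain D where D: "countable D" "D \<subseteq> V"
     "pairwise (\<lambda>i j. disjnt (ball (fst i) (snd i)) (ball (fst j) (snd j))) D"
     "negligible (S - (\<Union>i \<in> D. ball (fst i) (snd i)))"
    using Vitali_covering_theorem_balls[of S V fst snd, OF vit] by blast
  define N where "N = S - (\<Union>i \<in> D. ball (fst i) (snd i))"
  have "negligible (f ` N)"
  proof (rule negligible_locally_Lipschitz_image)
    show "\<exists>T B. open T \<and> x \<in> T \<and> (\<forall>y \<in> N \<inter> T. norm (f y - f x) \<le> B * norm (y - x))" if "x \<in> N" for x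
      using lip that by (intro exI[of _ UNIV] exI[of _ C]) (auto simp: N_def dist_norm)
  qed (use D N_def in auto)
  then have fN: "f ` N \<in> null_sets lebesgue" by (simp add: negligible_iff_null_sets)
  let ?B = "\<Union>i\<in>D. cball (f (fst i)) (C * snd i)"
  have B: "?B \<in> sets lebesgue" using D by (intro sets.countable_UN') auto
  have sub: "f ` S \<subseteq> ?B \<union> f ` N"
  proof
    fix y assume "y \<in> f ` S"
    then obtain x where x: "x \<in> S" "y = f x" by auto
    show "y \<in> ?B \<union> f ` N"
    proof (cases "x \<in> N")
      case False
      then obtain i where i: "i \<in> D" "x \<in> ball (fst i) (snd i)" using x by (auto simp: N_def)
      then have "fst i \<in> S" using D by (auto simp: V_def)
      then have "dist (f (fst i)) (f x) \<le> C * dist (fst i) x" using lip x by auto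
      also have "\<dots> \<le> C * snd i" using i C by simp
      finally show ?thesis using i x by auto
    qed (use x in auto)
  qed
  have "emeasure lebesgue (f ` S) \<le> emeasure lebesgue (?B \<union> f ` N)"
    using B fN sub by (intro emeasure_mono) auto
  also have "\<dots> = emeasure lebesgue ?B"
    using B fN by (rule emeasure_Un_null_set)
  also have "\<dots> \<le> (\<integral>\<^sup>+i. emeasure lebesgue (cball (f (fst i)) (C * snd i)) \<partial>count_space D)"
    using D by (intro emeasure_UN_countable_le) auto
  also have "\<dots> = (\<integral>\<^sup>+i. ennreal (C ^ DIM('a)) * emeasure lebesgue (ball (fst i) (snd i)) \<partial>count_space D)"
  proof (intro nn_integral_cong)
    fix i assume "i \<in> space (count_space D)"
    then have "0 < snd i" using D by (auto simp: V_def)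
    then show "emeasure lebesgue (cball (f (fst i)) (C * snd i)) =
        ennreal (C ^ DIM('a)) * emeasure lebesgue (ball (fst i) (snd i))"
      using C by (simp add: emeasure_cball emeasure_ball power_mult_distrib
          ennreal_mult[symmetric] mult_ac)
  qed
  also have "\<dots> = ennreal (C ^ DIM('a)) * (\<integral>\<^sup>+i. emeasure lebesgue (ball (fst i) (snd i)) \<partial>count_space D)"
    by (rule nn_integral_cmult) auto
  also have "(\<integral>\<^sup>+i. emeasure lebesgue (ball (fst i) (snd i)) \<partial>count_space D) =
      emeasure lebesgue (\<Union>i\<in>D. ball (fst i) (snd i))"
    using D by (intro emeasure_UN_countable[symmetric])
      (auto simp: disjoint_family_on_def pairwise_def disjnt_def)
  also have "\<dots> \<le> emeasure lebesgue T"
  proof (intro emeasure_mono)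
    show "(\<Union>i\<in>D. ball (fst i) (snd i)) \<subseteq> T" using D(2) unfolding V_def by fastforce
  qed (use T in auto)
  also have "emeasure lebesgue T = emeasure lebesgue S + emeasure lebesgue (T - S)"
  proof -
    have "emeasure lebesgue S + emeasure lebesgue (T - S) = emeasure lebesgue (S \<union> (T - S))"
      using S T by (intro plus_emeasure) auto
    also have "S \<union> (T - S) = T" using T by auto
    finally show ?thesis ..
  qed
  also have "ennreal (C ^ DIM('a)) * (emeasure lebesgue S + emeasure lebesgue (T - S)) \<le>
     ennreal (C ^ DIM('a)) * (emeasure lebesgue S + ennreal e')"
    using T by (intro mult_left_mono add_left_mono) auto
  also have "\<dots> = ennreal (C ^ DIM('a)) * emeasure lebesgue S + ennreal e"
    using C e' by (simp add: distrib_left ennreal_mult[symmetric] e'_def)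
  finally show "emeasure lebesgue (f ` S) \<le> ennreal (C ^ DIM('a)) * emeasure lebesgue S + ennreal e"
    by (simp add: mult_left_mono)
qed

section \<open>Inversions: orthogonal part, measurability, change of variables\<close>

locale inversion_map =
  fixes \<iota> :: "'a::euclidean_space \<Rightarrow> 'a"
  assumes inversion_axiom: "inversion \<iota>"
begin

lemma inv_0 [simp]: "\<iota> 0 = 0"
  and inv_inv [simp]: "\<iota> (\<iota> x) = x"
  and norm_inv: "norm (\<iota> x) = 1 / norm x"
  and dist_inv: "x \<noteq> 0 \<Longrightarrow> y \<noteq> 0 \<Longrightarrow> dist (\<iota> x) (\<iota> y) = dist x y / (norm x * norm y)"
  using inversion_axiom by (cases "x = 0"; auto simp: inversion_def)+

lemma inv_eq_0_iff [simp]: "\<iota> x = 0 \<longleftrightarrow> x = 0"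
  by (metis inv_0 inv_inv)

lemma inj_inv: "inj \<iota>"
  by (metis injI inv_inv)

lemma image_inv_eq: "\<iota> ` S = \<iota> -` S"
  by (auto intro!: image_eqI[of _ \<iota> "\<iota> _"])

definition orth :: "'a \<Rightarrow> 'a" where "orth x = (norm x)\<^sup>2 *\<^sub>R \<iota> x"

lemma inv_eq_orth: "\<iota> x = orth x /\<^sub>R (norm x)\<^sup>2"
  by (cases "x = 0") (simp_all add: orth_def)

text \<open>Polarisation: squaring the distance identity leaves only the mixed inner product
  unknown, since the norms of the images are given.\<close>

lemma orth_inner: "orth x \<bullet> orth y = x \<bullet> y"
proof (cases "x = 0 \<or> y = 0")
  case False
  then have nz: "norm x \<noteq> 0" "norm y \<noteq> 0" by auto
  have "(dist (\<iota> x) (\<iota> y))\<^sup>2 = (dist x y / (norm x * norm y))\<^sup>2"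
    using dist_inv False by simp
  then have "(norm (\<iota> x))\<^sup>2 + (norm (\<iota> y))\<^sup>2 - 2 * (\<iota> x \<bullet> \<iota> y) =
      ((norm x)\<^sup>2 + (norm y)\<^sup>2 - 2 * (x \<bullet> y)) / ((norm x)\<^sup>2 * (norm y)\<^sup>2)"
    by (simp add: dist_norm power_divide power_mult_distrib power2_norm_eq_inner inner_diff_left
        inner_diff_right inner_commute)
  then have "2 * (\<iota> x \<bullet> \<iota> y) = 2 * (x \<bullet> y) / ((norm x)\<^sup>2 * (norm y)\<^sup>2)"
    using nz by (simp add: norm_inv power_divide field_simps)
  then show ?thesis using nz by (simp add: orth_def field_simps)
qed (auto simp: orth_def)

lemma norm_orth [simp]: "norm (orth x) = norm x"
  using orth_inner[of x x] by (simp add: norm_eq_sqrt_inner)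

text \<open>A map preserving inner products is linear: the squared norm of each defect expands into
  inner products that cancel.\<close>

lemma linear_orth: "linear orth"
proof -
  have *: "v = 0" if "v \<bullet> v = 0" for v :: 'a using that by simp
  have "orth (x + y) - orth x - orth y = 0" for x y
    by (rule *) (simp add: inner_diff_left inner_diff_right orth_inner inner_add_left inner_add_right)
  moreover have "orth (c *\<^sub>R x) - c *\<^sub>R orth x = 0" for c x
    by (rule *) (simp add: inner_diff_left inner_diff_right orth_inner)
  ultimately show ?thesis
    by (intro linearI) (auto simp: algebra_simps)
qed

lemma orth_orth [simp]: "orth (orth x) = x"
proof (cases "x = 0")
  case False
  have "\<iota> (\<iota> x) = x" by simp
  then have "orth (\<iota> x) /\<^sub>R (norm (\<iota> x))\<^sup>2 = x" by (subst (asm) inv_eq_orth)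
  moreover have "orth (\<iota> x) = orth (orth x) /\<^sub>R (norm x)\<^sup>2"
    by (subst inv_eq_orth) (simp add: linear_orth linear_cmul)
  ultimately show ?thesis using False by (simp add: norm_inv power_divide)
qed (simp add: orth_def)

lemma orth_inner_swap: "orth x \<bullet> y = x \<bullet> orth y"
  using orth_inner[of x "orth y"] by simp

lemma inv_inner: "\<iota> x \<bullet> y = (x \<bullet> orth y) / (norm x)\<^sup>2"
  by (simp add: inv_eq_orth orth_inner_swap divide_inverse mult.commute)

lemma continuous_on_inv: "continuous_on (- {0}) \<iota>"
proof -
  have "continuous_on (- {0}) (\<lambda>x. orth x /\<^sub>R (norm x)\<^sup>2)"
    using linear_orth by (intro continuous_intros linear_continuous_on) (auto simp: linear_conv_bounded_linear)
  moreover have "(\<lambda>x. orth x /\<^sub>R (norm x)\<^sup>2) = \<iota>" by (rule ext) (rule inv_eq_orth[symmetric])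
  ultimately show ?thesis by (rule back_subst)
qed

lemma isCont_inv: "x \<noteq> 0 \<Longrightarrow> isCont \<iota> x"
  using continuous_on_inv by (simp add: continuous_on_eq_continuous_at open_Compl)

lemma negligible_inv_image:
  assumes "negligible S" shows "negligible (\<iota> ` S)"
proof -
  have "negligible (\<iota> ` (S - {0}))"
  proof (rule negligible_locally_Lipschitz_image)
    show "negligible (S - {0})" using assms by (rule negligible_diff)
    fix x assume "x \<in> S - {0}"
    then have x: "x \<noteq> 0" by auto
    have "norm (\<iota> y - \<iota> x) \<le> (2 / (norm x)\<^sup>2) * norm (y - x)" if "y \<in> ball x (norm x / 2)" for y
    proof -
      have "norm x \<le> norm y + dist x y" by (metis dist_norm norm_triangle_sub add.commute)
      then have y: "norm y \<ge> norm x / 2" using that by auto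
      with x have "y \<noteq> 0" by auto
      then have "norm (\<iota> y - \<iota> x) = norm (y - x) / (norm y * norm x)"
        using dist_inv x by (simp add: dist_norm)
      also have "\<dots> \<le> norm (y - x) / ((norm x / 2) * norm x)"
        using x y \<open>y \<noteq> 0\<close> by (intro divide_left_mono mult_right_mono mult_pos_pos) auto
      finally show ?thesis by (simp add: power2_eq_square mult.commute)
    qed
    then show "\<exists>T B. open T \<and> x \<in> T \<and> (\<forall>y\<in>(S - {0}) \<inter> T. norm (\<iota> y - \<iota> x) \<le> B * norm (y - x))"
      using x by (intro exI[of _ "ball x (norm x / 2)"] exI[of _ "2 / (norm x)\<^sup>2"]) auto
  qed auto
  moreover have "\<iota> ` S \<subseteq> insert 0 (\<iota> ` (S - {0}))" by auto
  ultimately show ?thesis using negligible_subset by (metis negligible_insert)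
qed

lemma borel_measurable_inv: "\<iota> \<in> borel_measurable borel"
proof -
  have "(\<lambda>x. if x \<in> - {0} then \<iota> x else 0) \<in> borel_measurable borel"
    using continuous_on_inv by (intro borel_measurable_continuous_on_if) auto
  moreover have "(\<lambda>x. if x \<in> - {0} then \<iota> x else 0) = \<iota>" by (auto simp: fun_eq_iff)
  ultimately show ?thesis by simp
qed

lemma sets_lebesgue_inv_image:
  assumes "S \<in> sets lebesgue" shows "\<iota> ` S \<in> sets lebesgue"
proof -
  obtain A N N' where S: "S = A \<union> N" "N \<subseteq> N'" "N' \<in> null_sets lborel" "A \<in> sets lborel"
    using assms by (auto simp: sets_completion)
  have "negligible N'" using S by (simp add: negligible_iff_null_sets null_sets_completionI)
  then have "negligible (\<iota> ` N)" using S negligible_inv_image negligible_subset by blast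
  then have "\<iota> ` N \<in> sets lebesgue" by (simp add: negligible_imp_sets)
  moreover have "\<iota> -` A \<inter> space borel \<in> sets borel"
    using S borel_measurable_inv by (intro measurable_sets) auto
  then have "\<iota> ` A \<in> sets lebesgue" by (simp add: image_inv_eq)
  ultimately show ?thesis by (simp add: S image_Un)
qed

lemma measurable_inv [measurable]: "\<iota> \<in> measurable lebesgue lebesgue"
  using sets_lebesgue_inv_image by (intro measurableI) (auto simp: image_inv_eq)

text \<open>The absolute Jacobian determinant of the inversion, which scales lengths at
  \<open>x\<close> by the factor \<open>1 / (norm x)\<^sup>2\<close>.\<close>

definition jac :: "'a \<Rightarrow> ennreal" where "jac x = ennreal (1 / norm x ^ (2 * DIM('a)))"

lemma jac_measurable [measurable]: "jac \<in> borel_measurable lebesgue"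
proof -
  have "jac \<in> borel_measurable borel" unfolding jac_def by measurable
  then show ?thesis by (intro measurable_completion) simp
qed

lemma jac_inv: "x \<noteq> 0 \<Longrightarrow> jac (\<iota> x) * jac x = 1"
  by (simp add: jac_def norm_inv ennreal_mult[symmetric] power_one_over)

text \<open>On a shell of ratio \<open>q\<close> the inversion is Lipschitz with the constant at the
  inner radius, and the Jacobian varies by at most the factor
  \<open>q ^ (2 * DIM('a))\<close>.\<close>

lemma emeasure_inv_image_shell_le:
  assumes S: "S \<in> sets lebesgue" and r: "0 < r" "1 < q"
    and shell: "\<And>x. x \<in> S \<Longrightarrow> r \<le> norm x \<and> norm x < q * r"
  shows "emeasure lebesgue (\<iota> ` S) \<le> ennreal (q ^ (2 * DIM('a))) * (\<integral>\<^sup>+x\<in>S. jac x \<partial>lebesgue)"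
proof -
  have "emeasure lebesgue (\<iota> ` S) \<le> ennreal ((1 / r\<^sup>2) ^ DIM('a)) * emeasure lebesgue S"
  proof (rule emeasure_lipschitz_image_le)
    fix x y assume xy: "x \<in> S" "y \<in> S"
    then have n: "r \<le> norm x" "r \<le> norm y" using shell by auto
    then have "dist (\<iota> x) (\<iota> y) = dist x y / (norm x * norm y)"
      using r by (intro dist_inv) auto
    also have "\<dots> \<le> dist x y / (r * r)"
      using n r by (intro divide_left_mono mult_mono mult_pos_pos) auto
    finally show "dist (\<iota> x) (\<iota> y) \<le> 1 / r\<^sup>2 * dist x y" by (simp add: power2_eq_square)
  qed (use S r sets_lebesgue_inv_image in auto)
  also have "\<dots> = (\<integral>\<^sup>+x\<in>S. ennreal ((1 / r\<^sup>2) ^ DIM('a)) \<partial>lebesgue)"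
    using S by (simp add: nn_integral_cmult_indicator)
  also have "\<dots> \<le> (\<integral>\<^sup>+x\<in>S. ennreal (q ^ (2 * DIM('a))) * jac x \<partial>lebesgue)"
  proof (intro nn_integral_mono)
    fix x
    show "ennreal ((1 / r\<^sup>2) ^ DIM('a)) * indicator S x \<le> ennreal (q ^ (2 * DIM('a))) * jac x * indicator S x"
    proof (cases "x \<in> S")
      case True
      then have n: "r \<le> norm x" "norm x < q * r" using shell by auto
      have "(1 / r\<^sup>2) ^ DIM('a) = 1 / r ^ (2 * DIM('a))" by (simp add: power_mult power_one_over)
      also have "\<dots> \<le> q ^ (2 * DIM('a)) * (1 / norm x ^ (2 * DIM('a)))"
      proof -
        have "norm x ^ (2 * DIM('a)) \<le> (q * r) ^ (2 * DIM('a))"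
          using n by (intro power_mono) auto
        moreover have "0 < norm x ^ (2 * DIM('a))" "0 < r ^ (2 * DIM('a))"
          using r n by (auto intro!: zero_less_power)
        ultimately show ?thesis by (simp add: divide_simps power_mult_distrib mult.commute)
      qed
      finally show ?thesis using True r
        by (simp add: jac_def ennreal_mult[symmetric] ennreal_leI)
    qed simp
  qed
  also have "\<dots> = ennreal (q ^ (2 * DIM('a))) * (\<integral>\<^sup>+x\<in>S. jac x \<partial>lebesgue)"
    using S by (simp add: mult.assoc nn_integral_cmult)
  finally show ?thesis .
qed

text \<open>Cut the space into geometric shells of ratio \<open>q\<close>, add up the estimates for
  the shells, and let \<open>q\<close> decrease to 1.\<close>

lemma emeasure_inv_image_le:
  assumes S: "S \<in> sets lebesgue" and 0: "0 \<notin> S"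
  shows "emeasure lebesgue (\<iota> ` S) \<le> (\<integral>\<^sup>+x\<in>S. jac x \<partial>lebesgue)"
proof -
  have q: "emeasure lebesgue (\<iota> ` S) \<le> ennreal (q ^ (2 * DIM('a))) * (\<integral>\<^sup>+x\<in>S. jac x \<partial>lebesgue)"
    if q: "1 < q" for q :: real
  proof -
    define A where "A k = S \<inter> {x. q powr real_of_int k \<le> norm x \<and> norm x < q * q powr real_of_int k}" for k :: int
    have A[measurable]: "A k \<in> sets lebesgue" for k
      unfolding A_def using S by (intro sets.Int) auto
    have kk: "x \<in> A k \<longleftrightarrow> x \<in> S \<and> k = \<lfloor>log q (norm x)\<rfloor>" for x k
    proof (cases "x \<in> S")
      case True
      then have x: "norm x > 0" using 0 by (cases "x = 0") auto
      have qq: "q * q powr real_of_int k = q powr (real_of_int k + 1)"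
        using q by (simp add: powr_add)
      have "x \<in> A k \<longleftrightarrow> real_of_int k \<le> log q (norm x) \<and> log q (norm x) < real_of_int k + 1"
        using True q x unfolding A_def qq
        by (auto simp: le_log_iff log_less_iff)
      also have "\<dots> \<longleftrightarrow> k = \<lfloor>log q (norm x)\<rfloor>" by linarith
      finally show ?thesis using True by simp
    qed (auto simp: A_def)
    have SU: "S = (\<Union>k\<in>UNIV. A k)" by (auto simp: kk)
    have dj: "disjoint_family_on A UNIV" by (auto simp: disjoint_family_on_def kk)
    have "emeasure lebesgue (\<iota> ` S) = emeasure lebesgue (\<Union>k\<in>UNIV. \<iota> ` A k)"
      by (subst SU) (simp add: image_UN)
    also have "\<dots> \<le> (\<integral>\<^sup>+k. emeasure lebesgue (\<iota> ` A k) \<partial>count_space UNIV)"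
      using A sets_lebesgue_inv_image by (intro emeasure_UN_countable_le) auto
    also have "\<dots> \<le> (\<integral>\<^sup>+k. ennreal (q ^ (2 * DIM('a))) * (\<integral>\<^sup>+x\<in>A k. jac x \<partial>lebesgue) \<partial>count_space UNIV)"
      using q A by (intro nn_integral_mono emeasure_inv_image_shell_le[where r="q powr _"])
         (auto simp: A_def)
    also have "\<dots> = ennreal (q ^ (2 * DIM('a))) * (\<integral>\<^sup>+k. (\<integral>\<^sup>+x\<in>A k. jac x \<partial>lebesgue) \<partial>count_space UNIV)"
      by (intro nn_integral_cmult) auto
    also have "(\<integral>\<^sup>+k. (\<integral>\<^sup>+x\<in>A k. jac x \<partial>lebesgue) \<partial>count_space UNIV) =
        (\<integral>\<^sup>+k. emeasure (density lebesgue jac) (A k) \<partial>count_space UNIV)"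
      by (intro nn_integral_cong) (simp add: emeasure_density)
    also have "\<dots> = emeasure (density lebesgue jac) (\<Union>k\<in>UNIV. A k)"
      using dj by (intro emeasure_UN_countable[symmetric]) auto
    also have "\<dots> = (\<integral>\<^sup>+x\<in>S. jac x \<partial>lebesgue)"
      unfolding SU[symmetric] using S by (simp add: emeasure_density)
    finally show ?thesis .
  qed
  let ?I = "\<integral>\<^sup>+x\<in>S. jac x \<partial>lebesgue"
  have "((\<lambda>q. ennreal (q ^ (2 * DIM('a))) * ?I) \<longlongrightarrow> ennreal (1 ^ (2 * DIM('a))) * ?I) (at_right 1)"
    by (intro tendsto_intros) auto
  then have "((\<lambda>q. ennreal (q ^ (2 * DIM('a))) * ?I) \<longlongrightarrow> ?I) (at_right 1)" by simp
  then show ?thesis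
    by (rule tendsto_lowerbound) (auto intro!: eventually_at_rightI[of 1 2] q)
qed

text \<open>The preceding inequality gives one direction. The inversion being an involution, the
  same inequality used a second time gives the other, because the Jacobians at \<open>x\<close> and
  at its image multiply to 1.\<close>

theorem distr_jac_inv: "distr (density lebesgue jac) lebesgue \<iota> = lebesgue"
proof -
  let ?\<nu> = "distr (density lebesgue jac) lebesgue \<iota>"
  have \<nu>: "emeasure ?\<nu> E = (\<integral>\<^sup>+x\<in>\<iota> ` E. jac x \<partial>lebesgue)" if E: "E \<in> sets lebesgue" for E
    using E sets_lebesgue_inv_image[OF E]
    by (simp add: emeasure_distr emeasure_density image_inv_eq)
  have drop0: "emeasure lebesgue (E - {0}) = emeasure lebesgue E" if "E \<in> sets lebesgue" for E :: "'a set"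
    using that by (intro emeasure_Diff_null_set) auto
  have le: "emeasure lebesgue E \<le> emeasure ?\<nu> E" if E: "E \<in> sets lebesgue" for E
  proof -
    let ?E = "\<iota> ` (E - {0})"
    have m: "?E \<in> sets lebesgue" using E by (intro sets_lebesgue_inv_image) auto
    have "emeasure lebesgue E = emeasure lebesgue (E - {0})" using drop0[OF E] by simp
    also have "E - {0} = \<iota> ` ?E" by (simp add: image_image)
    also have "emeasure lebesgue (\<iota> ` ?E) \<le> (\<integral>\<^sup>+x\<in>?E. jac x \<partial>lebesgue)"
      using m by (rule emeasure_inv_image_le) auto
    also have "\<dots> \<le> (\<integral>\<^sup>+x\<in>\<iota> ` E. jac x \<partial>lebesgue)"
      by (intro nn_integral_mono) (auto split: split_indicator)
    finally show ?thesis using \<nu>[OF E] by simp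
  qed
  have "emeasure lebesgue E \<le> emeasure ?\<nu> E" for E
    using le[of E] emeasure_notin_sets[of E lebesgue] by (cases "E \<in> sets lebesgue") auto
  then have LE: "lebesgue \<le> ?\<nu>"
    by (intro less_eq_measure.intros(3) le_funI) auto
  show ?thesis
  proof (rule measure_eqI)
    show "sets ?\<nu> = sets lebesgue" by (rule sets_distr)
    fix E assume "E \<in> sets ?\<nu>"
    then have E: "E \<in> sets lebesgue" by simp
    have ins: "insert 0 E \<in> sets lebesgue" using sets.Un[of "{0}" lebesgue E] E by simp
    have i [measurable]: "\<iota> ` E \<in> sets lebesgue" using E by (rule sets_lebesgue_inv_image)
    have "emeasure ?\<nu> E = (\<integral>\<^sup>+x. jac x * indicator (\<iota> ` E) x \<partial>lebesgue)" by (rule \<nu>[OF E])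
    \<comment> \<open>The inequality between the two measures is applied here to the integral of the
      Jacobian itself.\<close>
    also have "\<dots> \<le> (\<integral>\<^sup>+x. jac x * indicator (\<iota> ` E) x \<partial>?\<nu>)"
      using LE by (intro nn_integral_mono_measure) auto
    also have "\<dots> = (\<integral>\<^sup>+x. jac (\<iota> x) * indicator (\<iota> ` E) (\<iota> x) \<partial>density lebesgue jac)"
      using i by (intro nn_integral_distr) measurable
    also have "\<dots> = (\<integral>\<^sup>+x. jac x * (jac (\<iota> x) * indicator (\<iota> ` E) (\<iota> x)) \<partial>lebesgue)"
      using i by (intro nn_integral_density) measurable
    also have "\<dots> \<le> (\<integral>\<^sup>+x. indicator (insert 0 E) x \<partial>lebesgue)"
    proof (intro nn_integral_mono)
      fix x
      show "jac x * (jac (\<iota> x) * indicator (\<iota> ` E) (\<iota> x)) \<le> indicator (insert 0 E) x"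
      proof (cases "x = 0")
        case True
        then have "jac x = 0" using DIM_positive[where 'a='a] by (simp add: jac_def power_0_left)
        then show ?thesis by simp
      next
        case False
        then have "jac x * jac (\<iota> x) = 1" using jac_inv[of x] by (simp add: mult.commute)
        moreover have "\<iota> x \<in> \<iota> ` E \<longleftrightarrow> x \<in> E" by (simp add: inj_image_mem_iff[OF inj_inv])
        ultimately show ?thesis by (auto simp flip: mult.assoc split: split_indicator)
      qed
    qed
    also have "\<dots> = emeasure lebesgue (insert 0 E)" using ins by (subst nn_integral_indicator) auto
    also have "\<dots> = emeasure lebesgue E"
      using drop0[of "insert 0 E"] drop0[OF E] ins by simp
    finally show "emeasure ?\<nu> E = emeasure lebesgue E" using le[OF E] by (rule antisym)
  qed
qed

lemma nn_integral_inv: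
  assumes [measurable]: "f \<in> borel_measurable lebesgue"
  shows "(\<integral>\<^sup>+x. f (\<iota> x) * jac x \<partial>lebesgue) = (\<integral>\<^sup>+x. f x \<partial>lebesgue)"
proof -
  have "(\<integral>\<^sup>+x. f x \<partial>lebesgue) = (\<integral>\<^sup>+x. f x \<partial>distr (density lebesgue jac) lebesgue \<iota>)"
    by (rule arg_cong[OF distr_jac_inv[symmetric]])
  also have "\<dots> = (\<integral>\<^sup>+x. f (\<iota> x) \<partial>density lebesgue jac)"
    by (intro nn_integral_distr) measurable
  also have "\<dots> = (\<integral>\<^sup>+x. jac x * f (\<iota> x) \<partial>lebesgue)"
    by (intro nn_integral_density) measurable
  finally show ?thesis by (simp add: mult.commute)
qed

end

section \<open>Lattice geometry and the cells\<close>

lemma not_sorted_wrt_split: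
  "\<not> sorted_wrt P us \<Longrightarrow> \<exists>xs u ys v ws. us = xs @ u # ys @ v # ws \<and> \<not> P u v"
proof (induction us)
  case (Cons u us)
  show ?case
  proof (cases "sorted_wrt P us")
    case True
    then obtain v where "v \<in> set us" "\<not> P u v" using Cons.prems by auto
    then show ?thesis by (metis append_Nil split_list)
  next
    case False
    then show ?thesis using Cons.IH by (metis append_Cons)
  qed
qed simp

lemma inner_sum_list_left: "x \<bullet> sum_list us = (\<Sum>u\<leftarrow>us. x \<bullet> u)"
  by (induction us) (auto simp: inner_add_right)

lemma finite_separated_bounded:
  fixes S :: "'a::euclidean_space set"
  assumes "bounded S" and sep: "\<And>x y. x \<in> S \<Longrightarrow> y \<in> S \<Longrightarrow> x \<noteq> y \<Longrightarrow> 1 \<le> dist x y"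
  shows "finite S"
proof (rule ccontr)
  assume "infinite S"
  then obtain l where l: "l islimpt S"
    using bounded_infinite_imp_islimpt[OF _ assms(1), of S] by auto
  obtain x where x: "x \<in> S" "x \<noteq> l" "dist x l < 1/2"
    using l unfolding islimpt_approachable by (meson zero_less_divide_1_iff zero_less_numeral)
  obtain y where y: "y \<in> S" "y \<noteq> l" "dist y l < dist x l"
    using l x unfolding islimpt_approachable by (meson zero_less_dist_iff)
  have "x \<noteq> y" using y by auto
  then have "1 \<le> dist x y" using sep x y by auto
  also have "\<dots> \<le> dist x l + dist y l" by (metis dist_triangle2)
  finally show False using x y by linarith
qed

locale cf_lattice = inversion_map \<iota> for \<iota> :: "'a::euclidean_space \<Rightarrow> 'a" +
  fixes Z K :: "'a set"
  assumes lat: "lattice Z"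
    and dir: "dirichlet_region Z K"
    and integ: "integral_lattice Z"
    and unit: "unit_generated Z"
    and ne: "norm_euclidean K"
    and nice: "nicely_invertible Z \<iota>"
    and remote: "three_remote Z K \<or> seven_remote Z K"
begin

section \<open>Integrality, discreteness and units of the lattice\<close>

lemma Z_0 [simp]: "0 \<in> Z"
  and Z_add: "x \<in> Z \<Longrightarrow> y \<in> Z \<Longrightarrow> x + y \<in> Z"
  and Z_diff: "x \<in> Z \<Longrightarrow> y \<in> Z \<Longrightarrow> x - y \<in> Z"
  using lat by (auto simp: lattice_def)

lemma Z_uminus: "x \<in> Z \<Longrightarrow> - x \<in> Z"
  using Z_diff[of 0 x] by simp

lemma Z_scaleR_nat: "z \<in> Z \<Longrightarrow> real n *\<^sub>R z \<in> Z"
  by (induction n) (auto simp: scaleR_left_distrib Z_add)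

lemma Z_scaleR_int: "z \<in> Z \<Longrightarrow> of_int k *\<^sub>R z \<in> Z"
  by (cases k rule: int_cases2) (use Z_scaleR_nat Z_uminus in \<open>auto simp: Z_uminus\<close>)

lemma Z_norm_sq: "z \<in> Z \<Longrightarrow> z \<bullet> z \<in> \<int>"
  using integ by (auto simp: integral_lattice_def)

lemma Z_double_inner: "z \<in> Z \<Longrightarrow> w \<in> Z \<Longrightarrow> 2 * (z \<bullet> w) \<in> \<int>"
proof -
  assume zw: "z \<in> Z" "w \<in> Z"
  have "2 * (z \<bullet> w) = (z + w) \<bullet> (z + w) - z \<bullet> z - w \<bullet> w"
    by (simp add: inner_add_left inner_add_right inner_commute)
  then show ?thesis using zw by (simp add: Z_norm_sq Z_add)
qed

lemma orth_Z: "z \<in> Z \<Longrightarrow> orth z \<in> Z"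
  using nice by (cases "z = 0") (auto simp: nicely_invertible_def orth_def)

lemma Z_norm_ge_1: "z \<in> Z \<Longrightarrow> z \<noteq> 0 \<Longrightarrow> 1 \<le> norm z"
proof -
  assume z: "z \<in> Z" "z \<noteq> 0"
  obtain n where n: "z \<bullet> z = of_int n" using Z_norm_sq[OF z(1)] by (auto elim: Ints_cases)
  have "0 < z \<bullet> z" using z by simp
  then have "1 \<le> z \<bullet> z" using n by simp
  then show ?thesis by (simp add: norm_eq_sqrt_inner)
qed

lemma finite_Z_cball: "finite (Z \<inter> cball x R)"
proof (rule finite_separated_bounded)
  show "1 \<le> dist z w" if "z \<in> Z \<inter> cball x R" "w \<in> Z \<inter> cball x R" "z \<noteq> w" for z w
    using that Z_norm_ge_1[of "z - w"] Z_diff by (auto simp: dist_norm)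
  show "bounded (Z \<inter> cball x R)" by (rule bounded_subset[OF bounded_cball]) auto
qed

lemma countable_Z: "countable Z"
proof -
  have "Z \<subseteq> (\<Union>n::nat. Z \<inter> cball 0 (real n))"
    using real_arch_simple by fastforce
  moreover have "countable (\<Union>n::nat. Z \<inter> cball 0 (real n))"
    using finite_Z_cball countable_finite by (intro countable_UN) auto
  ultimately show ?thesis using countable_subset by blast
qed

definition units :: "'a set" where "units = {u \<in> Z. norm u = 1}"

lemma unitsD: "u \<in> units \<Longrightarrow> u \<in> Z" "u \<in> units \<Longrightarrow> norm u = 1" "u \<in> units \<Longrightarrow> u \<bullet> u = 1"
  by (auto simp: units_def norm_eq_1)

lemma finite_units: "finite units"
  by (rule finite_subset[OF _ finite_Z_cball[of 0 1]]) (auto simp: units_def)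

text \<open>Compactness of the quotient forces a nonzero lattice vector, and a nonzero vector is a
  nonempty sum of units.\<close>

lemma units_ne: "\<exists>u. u \<in> units"
proof -
  obtain C where C: "compact C" "\<forall>x. \<exists>z\<in>Z. \<exists>c\<in>C. x = z + c"
    using lat by (auto simp: lattice_def)
  then obtain B where B: "\<And>c. c \<in> C \<Longrightarrow> norm c \<le> B"
    using compact_imp_bounded bounded_iff by metis
  obtain b :: 'a where b: "b \<in> Basis" using nonempty_Basis by blast
  obtain z c where z: "z \<in> Z" "c \<in> C" "(\<bar>B\<bar> + 1) *\<^sub>R b = z + c" using C by meson
  have "z \<noteq> 0"
  proof
    assume "z = 0"
    then have "norm ((\<bar>B\<bar> + 1) *\<^sub>R b) = norm c" using z by simp
    then show False using B[OF z(2)] b by simp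
  qed
  moreover obtain us where "set us \<subseteq> units" "sum_list us = z"
    using unit z unfolding unit_generated_def units_def by blast
  ultimately show ?thesis by (cases us) auto
qed

text \<open>In a shortest representation as a sum of units no two summands have negative inner
  product, as they could be replaced by their sum, which has norm 0 or 1.\<close>

lemma units_decomp:
  assumes "z \<in> Z"
  shows "\<exists>us. set us \<subseteq> units \<and> sum_list us = z \<and> real (length us) \<le> z \<bullet> z"
proof -
  define P where "P us \<longleftrightarrow> set us \<subseteq> units \<and> sum_list us = z" for us
  have "\<exists>us. P us" using unit assms unfolding unit_generated_def units_def P_def by blast
  then obtain us where us: "P us" and least: "\<And>vs. P vs \<Longrightarrow> length us \<le> length vs"
    using arg_min_natI[of P _ length] arg_min_nat_le[of P _ length] by metis
  have "sorted_wrt (\<lambda>u v. 0 \<le> u \<bullet> v) us"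
  proof (rule ccontr)
    assume "\<not> ?thesis"
    then obtain xs u ys v ws where d: "us = xs @ u # ys @ v # ws" "\<not> 0 \<le> u \<bullet> v"
      using not_sorted_wrt_split[of "\<lambda>u v. 0 \<le> u \<bullet> v" us] by auto
    have uv: "u \<in> units" "v \<in> units" using us d by (auto simp: P_def)
    note uv1 = unitsD(1)[OF uv(1)] unitsD(1)[OF uv(2)] unitsD(3)[OF uv(1)] unitsD(3)[OF uv(2)]
    obtain k where k: "2 * (u \<bullet> v) = of_int k"
      using Z_double_inner[of u v] uv1 by (auto elim: Ints_cases)
    have "\<bar>u \<bullet> v\<bar> \<le> 1"
      using Cauchy_Schwarz_ineq2[of u v] unitsD(2)[OF uv(1)] unitsD(2)[OF uv(2)] by simp
    then have "real_of_int k \<ge> -2" "real_of_int k < 0" using d k by linarith+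
    then have "k = -2 \<or> k = -1" by linarith
    then have "(u + v) \<bullet> (u + v) \<in> {0, 1}"
      using k uv1 by (auto simp: inner_add_left inner_add_right inner_commute[of v u])
    then have "u + v = 0 \<or> u + v \<in> units"
      using uv1 Z_add[of u v] by (auto simp: units_def norm_eq_1)
    then have "P (xs @ ys @ ws) \<or> P ((u + v) # xs @ ys @ ws)"
      using us d by (auto simp: P_def algebra_simps)
    then show False using least d by fastforce
  qed
  moreover have "real (length vs) \<le> sum_list vs \<bullet> sum_list vs"
    if "set vs \<subseteq> units" "sorted_wrt (\<lambda>u v. 0 \<le> u \<bullet> v) vs" for vs
    using that
  proof (induction vs)
    case (Cons v vs)
    have "0 \<le> v \<bullet> sum_list vs"
      using Cons.prems by (auto simp: inner_sum_list_left intro!: sum_list_nonneg)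
    moreover have "v \<bullet> v = 1" using Cons.prems unitsD(3)[of v] by simp
    moreover have "real (length vs) \<le> sum_list vs \<bullet> sum_list vs" using Cons by simp
    moreover have "sum_list (v # vs) \<bullet> sum_list (v # vs) =
        v \<bullet> v + 2 * (v \<bullet> sum_list vs) + sum_list vs \<bullet> sum_list vs"
      by (simp add: inner_add_left inner_add_right inner_commute[of "sum_list vs" v])
    ultimately show ?case by simp
  qed simp
  ultimately have "real (length us) \<le> sum_list us \<bullet> sum_list us" using us unfolding P_def by blast
  then show ?thesis using us unfolding P_def by blast
qed

section \<open>The open polyhedron cut out by the units\<close>

definition Ko :: "'a set" where "Ko = {x. \<forall>u\<in>units. x \<bullet> u < 1/2}"

lemma open_Ko: "open Ko"
proof -
  have "Ko = (\<Inter>u\<in>units. {x. x \<bullet> u < 1/2})" by (auto simp: Ko_def)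
  then show ?thesis using finite_units
    by (auto intro!: open_INT open_Collect_less continuous_intros)
qed

lemma convex_Ko: "convex Ko"
proof -
  have "Ko = (\<Inter>u\<in>units. {x. u \<bullet> x < 1/2})" by (auto simp: Ko_def inner_commute)
  then show ?thesis by (simp only:) (intro convex_INT convex_halfspace_lt)
qed

lemma ball_subset_Ko: "ball 0 (1/2) \<subseteq> Ko"
proof
  fix x :: 'a assume x: "x \<in> ball 0 (1/2)"
  have "x \<bullet> u < 1/2" if "u \<in> units" for u
    using Cauchy_Schwarz_ineq2[of x u] x unitsD(2)[OF that] by auto
  then show "x \<in> Ko" by (simp add: Ko_def)
qed

text \<open>\<open>z\<close> is a sum of at most \<open>z \<bullet> z\<close> units, and each
  summand contributes less than 1/2. Thus the units alone determine the Dirichlet region.\<close>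

lemma Ko_inner_less:
  assumes "x \<in> Ko" "z \<in> Z" "z \<noteq> 0" shows "x \<bullet> z < (z \<bullet> z) / 2"
proof -
  obtain us where us: "set us \<subseteq> units" "sum_list us = z" "real (length us) \<le> z \<bullet> z"
    using units_decomp[OF assms(2)] by blast
  have "us = [] \<or> (\<Sum>u\<leftarrow>us. x \<bullet> u) < real (length us) / 2" using us(1)
    by (induction us) (use assms(1) in \<open>fastforce simp: Ko_def field_simps\<close>)+
  then show ?thesis using us assms(3) by (auto simp: inner_sum_list_left)
qed

lemma K_inner_le:
  assumes "x \<in> K" "z \<in> Z" shows "x \<bullet> z \<le> (z \<bullet> z) / 2"
proof -
  have "dist x 0 \<le> dist x z"
    using dir assms by (auto simp: dirichlet_region_def dirichlet_closed_def)
  then have "(norm x)\<^sup>2 \<le> (norm (x - z))\<^sup>2" by (simp add: dist_norm power_mono)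
  then show ?thesis
    by (simp add: power2_norm_eq_inner inner_diff_left inner_diff_right inner_commute)
qed

lemma nearest: "nearest Z K x \<in> Z" "x - nearest Z K x \<in> K"
  using dir theI'[of "\<lambda>z. z \<in> Z \<and> x - z \<in> K"]
  by (auto simp: dirichlet_region_def nearest_def)

lemma nearest_eqI: "z \<in> Z \<Longrightarrow> x - z \<in> K \<Longrightarrow> nearest Z K x = z"
  using dir nearest unfolding dirichlet_region_def by metis

text \<open>Independently of the boundary choice, the lattice point assigned to a point of
  \<open>Ko\<close> is 0: any other one would violate the strict inequality for lattice
  vectors.\<close>

lemma Ko_subset_K: "Ko \<subseteq> K"
proof
  fix x assume x: "x \<in> Ko"
  let ?z = "nearest Z K x"
  show "x \<in> K"
  proof (cases "?z = 0")
    case False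
    have "(x - ?z) \<bullet> (- ?z) \<le> ((- ?z) \<bullet> (- ?z)) / 2"
      by (rule K_inner_le) (use nearest Z_uminus in auto)
    then have "?z \<bullet> ?z / 2 \<le> x \<bullet> ?z" by (simp add: inner_diff_left)
    then show ?thesis using Ko_inner_less[OF x nearest(1) False] by simp
  qed (use nearest[of x] in simp)
qed

lemma zero_in_K: "0 \<in> K"
  using ball_subset_Ko Ko_subset_K by force

text \<open>The supremum in \<open>norm_euclidean\<close> is informative only for a bounded set;
  boundedness comes from the compact set of representatives.\<close>

lemma bounded_K: "bounded K"
proof -
  obtain C where C: "compact C" "\<forall>x. \<exists>z\<in>Z. \<exists>c\<in>C. x = z + c"
    using lat by (auto simp: lattice_def)
  then obtain B where B: "\<And>c. c \<in> C \<Longrightarrow> norm c \<le> B"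
    using compact_imp_bounded bounded_iff by metis
  have "norm x \<le> B" if x: "x \<in> K" for x
  proof -
    obtain z c where z: "z \<in> Z" "c \<in> C" "x = z + c" using C by meson
    have "dist x 0 \<le> dist x z"
      using dir x z by (auto simp: dirichlet_region_def dirichlet_closed_def)
    then show ?thesis using B[OF z(2)] z by (simp add: dist_norm)
  qed
  then show ?thesis by (auto simp: bounded_iff)
qed

text \<open>The maximum makes positivity immediate. It does not change the value, as
  \<open>K\<close> contains the open ball of radius 1/2.\<close>

definition \<rho> :: real where "\<rho> = max (1/2) (SUP x\<in>K. norm x)"

lemma rho: "0 < \<rho>" "\<rho> < 1" and norm_K: "x \<in> K \<Longrightarrow> norm x \<le> \<rho>"
proof -
  show "0 < \<rho>" "\<rho> < 1" using ne by (auto simp: \<rho>_def norm_euclidean_def)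
  assume x: "x \<in> K"
  have "bdd_above (norm ` K)" using bounded_K by (auto simp: bounded_iff bdd_above_def)
  then show "norm x \<le> \<rho>" using cSUP_upper[OF x, of norm] by (simp add: \<rho>_def)
qed

text \<open>Coefficient bound for the finite family of forms. The critical cases just beyond it are
  \<open>A = 1\<close>, \<open>C = 2\<close> with \<open>z \<bullet> z = 3\<close>, and
  \<open>A = 2\<close>, \<open>C = 3\<close> with \<open>z \<bullet> z = 7\<close>; these are the
  ones excluded by remoteness.\<close>

definition mm :: int where "mm = (if three_remote Z K then 1 else 2)"

section \<open>Integral quadratic forms and the bound on their coefficients\<close>

definition qf :: "int \<Rightarrow> 'a \<Rightarrow> int \<Rightarrow> 'a \<Rightarrow> real" where
  "qf A z C x = of_int A * (x \<bullet> x) - 2 * (x \<bullet> z) + of_int C"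

text \<open>The zero sets of forms are spheres and hyperplanes; the family of all forms is
  invariant under translations by the lattice and under the inversion.\<close>
definition form :: "int \<Rightarrow> 'a \<Rightarrow> int \<Rightarrow> bool" where
  "form A z C \<longleftrightarrow> z \<in> Z \<and> z \<bullet> z = 1 + of_int A * of_int C"

lemma qf_uminus: "qf (-A) (-z) (-C) x = - qf A z C x"
  by (simp add: qf_def)

lemma form_uminus: "form A z C \<Longrightarrow> form (-A) (-z) (-C)"
  by (auto simp: form_def Z_uminus)

lemma continuous_on_qf: "continuous_on S (qf A z C)"
  unfolding qf_def by (intro continuous_intros)

text \<open>Remoteness is a weak inequality for the distance to \<open>K\<close>. Openness of
  \<open>Ko\<close> sharpens it: a point of \<open>Ko\<close> at exactly the critical distance could
  be moved closer to the centre.\<close>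

lemma Ko_move_closer:
  assumes "x \<in> Ko" "x \<noteq> c" shows "\<exists>y\<in>K. dist c y < dist c x"
proof -
  obtain e where e: "e > 0" "ball x e \<subseteq> Ko" using open_Ko assms openE by metis
  define t where "t = min (1/2) (e / (2 * dist x c))"
  have t: "0 < t" "t < 1" "t * dist x c < e"
  proof -
    have "dist x c > 0" using assms by simp
    then show "0 < t" "t < 1" using e by (auto simp: t_def)
    have "t * dist x c \<le> e / (2 * dist x c) * dist x c"
      by (intro mult_right_mono) (auto simp: t_def)
    also have "\<dots> < e" using \<open>dist x c > 0\<close> e by simp
    finally show "t * dist x c < e" .
  qed
  define y where "y = x + t *\<^sub>R (c - x)"
  have "dist x y = t * dist x c" using t by (simp add: y_def dist_norm norm_minus_commute)
  then have "y \<in> Ko" using e t by auto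
  moreover have "c - y = (1 - t) *\<^sub>R (c - x)" by (simp add: y_def algebra_simps)
  then have "dist c y = (1 - t) * dist c x" using t by (simp add: dist_norm)
  moreover have "\<dots> < 1 * dist c x" using t assms by (intro mult_strict_right_mono) auto
  ultimately show ?thesis using Ko_subset_K by (intro bexI[of _ y]) auto
qed

text \<open>The inversion swaps the outer coefficients of a form. This bound shows that the forms with
  leading coefficient at most \<open>mm\<close> whose zero set cuts \<open>Ko\<close> are again of this kind after the
  inversion; it is the only place where remoteness enters.\<close>
lemma form_bound:
  assumes "form A z C" "\<bar>A\<bar> \<le> mm" "x \<in> Ko" "qf A z C x = 0"
  shows "\<bar>C\<bar> \<le> mm"
proof -
  have pos: "\<bar>C\<bar> \<le> mm" if f: "form A z C" and A: "0 \<le> A" "A \<le> mm" and q: "qf A z C x = 0" for A z C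
  proof -
    have xK: "x \<in> K" using assms Ko_subset_K by auto
    have nx: "norm x < 1" using norm_K[OF xK] rho by simp
    have z: "z \<in> Z" "z \<bullet> z = 1 + of_int A * of_int C" using f by (auto simp: form_def)
    have mm12: "mm = 1 \<or> mm = 2" by (simp add: mm_def)
    have "A = 0 \<or> A = 1 \<or> (A = 2 \<and> mm = 2)" using A mm12 by linarith
    then consider "A = 0" | "A = 1" | "A = 2" "mm = 2" by blast
    then show ?thesis
    proof cases
      case 1
      then have "z \<in> units" "- z \<in> units" using z by (auto simp: units_def norm_eq_1 Z_uminus)
      then have "x \<bullet> z < 1/2" "x \<bullet> (- z) < 1/2" using assms(3) unfolding Ko_def by blast+
      then have "\<bar>2 * (x \<bullet> z)\<bar> < 1" by simp
      then show ?thesis using q 1 by (auto simp: qf_def mm_def)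
    next
      case 2
      \<comment> \<open>For \<open>A = 1\<close> the zero set is the unit sphere about
        \<open>z\<close>. As \<open>norm x < 1\<close>, the centre has norm below 2, hence
        \<open>C \<le> 2\<close>, and equality means that \<open>norm z\<close> is
        \<open>sqrt 3\<close>.\<close>
      have "(norm (z - x))\<^sup>2 = 1" using q z 2
        by (simp add: qf_def power2_norm_eq_inner inner_diff_left inner_diff_right inner_commute)
      then have d: "dist z x = 1"
        using norm_ge_zero[of "z - x"] by (auto simp: dist_norm power2_eq_1_iff simp del: norm_ge_zero)
      then have "norm z < 2" using nx norm_triangle_ineq[of "z - x" x] by (simp add: dist_norm)
      then have "z \<bullet> z < 4" using power_strict_mono[of "norm z" 2 2] by (simp add: power2_norm_eq_inner)
      then have C: "C \<le> 2" "-1 \<le> C" using z 2 inner_ge_zero[of z] by auto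
      show ?thesis
      proof (cases "three_remote Z K")
        case True
        have "C \<noteq> 2"
        proof
          assume "C = 2"
          then have "norm z = sqrt 3" using z 2 by (simp add: norm_eq_sqrt_inner)
          then have "infdist z K \<ge> 1" using True z by (auto simp: three_remote_def)
          moreover obtain y where "y \<in> K" "dist z y < 1"
            using Ko_move_closer[OF assms(3), of z] d by fastforce
          ultimately show False using infdist_le[of y K z] by simp
        qed
        then show ?thesis using C True by (auto simp: mm_def)
      qed (use C in \<open>auto simp: mm_def\<close>)
    next
      case 3
      then have nt: "\<not> three_remote Z K" by (auto simp: mm_def)
      then have sr: "seven_remote Z K" using remote by auto
      \<comment> \<open>For \<open>A = 2\<close> the zero set is the sphere of radius 1/2 about the
        midpoint \<open>z /\<^sub>R 2\<close>. Then \<open>norm z < 3\<close>, hence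
        \<open>C \<le> 3\<close>, and equality means that \<open>norm z\<close> is
        \<open>sqrt 7\<close>.\<close>
      have "(norm (z /\<^sub>R 2 - x))\<^sup>2 = (z \<bullet> z) / 4 - x \<bullet> z + x \<bullet> x"
        by (simp add: power2_norm_eq_inner inner_diff_left inner_diff_right inner_commute)
      also have "\<dots> = (1/2)\<^sup>2" using q z 3 by (simp add: qf_def power2_eq_square field_simps)
      finally have "(norm (z /\<^sub>R 2 - x))\<^sup>2 = (1/2)\<^sup>2" .
      then have "norm (z /\<^sub>R 2 - x) = 1/2" by (rule power2_eq_imp_eq) auto
      then have d: "dist (z /\<^sub>R 2) x = 1/2" by (simp add: dist_norm)
      then have "norm (z /\<^sub>R 2) < 3/2" using nx norm_triangle_ineq[of "z /\<^sub>R 2 - x" x] by (simp add: dist_norm)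
      then have "norm z < 3" by simp
      then have "z \<bullet> z < 9" using power_strict_mono[of "norm z" 3 2] by (simp add: power2_norm_eq_inner)
      then have "1 + 2 * real_of_int C < 9" "0 \<le> 1 + 2 * real_of_int C"
        using z 3 inner_ge_zero[of z] by auto
      then have C: "C \<le> 3" "0 \<le> C" by linarith+
      have "C \<noteq> 3"
      proof
        assume "C = 3"
        then have "norm z = sqrt 7" using z 3 by (simp add: norm_eq_sqrt_inner)
        then have "infdist (z /\<^sub>R 2) K \<ge> 1/2" using sr z by (auto simp: seven_remote_def)
        moreover obtain y where "y \<in> K" "dist (z /\<^sub>R 2) y < 1/2"
          using Ko_move_closer[OF assms(3), of "z /\<^sub>R 2"] d by fastforce
        ultimately show False using infdist_le[of y K "z /\<^sub>R 2"] by simp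
      qed
      then show ?thesis using C 3 by auto
    qed
  qed
  show ?thesis
  proof (cases "A \<ge> 0")
    case True
    then show ?thesis using pos[of A z C] assms by auto
  next
    case False
    then show ?thesis using pos[of "-A" "-z" "-C"] assms by (auto simp: form_uminus qf_uminus)
  qed
qed

section \<open>The finite family of forms, generic points and cells\<close>

definition Phi :: "(int \<times> 'a \<times> int) set" where
  "Phi = {(A, z, C). form A z C \<and> \<bar>A\<bar> \<le> mm \<and> \<bar>C\<bar> \<le> mm}"

lemma Phi_bounds:
  assumes "(A, z, C) \<in> Phi" shows "\<bar>A\<bar> \<le> 2" "norm z \<le> 5"
proof -
  have f: "form A z C" "\<bar>A\<bar> \<le> 2" "\<bar>C\<bar> \<le> 2" using assms by (auto simp: Phi_def mm_def split: if_splits)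
  then show "\<bar>A\<bar> \<le> 2" by simp
  have "\<bar>A * C\<bar> \<le> 2 * 2" unfolding abs_mult using f by (intro mult_mono) auto
  then have "real_of_int (A * C) \<le> 4" by linarith
  then have "(norm z)\<^sup>2 \<le> 5\<^sup>2" using f by (simp add: form_def power2_norm_eq_inner)
  then show "norm z \<le> 5" by (rule power2_le_imp_le) auto
qed

lemma finite_Phi: "finite Phi"
proof -
  have "Phi \<subseteq> {-2..2} \<times> (Z \<inter> cball 0 5) \<times> {-2..2}"
  proof
    fix p assume p: "p \<in> Phi"
    obtain A z C where pA: "p = (A, z, C)" by (cases p) auto
    have "form A z C" "\<bar>A\<bar> \<le> 2" "\<bar>C\<bar> \<le> 2" using p pA by (auto simp: Phi_def mm_def split: if_splits)
    then show "p \<in> {-2..2} \<times> (Z \<inter> cball 0 5) \<times> {-2..2}"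
      using Phi_bounds(2)[of A z C] p pA by (auto simp: form_def)
  qed
  then show ?thesis using finite_Z_cball finite_subset by (metis finite_SigmaI finite_atLeastAtMost_int)
qed

definition sim :: "'a \<Rightarrow> 'a \<Rightarrow> bool" where
  "sim x y \<longleftrightarrow> (\<forall>(A, z, C)\<in>Phi. sgn (qf A z C x) = sgn (qf A z C y))"

text \<open>The generic points. Removing the zero sets makes every sign class open and hides the
  boundary choice made in \<open>K\<close>.\<close>

definition K0 :: "'a set" where "K0 = {x \<in> Ko. \<forall>(A, z, C)\<in>Phi. qf A z C x \<noteq> 0}"

lemma sim_refl [simp]: "sim x x" and sim_sym: "sim x y \<Longrightarrow> sim y x"
  and sim_trans: "sim x y \<Longrightarrow> sim y z \<Longrightarrow> sim x z"
  unfolding sim_def by (fastforce+)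

lemma K0_subset_K: "K0 \<subseteq> K" and K0_subset_Ko: "K0 \<subseteq> Ko"
  using Ko_subset_K by (auto simp: K0_def)

lemma norm_K0: "x \<in> K0 \<Longrightarrow> norm x \<le> \<rho>"
  using K0_subset_K norm_K by auto

lemma unit_form: "u \<in> units \<Longrightarrow> (0, u, k) \<in> Phi \<longleftrightarrow> \<bar>k\<bar> \<le> mm"
  by (auto simp: Phi_def form_def mm_def unitsD)

text \<open>Hyperplanes through 0 belong to the family, so 0 is never in a cell and can be reached
  only as a limit point of one. This is why closures of supports are used below.\<close>

lemma zero_notin_K0: "0 \<notin> K0"
proof
  assume "0 \<in> K0"
  moreover obtain u where "u \<in> units" using units_ne by blast
  moreover from this have "(0, u, 0) \<in> Phi" by (simp add: unit_form mm_def)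
  ultimately show False by (auto simp: K0_def qf_def)
qed

lemma open_K0: "open K0"
proof -
  have "K0 = Ko \<inter> (\<Inter>p\<in>Phi. {x. qf (fst p) (fst (snd p)) (snd (snd p)) x \<noteq> 0})"
    by (fastforce simp: K0_def)
  moreover have "open {x. qf A z C x \<noteq> 0}" for A z C
    by (intro open_Collect_neq continuous_on_qf continuous_intros)
  ultimately show ?thesis using open_Ko finite_Phi by (auto intro!: open_INT)
qed

lemma open_cell:
  assumes "x \<in> K0" shows "open {y \<in> K0. sim x y}"
proof -
  have *: "sgn u = sgn v \<longleftrightarrow> 0 < u * v" if "u \<noteq> 0" "v \<noteq> 0" for u v :: real
    using that by (auto simp: sgn_if zero_less_mult_iff)
  have "{y \<in> K0. sim x y} = K0 \<inter> (\<Inter>p\<in>Phi. {y. 0 < qf (fst p) (fst (snd p)) (snd (snd p)) x *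
      qf (fst p) (fst (snd p)) (snd (snd p)) y})"
  proof (intro set_eqI iffI)
    fix y assume "y \<in> {y \<in> K0. sim x y}"
    then show "y \<in> K0 \<inter> (\<Inter>p\<in>Phi. {y. 0 < qf (fst p) (fst (snd p)) (snd (snd p)) x *
        qf (fst p) (fst (snd p)) (snd (snd p)) y})"
      using assms by (fastforce simp: sim_def K0_def *[symmetric])
  next
    fix y assume y: "y \<in> K0 \<inter> (\<Inter>p\<in>Phi. {y. 0 < qf (fst p) (fst (snd p)) (snd (snd p)) x *
        qf (fst p) (fst (snd p)) (snd (snd p)) y})"
    have "sgn (qf A z C x) = sgn (qf A z C y)" if p: "(A, z, C) \<in> Phi" for A z C
      using y p assms *[of "qf A z C x" "qf A z C y"] by (fastforce simp: K0_def)
    then show "y \<in> {y \<in> K0. sim x y}" using y by (auto simp: sim_def)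
  qed
  moreover have "open {y. 0 < qf A z C x * qf A z C y}" for A z C
    by (intro open_Collect_less continuous_intros continuous_on_qf)
  ultimately show ?thesis using open_K0 finite_Phi by (auto intro!: open_INT)
qed

text \<open>Completing the square turns the normalisation \<open>z \<bullet> z - A * C = 1\<close>
  into a sphere of radius \<open>1 / \<bar>A\<bar>\<close>. For \<open>A = 0\<close> it makes
  \<open>z\<close> a unit vector and the zero set a hyperplane.\<close>

lemma negligible_qf_zero:
  assumes "form A z C" shows "negligible {x. qf A z C x = 0}"
proof (cases "A = 0")
  case True
  then have "z \<noteq> 0" using assms by (auto simp: form_def)
  then have "negligible {x. (2 *\<^sub>R z) \<bullet> x = of_int C}" by (intro negligible_hyperplane) auto
  moreover have "{x. qf A z C x = 0} = {x. (2 *\<^sub>R z) \<bullet> x = of_int C}"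
    using True by (auto simp: qf_def inner_commute)
  ultimately show ?thesis by simp
next
  case False
  have "{x. qf A z C x = 0} \<subseteq> sphere (z /\<^sub>R of_int A) (1 / \<bar>of_int A\<bar>)"
  proof
    fix x assume "x \<in> {x. qf A z C x = 0}"
    then have q: "of_int A * (x \<bullet> x) - 2 * (x \<bullet> z) + of_int C = 0" by (simp add: qf_def)
    have "(norm (of_int A *\<^sub>R x - z))\<^sup>2 = of_int A * (of_int A * (x \<bullet> x) - 2 * (x \<bullet> z)) + z \<bullet> z"
      by (simp add: power2_norm_eq_inner inner_diff_left inner_diff_right inner_commute algebra_simps)
    also have "of_int A * (x \<bullet> x) - 2 * (x \<bullet> z) = - of_int C" using q by simp
    also have "of_int A * - of_int C + z \<bullet> z = 1" using assms by (simp add: form_def)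
    finally have "norm (of_int A *\<^sub>R x - z) = 1" 
      using norm_ge_zero[of "of_int A *\<^sub>R x - z"] by (auto simp: power2_eq_1_iff)
    moreover have "of_int A *\<^sub>R x - z = of_int A *\<^sub>R (x - z /\<^sub>R of_int A)" using False by (simp add: scaleR_diff_right)
    ultimately have "\<bar>of_int A\<bar> * norm (x - z /\<^sub>R of_int A) = 1" by simp
    then show "x \<in> sphere (z /\<^sub>R of_int A) (1 / \<bar>of_int A\<bar>)"
      using False by (simp add: dist_norm norm_minus_commute field_simps)
  qed
  then show ?thesis using negligible_sphere negligible_subset by blast
qed

text \<open>A point of \<open>K\<close> outside \<open>Ko\<close> lies on a face
  \<open>x \<bullet> u = 1/2\<close>, which is the zero set of the form with coefficients
  \<open>0\<close>, \<open>u\<close>, \<open>1\<close> of the family.\<close>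

lemma negligible_K_diff_K0: "negligible (K - K0)"
proof -
  have "K - K0 \<subseteq> (\<Union>p\<in>Phi. {x. qf (fst p) (fst (snd p)) (snd (snd p)) x = 0})"
  proof
    fix x assume x: "x \<in> K - K0"
    show "x \<in> (\<Union>p\<in>Phi. {x. qf (fst p) (fst (snd p)) (snd (snd p)) x = 0})"
    proof (cases "x \<in> Ko")
      case False
      then obtain u where u: "u \<in> units" "x \<bullet> u \<ge> 1/2" by (force simp: Ko_def)
      then have "x \<bullet> u = 1/2" using K_inner_le[of x u] x unitsD[of u] by auto
      then have "qf 0 u 1 x = 0" by (simp add: qf_def)
      moreover have "(0, u, 1) \<in> Phi" using u by (simp add: unit_form mm_def)
      ultimately show ?thesis by force
    qed (use x in \<open>force simp: K0_def\<close>)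
  qed
  moreover have "negligible (\<Union>p\<in>Phi. {x. qf (fst p) (fst (snd p)) (snd (snd p)) x = 0})"
    using finite_Phi by (intro negligible_Union) (auto simp: Phi_def intro!: negligible_qf_zero)
  ultimately show ?thesis using negligible_subset by blast
qed

text \<open>The boundary choice may be an arbitrary subset of the boundary; completeness of Lebesgue
  measure makes it measurable nevertheless.\<close>

lemma sets_K [measurable]: "K \<in> sets lebesgue" and sets_K0 [measurable]: "K0 \<in> sets lebesgue"
proof -
  show 0: "K0 \<in> sets lebesgue" using open_K0 by simp
  have "K = K0 \<union> (K - K0)" using K0_subset_K by auto
  then show "K \<in> sets lebesgue" using 0 negligible_K_diff_K0 negligible_imp_sets by (metis sets.Un)
qed

text \<open>Translation fixes the leading coefficient and the discriminant
  \<open>z \<bullet> z - A * C\<close>. The new constant coefficient is an integer because an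
  integral lattice has integral values of \<open>2 * (a \<bullet> z)\<close>.\<close>

lemma qf_translate:
  assumes "form A z C" "a \<in> Z"
  obtains z' C' where "form A z' C'" "\<And>x. qf A z C (x + a) = qf A z' C' x"
proof -
  obtain k where k: "2 * (a \<bullet> z) = of_int k"
    using Z_double_inner[of a z] assms by (auto simp: form_def elim: Ints_cases)
  obtain l where l: "a \<bullet> a = of_int l" using Z_norm_sq[of a] assms by (auto elim: Ints_cases)
  show ?thesis
  proof (rule that)
    show "qf A z C (x + a) = qf A (z - of_int A *\<^sub>R a) (C - k + A * l) x" for x
      using k l by (simp add: qf_def inner_add_left inner_add_right inner_diff_right inner_commute algebra_simps)
    have "(z - of_int A *\<^sub>R a) \<bullet> (z - of_int A *\<^sub>R a) = z \<bullet> z - of_int A * (2 * (a \<bullet> z)) + of_int A * of_int A * (a \<bullet> a)"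
      by (simp add: inner_diff_left inner_diff_right inner_commute algebra_simps)
    also have "\<dots> = 1 + of_int A * of_int (C - k + A * l)"
      using assms k l by (simp add: form_def algebra_simps)
    finally show "form A (z - of_int A *\<^sub>R a) (C - k + A * l)"
      using assms by (auto simp: form_def Z_diff Z_scaleR_int)
  qed
qed

lemma qf_inv: "x \<noteq> 0 \<Longrightarrow> qf A z C (\<iota> x) * (x \<bullet> x) = qf C (orth z) A x"
proof -
  assume x: "x \<noteq> 0"
  have "\<iota> x \<bullet> \<iota> x = 1 / (x \<bullet> x)"
    using norm_inv[of x] by (simp add: power2_norm_eq_inner[symmetric] power_divide)
  moreover have "\<iota> x \<bullet> z = (x \<bullet> orth z) / (x \<bullet> x)" by (simp add: inv_inner power2_norm_eq_inner)
  ultimately show ?thesis using x by (simp add: qf_def field_simps)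
qed

lemma form_orth: "form A z C \<Longrightarrow> form C (orth z) A"
  by (auto simp: form_def orth_Z orth_inner)

text \<open>A form of the family has constant sign on a cell by definition. One with small leading
  but large constant coefficient has no zero in the convex set \<open>Ko\<close>, hence one sign on
  all of it.\<close>

lemma form_sign:
  assumes f: "form A z C" "\<bar>A\<bar> \<le> mm" and xy: "x \<in> K0" "y \<in> K0" "sim x y"
  shows "qf A z C x \<noteq> 0" "sgn (qf A z C x) = sgn (qf A z C y)"
proof -
  have "qf A z C x \<noteq> 0 \<and> sgn (qf A z C x) = sgn (qf A z C y)"
  proof (cases "\<bar>C\<bar> \<le> mm")
    case True
    then have "(A, z, C) \<in> Phi" using f by (simp add: Phi_def)
    then show ?thesis using xy by (auto simp: K0_def sim_def)
  next
    case False
    then have nz: "qf A z C v \<noteq> 0" if "v \<in> Ko" for v using form_bound[OF f that] by auto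
    have conn: "connected (qf A z C ` Ko)"
      using convex_Ko by (intro connected_continuous_image continuous_on_qf convex_connected)
    have "qf A z C x \<in> qf A z C ` Ko" "qf A z C y \<in> qf A z C ` Ko" using xy K0_subset_Ko by auto
    moreover have "0 \<notin> qf A z C ` Ko" using nz by auto
    ultimately have "\<not> (qf A z C x < 0 \<and> 0 < qf A z C y)" "\<not> (qf A z C y < 0 \<and> 0 < qf A z C x)"
      using connectedD_interval[OF conn] by (meson less_imp_le)+
    moreover have "qf A z C x \<noteq> 0" "qf A z C y \<noteq> 0" using nz xy K0_subset_Ko by auto
    ultimately show ?thesis by (auto simp: sgn_if)
  qed
  then show "qf A z C x \<noteq> 0" "sgn (qf A z C x) = sgn (qf A z C y)" by auto
qed

lemma K0_add_ne_0: "y \<in> K0 \<Longrightarrow> a \<in> Z \<Longrightarrow> y + a \<noteq> 0"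
proof
  assume y: "y \<in> K0" "a \<in> Z" "y + a = 0"
  then have "nearest Z K y = 0" using K0_subset_K by (intro nearest_eqI) auto
  moreover have "nearest Z K y = - a" using y Z_uminus zero_in_K by (intro nearest_eqI) auto
  ultimately show False using y zero_notin_K0 by auto
qed

text \<open>The inversion makes \<open>C\<close> the leading coefficient and the translation by
  \<open>a\<close> keeps it, so the pulled-back form still has a small leading coefficient and
  \<open>form_sign\<close> applies. This is why the family bounds both outer coefficients.\<close>

lemma branch_sign:
  assumes "y \<in> K0" "y' \<in> K0" "sim y y'" "a \<in> Z" "(A, z, C) \<in> Phi"
  shows "qf A z C (\<iota> (y + a)) \<noteq> 0" "sgn (qf A z C (\<iota> (y + a))) = sgn (qf A z C (\<iota> (y' + a)))"
proof -
  have f: "form A z C" "\<bar>C\<bar> \<le> mm" using assms by (auto simp: Phi_def)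
  obtain z' C' where f': "form C z' C'" "\<And>x. qf C (orth z) A (x + a) = qf C z' C' x"
    using qf_translate[OF form_orth[OF f(1)] assms(4)] by blast
  have nz: "y + a \<noteq> 0" "y' + a \<noteq> 0" using K0_add_ne_0 assms by auto
  have q: "qf A z C (\<iota> (y + a)) * ((y + a) \<bullet> (y + a)) = qf C z' C' y"
    "qf A z C (\<iota> (y' + a)) * ((y' + a) \<bullet> (y' + a)) = qf C z' C' y'"
    using qf_inv nz f' by auto
  show "qf A z C (\<iota> (y + a)) \<noteq> 0" using q form_sign(1)[OF f'(1) f(2) assms(1-3)] by auto
  have "sgn (qf A z C (\<iota> (y + a))) = sgn (qf C z' C' y)"
    unfolding q[symmetric] sgn_mult using nz by simp
  also have "\<dots> = sgn (qf C z' C' y')" by (rule form_sign(2)[OF f'(1) f(2) assms(1-3)])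
  also have "\<dots> = sgn (qf A z C (\<iota> (y' + a)))"
    unfolding q[symmetric] sgn_mult using nz by simp
  finally show "sgn (qf A z C (\<iota> (y + a))) = sgn (qf A z C (\<iota> (y' + a)))" .
qed

lemma K_imp_K0: "x \<in> K \<Longrightarrow> (\<And>A z C. (A, z, C) \<in> Phi \<Longrightarrow> qf A z C x \<noteq> 0) \<Longrightarrow> x \<in> K0"
proof -
  assume x: "x \<in> K" and nz: "\<And>A z C. (A, z, C) \<in> Phi \<Longrightarrow> qf A z C x \<noteq> 0"
  have "x \<bullet> u < 1/2" if u: "u \<in> units" for u
  proof -
    have "qf 0 u 1 x \<noteq> 0" using nz u by (simp add: unit_form mm_def)
    then show ?thesis using K_inner_le[OF x, of u] u unitsD[OF u] by (auto simp: qf_def)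
  qed
  then show "x \<in> K0" using nz by (auto simp: K0_def Ko_def)
qed

lemma branch_in_K0: "y \<in> K0 \<Longrightarrow> a \<in> Z \<Longrightarrow> \<iota> (y + a) \<in> K \<Longrightarrow> \<iota> (y + a) \<in> K0"
  using branch_sign(1)[of y y a] by (intro K_imp_K0) auto

text \<open>Membership in \<open>Ko\<close> is itself a sign condition, on the forms with
  coefficients \<open>0\<close>, \<open>u\<close>, \<open>1\<close>. Hence a digit is admissible
  either at all points of a cell or at none.\<close>

lemma branch_sim:
  assumes "y \<in> K0" "y' \<in> K0" "sim y y'" "a \<in> Z" "\<iota> (y + a) \<in> K"
  shows "\<iota> (y' + a) \<in> K0" "sim (\<iota> (y + a)) (\<iota> (y' + a))"
proof -
  have x: "\<iota> (y + a) \<in> K0" using branch_in_K0 assms by blast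
  show s: "sim (\<iota> (y + a)) (\<iota> (y' + a))" using branch_sign(2)[OF assms(1-4)] by (auto simp: sim_def)
  have nz: "qf A z C (\<iota> (y' + a)) \<noteq> 0" if "(A, z, C) \<in> Phi" for A z C
    using branch_sign(1)[of y' y' a] assms that by auto
  have "\<iota> (y' + a) \<bullet> u < 1/2" if u: "u \<in> units" for u
  proof -
    have "(0, u, 1) \<in> Phi" using u by (simp add: unit_form mm_def)
    then have "sgn (qf 0 u 1 (\<iota> (y + a))) = sgn (qf 0 u 1 (\<iota> (y' + a)))" using s by (auto simp: sim_def)
    moreover have "qf 0 u 1 (\<iota> (y + a)) > 0" using x u by (auto simp: qf_def K0_def Ko_def)
    ultimately have "qf 0 u 1 (\<iota> (y' + a)) > 0" by (simp add: sgn_if split: if_splits)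
    then show ?thesis by (simp add: qf_def)
  qed
  then show "\<iota> (y' + a) \<in> K0" using nz by (auto simp: K0_def Ko_def)
qed

lemma negligible_not_K0_translate: "negligible {x. \<not> (\<exists>a\<in>Z. x - a \<in> K0)}"
proof -
  have "{x. \<not> (\<exists>a\<in>Z. x - a \<in> K0)} \<subseteq> (\<Union>a\<in>Z. (+) a ` (K - K0))"
  proof
    fix x assume x: "x \<in> {x. \<not> (\<exists>a\<in>Z. x - a \<in> K0)}"
    have "x = nearest Z K x + (x - nearest Z K x)" by simp
    then show "x \<in> (\<Union>a\<in>Z. (+) a ` (K - K0))" using nearest[of x] x by blast
  qed
  moreover have "negligible (\<Union>a\<in>Z. (+) a ` (K - K0))"
    using countable_Z negligible_K_diff_K0 by (intro negligible_countable_Union) (auto intro!: negligible_translation)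
  ultimately show ?thesis using negligible_subset by blast
qed

lemma norm_branch: "y \<in> K0 \<Longrightarrow> a \<in> Z \<Longrightarrow> \<iota> (y + a) \<in> K \<Longrightarrow> 1 / \<rho> \<le> norm (y + a)"
proof -
  assume y: "y \<in> K0" "a \<in> Z" "\<iota> (y + a) \<in> K"
  then have "1 / norm (y + a) \<le> \<rho>" using norm_K norm_inv by metis
  moreover have "norm (y + a) > 0" using K0_add_ne_0 y by auto
  ultimately show ?thesis using rho by (simp add: field_simps)
qed

text \<open>The inversion divides distances by the product of the two norms, and both are at least
  \<open>1 / \<rho>\<close> when the images lie in \<open>K\<close>.\<close>

lemma dist_branch_le:
  assumes "y \<in> K0" "y' \<in> K0" "a \<in> Z" "\<iota> (y + a) \<in> K" "\<iota> (y' + a) \<in> K"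
  shows "dist (\<iota> (y + a)) (\<iota> (y' + a)) \<le> \<rho>\<^sup>2 * dist y y'"
proof -
  have n: "1 / \<rho> \<le> norm (y + a)" "1 / \<rho> \<le> norm (y' + a)" using norm_branch assms by auto
  have "dist (\<iota> (y + a)) (\<iota> (y' + a)) = dist y y' / (norm (y + a) * norm (y' + a))"
    using dist_inv[of "y + a" "y' + a"] K0_add_ne_0 assms by simp
  also have "\<dots> \<le> dist y y' / ((1 / \<rho>) * (1 / \<rho>))"
    using n rho by (intro divide_left_mono mult_mono mult_pos_pos) (auto intro: less_le_trans[OF _ n(1)] less_le_trans[OF _ n(2)])
  finally show ?thesis using rho by (simp add: power2_eq_square field_simps)
qed

end

section \<open>The transfer operator\<close>

lemma measurable_lebesgue_add [measurable]:
  fixes a :: "'a::euclidean_space" shows "(\<lambda>x. x + a) \<in> measurable lebesgue lebesgue"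
proof -
  have "(\<lambda>x. a + (\<Sum>j\<in>Basis. (1 * (x \<bullet> j)) *\<^sub>R j)) \<in> measurable lebesgue (lebesgue :: 'a measure)"
    by (rule lebesgue_affine_measurable) auto
  then show ?thesis by (simp add: euclidean_representation add.commute)
qed

lemma nn_integral_lebesgue_add:
  fixes a :: "'a::euclidean_space"
  assumes f [measurable]: "f \<in> borel_measurable lebesgue"
  shows "(\<integral>\<^sup>+x. f (x + a) \<partial>lebesgue) = (\<integral>\<^sup>+x. f x \<partial>lebesgue)"
proof -
  have "(lebesgue :: 'a measure) = density (distr lebesgue lebesgue (\<lambda>x. a + (\<Sum>j\<in>Basis. (1 * (x \<bullet> j)) *\<^sub>R j)))
      (\<lambda>_. ennreal (\<Prod>j\<in>(Basis :: 'a set). \<bar>1\<bar>))"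
    by (rule lebesgue_affine_euclidean) auto
  then have "(lebesgue :: 'a measure) = distr lebesgue lebesgue (\<lambda>x. x + a)"
    by (simp add: euclidean_representation add.commute density_1)
  then have "(\<integral>\<^sup>+x. f x \<partial>lebesgue) = (\<integral>\<^sup>+x. f x \<partial>distr lebesgue lebesgue (\<lambda>x. x + a))"
    by (rule arg_cong)
  also have "\<dots> = (\<integral>\<^sup>+x. f (x + a) \<partial>lebesgue)"
    by (intro nn_integral_distr) measurable
  finally show ?thesis ..
qed

lemma borel_measurable_nn_integral_count_space_countable:
  assumes "countable I" and "\<And>i. i \<in> I \<Longrightarrow> f i \<in> borel_measurable M"
  shows "(\<lambda>x. \<integral>\<^sup>+i. f i x \<partial>count_space I) \<in> borel_measurable M"
proof -
  interpret sigma_finite_measure "count_space I"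
    using assms(1) by (rule sigma_finite_measure_count_space_countable)
  have "(\<lambda>(i, x). f i x) \<in> borel_measurable (count_space I \<Otimes>\<^sub>M M)"
    using assms by (intro measurable_pair_measure_countable1) auto
  then have "(\<lambda>(x, i). f i x) \<in> borel_measurable (M \<Otimes>\<^sub>M count_space I)"
    by (subst (asm) measurable_pair_swap_iff) (simp add: case_prod_unfold)
  then show ?thesis using borel_measurable_nn_integral_fst by fastforce
qed

lemma nn_integral_count_space_single:
  assumes "b \<in> I" "\<And>a. a \<in> I \<Longrightarrow> a \<noteq> b \<Longrightarrow> f a = 0"
  shows "(\<integral>\<^sup>+a. f a \<partial>count_space I) = f b"
  using nn_integral_count_space'[of "{b}" I f] assms by auto

context cf_lattice
begin

lemmas [simp del] = emeasure_completion

abbreviation T :: "'a \<Rightarrow> 'a" where "T \<equiv> cfmap Z K \<iota>"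

definition red :: "'a \<Rightarrow> 'a" where "red x = x - nearest Z K x"

text \<open>The convention at 0 is no exception to the formula, because the inversion fixes 0 and
  the digit of 0 is 0.\<close>

lemma T_eq: "T x = red (\<iota> x)"
  using nearest_eqI[of 0 0] zero_in_K by (auto simp: cfmap_def red_def)

lemma T_in_K: "T x \<in> K"
  using nearest by (auto simp: red_def T_eq)

lemma red_eqI: "a \<in> Z \<Longrightarrow> x - a \<in> K \<Longrightarrow> red x = x - a"
  using nearest_eqI by (auto simp: red_def)

lemma measurable_red [measurable]: "red \<in> measurable lebesgue lebesgue"
proof (rule measurableI)
  fix E :: "'a set" assume E: "E \<in> sets lebesgue"
  have eq: "red -` E \<inter> space lebesgue = (\<Union>a\<in>Z. (\<lambda>x. x + (- a)) -` (K \<inter> E) \<inter> space lebesgue)"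
  proof (intro set_eqI iffI)
    fix x assume "x \<in> red -` E \<inter> space lebesgue"
    then show "x \<in> (\<Union>a\<in>Z. (\<lambda>x. x + (- a)) -` (K \<inter> E) \<inter> space lebesgue)"
      using nearest[of x] by (auto simp: red_def intro!: bexI[of _ "nearest Z K x"])
  next
    fix x assume "x \<in> (\<Union>a\<in>Z. (\<lambda>x. x + (- a)) -` (K \<inter> E) \<inter> space lebesgue)"
    then show "x \<in> red -` E \<inter> space lebesgue" using red_eqI by auto
  qed
  have "(\<lambda>x. x + (- a)) -` (K \<inter> E) \<inter> space lebesgue \<in> sets lebesgue" for a
    using E sets_K by (intro measurable_sets[OF measurable_lebesgue_add]) auto
  then show "red -` E \<inter> space lebesgue \<in> sets lebesgue"
    unfolding eq using countable_Z by (intro sets.countable_UN') auto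
qed auto

lemma measurable_T [measurable]: "T \<in> measurable lebesgue lebesgue"
proof -
  have "(\<lambda>x. red (\<iota> x)) \<in> measurable lebesgue lebesgue" by measurable
  then show ?thesis by (simp add: T_eq[abs_def])
qed

text \<open>The contribution of the digit \<open>a\<close> to the transfer operator. The indicators
  suppress the null set outside the cells on both sides of the branch, so that later statements hold
  at every point of \<open>K0\<close>.\<close>

definition branch :: "'a \<Rightarrow> ('a \<Rightarrow> ennreal) \<Rightarrow> 'a \<Rightarrow> ennreal" where
  "branch a f y = indicator K0 y * (indicator K0 (\<iota> (y + a)) * f (\<iota> (y + a)) * jac (y + a))"

definition transfer :: "('a \<Rightarrow> ennreal) \<Rightarrow> 'a \<Rightarrow> ennreal" where
  "transfer f y = (\<integral>\<^sup>+a. branch a f y \<partial>count_space Z)"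

lemma branch_measurable [measurable]:
  assumes [measurable]: "f \<in> borel_measurable lebesgue" shows "branch a f \<in> borel_measurable lebesgue"
  unfolding branch_def by measurable

lemma transfer_measurable [measurable]:
  "f \<in> borel_measurable lebesgue \<Longrightarrow> transfer f \<in> borel_measurable lebesgue"
  unfolding transfer_def using countable_Z
  by (intro borel_measurable_nn_integral_count_space_countable) auto

lemma transfer_pow_measurable [measurable]:
  "f \<in> borel_measurable lebesgue \<Longrightarrow> (transfer ^^ n) f \<in> borel_measurable lebesgue"
  by (induction n) auto

lemma transfer_cong:
  assumes "\<And>x. x \<in> K0 \<Longrightarrow> f x = g x" shows "transfer f = transfer g"
proof -
  have "branch a f y = branch a g y" for a y
    using assms by (auto simp: branch_def split: split_indicator)
  then show ?thesis by (simp add: transfer_def fun_eq_iff)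
qed

lemma transfer_mono:
  assumes "\<And>x. x \<in> K0 \<Longrightarrow> f x \<le> g x" shows "transfer f y \<le> transfer g y"
  unfolding transfer_def branch_def using assms
  by (intro nn_integral_mono) (auto split: split_indicator intro!: mult_right_mono)

lemma transfer_add: "transfer (\<lambda>x. f x + g x) y = transfer f y + transfer g y"
  unfolding transfer_def branch_def
  by (subst nn_integral_add[symmetric]) (auto simp: algebra_simps)

lemma transfer_cmult: "transfer (\<lambda>x. c * f x) y = c * transfer f y"
  unfolding transfer_def branch_def
  by (subst nn_integral_cmult[symmetric]) (auto simp: mult_ac)

lemma transfer_pow_mono:
  "(\<And>x. x \<in> K0 \<Longrightarrow> f x \<le> g x) \<Longrightarrow> y \<in> K0 \<Longrightarrow> (transfer ^^ n) f y \<le> (transfer ^^ n) g y"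
  by (induction n arbitrary: y) (auto intro: transfer_mono)

lemma transfer_pow_add: "(transfer ^^ n) (\<lambda>x. f x + g x) = (\<lambda>y. (transfer ^^ n) f y + (transfer ^^ n) g y)"
  by (induction n) (auto simp: transfer_add)

lemma transfer_pow_cmult: "(transfer ^^ n) (\<lambda>x. c * f x) = (\<lambda>y. c * (transfer ^^ n) f y)"
  by (induction n) (auto simp: transfer_cmult)

lemma transfer_pow_cong:
  assumes "\<And>x. x \<in> K0 \<Longrightarrow> f x = g x" "y \<in> K0"
  shows "(transfer ^^ n) f y = (transfer ^^ n) g y"
  using assms by (cases n) (auto simp: transfer_cong[of f g] funpow_Suc_right simp del: funpow.simps)

lemma AE_K_K0: "AE x in lebesgue. x \<in> K \<longleftrightarrow> x \<in> K0"
proof -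
  have "AE x in lebesgue. x \<notin> K - K0"
    using negligible_K_diff_K0 by (intro AE_not_in) (simp add: negligible_iff_null_sets)
  then show ?thesis by eventually_elim (use K0_subset_K in auto)
qed

text \<open>Change variables by the inversion, then split the space into lattice translates of
  \<open>K0\<close>. Almost every point lies in exactly one of them, so the sum over digits has a
  single term there; Tonelli exchanges sum and integral.\<close>

lemma transfer_duality:
  assumes [measurable]: "f \<in> borel_measurable lebesgue" "g \<in> borel_measurable lebesgue"
  shows "(\<integral>\<^sup>+x\<in>K. f x * g (T x) \<partial>lebesgue) = (\<integral>\<^sup>+y\<in>K0. transfer f y * g y \<partial>lebesgue)"
proof -
  have [measurable]: "(\<lambda>x. g (red x)) \<in> borel_measurable lebesgue" by measurable
  have [measurable]: "(\<lambda>x. g (red (\<iota> x))) \<in> borel_measurable lebesgue" by measurable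
  have [measurable]: "(\<lambda>x. f (\<iota> x)) \<in> borel_measurable lebesgue" by measurable
  have [measurable]: "(\<lambda>x. indicator K0 (\<iota> x) :: ennreal) \<in> borel_measurable lebesgue" by measurable
  define G where "G w = indicator K0 (\<iota> w) * f (\<iota> w) * jac w" for w
  have [measurable]: "G \<in> borel_measurable lebesgue" unfolding G_def by measurable
  have [measurable]: "(\<lambda>x. g (x + a)) \<in> borel_measurable lebesgue"
    "(\<lambda>x. indicator K0 (x + a) :: ennreal) \<in> borel_measurable lebesgue"
    "(\<lambda>x. G (x + a)) \<in> borel_measurable lebesgue" for a
    by measurable
  have "(\<integral>\<^sup>+x\<in>K. f x * g (T x) \<partial>lebesgue) = (\<integral>\<^sup>+x. indicator K0 x * f x * g (red (\<iota> x)) \<partial>lebesgue)"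
    by (intro nn_integral_cong_AE eventually_mono[OF AE_K_K0]) (auto simp: T_eq split: split_indicator)
  also have "\<dots> = (\<integral>\<^sup>+w. (indicator K0 (\<iota> w) * f (\<iota> w) * g (red (\<iota> (\<iota> w)))) * jac w \<partial>lebesgue)"
    by (intro nn_integral_inv[symmetric]) measurable
  also have "\<dots> = (\<integral>\<^sup>+w. G w * g (red w) \<partial>lebesgue)"
    by (simp add: G_def mult_ac)
  also have "\<dots> = (\<integral>\<^sup>+w. \<integral>\<^sup>+a. indicator K0 (w + (- a)) * G w * g (w + (- a)) \<partial>count_space Z \<partial>lebesgue)"
  proof (intro nn_integral_cong_AE)
    have "AE w in lebesgue. \<exists>a\<in>Z. w - a \<in> K0"
      using AE_not_in[of "{x. \<not> (\<exists>a\<in>Z. x - a \<in> K0)}" lebesgue] negligible_not_K0_translate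
      by (simp add: negligible_iff_null_sets)
    then show "AE w in lebesgue. G w * g (red w) =
        (\<integral>\<^sup>+a. indicator K0 (w + (- a)) * G w * g (w + (- a)) \<partial>count_space Z)"
    proof eventually_elim
      fix w assume "\<exists>a\<in>Z. w - a \<in> K0"
      then obtain b where b: "b \<in> Z" "w - b \<in> K0" by auto
      have un: "a = b" if "a \<in> Z" "w - a \<in> K0" for a
        using nearest_eqI[of a w] nearest_eqI[of b w] b that K0_subset_K by auto
      have "(\<integral>\<^sup>+a. indicator K0 (w + (- a)) * G w * g (w + (- a)) \<partial>count_space Z) =
          indicator K0 (w + (- b)) * G w * g (w + (- b))"
        using un by (intro nn_integral_count_space_single b) (auto split: split_indicator)
      then show "G w * g (red w) = (\<integral>\<^sup>+a. indicator K0 (w + (- a)) * G w * g (w + (- a)) \<partial>count_space Z)"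
        using b red_eqI[of b w] K0_subset_K by auto
    qed
  qed
  also have "\<dots> = (\<integral>\<^sup>+a. \<integral>\<^sup>+w. indicator K0 (w + (- a)) * G w * g (w + (- a)) \<partial>lebesgue \<partial>count_space Z)"
    using countable_Z by (intro nn_integral_count_space_nn_integral) measurable
  also have "\<dots> = (\<integral>\<^sup>+a. \<integral>\<^sup>+y. indicator K0 y * G (y + a) * g y \<partial>lebesgue \<partial>count_space Z)"
  proof (rule nn_integral_cong)
    fix a
    have "(\<integral>\<^sup>+w. indicator K0 (w + (- a)) * G w * g (w + (- a)) \<partial>lebesgue) =
      (\<integral>\<^sup>+y. indicator K0 ((y + a) + (- a)) * G (y + a) * g ((y + a) + (- a)) \<partial>lebesgue)"
      by (intro nn_integral_lebesgue_add[symmetric]) measurable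
    then show "(\<integral>\<^sup>+w. indicator K0 (w + (- a)) * G w * g (w + (- a)) \<partial>lebesgue) =
      (\<integral>\<^sup>+y. indicator K0 y * G (y + a) * g y \<partial>lebesgue)" by simp
  qed
  also have "\<dots> = (\<integral>\<^sup>+y. \<integral>\<^sup>+a. indicator K0 y * G (y + a) * g y \<partial>count_space Z \<partial>lebesgue)"
    using countable_Z by (intro nn_integral_count_space_nn_integral[symmetric]) measurable
  also have "\<dots> = (\<integral>\<^sup>+y\<in>K0. transfer f y * g y \<partial>lebesgue)"
  proof (intro nn_integral_cong)
    fix y
    have "(\<integral>\<^sup>+a. indicator K0 y * G (y + a) * g y \<partial>count_space Z) =
      (\<integral>\<^sup>+a. branch a f y * (g y * indicator K0 y) \<partial>count_space Z)"
      by (intro nn_integral_cong) (auto simp: branch_def G_def mult_ac split: split_indicator)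
    also have "\<dots> = transfer f y * (g y * indicator K0 y)"
      unfolding transfer_def by (intro nn_integral_multc) auto
    finally show "(\<integral>\<^sup>+a. indicator K0 y * G (y + a) * g y \<partial>count_space Z) = transfer f y * g y * indicator K0 y"
      by (simp add: mult_ac)
  qed
  finally show ?thesis .
qed

definition mass :: "('a \<Rightarrow> ennreal) \<Rightarrow> ennreal" where "mass f = (\<integral>\<^sup>+x\<in>K0. f x \<partial>lebesgue)"

lemma nn_integral_K_eq_K0: "(\<integral>\<^sup>+x\<in>K. f x \<partial>lebesgue) = (\<integral>\<^sup>+x\<in>K0. f x \<partial>lebesgue)"
  by (intro nn_integral_cong_AE eventually_mono[OF AE_K_K0]) (auto split: split_indicator)

lemma transfer_pow_duality:
  assumes [measurable]: "f \<in> borel_measurable lebesgue" "g \<in> borel_measurable lebesgue"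
  shows "(\<integral>\<^sup>+x\<in>K. f x * g ((T ^^ n) x) \<partial>lebesgue) = (\<integral>\<^sup>+y\<in>K0. (transfer ^^ n) f y * g y \<partial>lebesgue)"
  using assms
proof (induction n arbitrary: f)
  case 0
  then show ?case by (simp add: nn_integral_K_eq_K0)
next
  case (Suc n)
  have [measurable]: "(T ^^ n) \<in> measurable lebesgue lebesgue" by (rule measurable_compose_n) (rule measurable_T)
  note [measurable] = Suc.prems
  have gn: "(\<lambda>x. g ((T ^^ n) x)) \<in> borel_measurable lebesgue" by measurable
  have "(\<integral>\<^sup>+x\<in>K. f x * g ((T ^^ Suc n) x) \<partial>lebesgue) = (\<integral>\<^sup>+x\<in>K. f x * g ((T ^^ n) (T x)) \<partial>lebesgue)"
    by (simp add: funpow_Suc_right del: funpow.simps)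
  also have "\<dots> = (\<integral>\<^sup>+y\<in>K0. transfer f y * g ((T ^^ n) y) \<partial>lebesgue)"
    by (rule transfer_duality[OF Suc.prems(1) gn])
  also have "\<dots> = (\<integral>\<^sup>+y\<in>K. transfer f y * g ((T ^^ n) y) \<partial>lebesgue)"
    by (rule nn_integral_K_eq_K0[symmetric])
  also have "\<dots> = (\<integral>\<^sup>+y\<in>K0. (transfer ^^ n) (transfer f) y * g y \<partial>lebesgue)"
    by (rule Suc.IH) measurable
  finally show ?case by (simp add: funpow_Suc_right del: funpow.simps)
qed

lemma mass_transfer_pow:
  "f \<in> borel_measurable lebesgue \<Longrightarrow> mass ((transfer ^^ n) f) = mass f"
  using transfer_pow_duality[of f "\<lambda>_. 1" n] by (simp add: mass_def nn_integral_K_eq_K0)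

text \<open>Log-Lipschitz continuity on cells, written without logarithms so that functions
  vanishing on whole cells are included.\<close>

definition reg :: "real \<Rightarrow> ('a \<Rightarrow> ennreal) \<Rightarrow> bool" where
  "reg B f \<longleftrightarrow> (\<forall>x\<in>K0. \<forall>y\<in>K0. sim x y \<longrightarrow> f x \<le> ennreal (exp (B * dist x y)) * f y)"

lemma reg_mono: "reg B f \<Longrightarrow> B \<le> B' \<Longrightarrow> reg B' f"
  unfolding reg_def
  by (meson order_trans mult_right_mono ennreal_leI exp_le_cancel_iff zero_le_dist zero_le mult_right_mono)

text \<open>Since \<open>1 \<le> \<rho> * norm (x + a)\<close>, moving the argument by
  \<open>dist x y\<close> changes its norm by at most the factor
  \<open>1 + \<rho> * dist x y\<close>; the exponent \<open>2 * DIM('a)\<close> of the Jacobian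
  multiplies the rate.\<close>

lemma jac_le:
  assumes "y \<in> K0" "x \<in> K0" "a \<in> Z" "\<iota> (x + a) \<in> K"
  shows "jac (x + a) \<le> ennreal (exp (2 * real DIM('a) * \<rho> * dist x y)) * jac (y + a)"
proof -
  have n: "1 / \<rho> \<le> norm (x + a)" using norm_branch assms by auto
  have nx: "norm (x + a) > 0" "norm (y + a) > 0" using K0_add_ne_0 assms by auto
  have "1 \<le> \<rho> * norm (x + a)" using n rho by (simp add: field_simps)
  then have "dist x y * 1 \<le> dist x y * (\<rho> * norm (x + a))" by (intro mult_left_mono) auto
  moreover have "norm (y + a) \<le> norm (x + a) + dist x y"
    using norm_triangle_ineq[of "x + a" "y - x"] by (simp add: dist_norm norm_minus_commute algebra_simps)
  ultimately have "norm (y + a) \<le> norm (x + a) * (1 + \<rho> * dist x y)" by (simp add: algebra_simps)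
  also have "\<dots> \<le> norm (x + a) * exp (\<rho> * dist x y)" by (intro mult_left_mono) auto
  finally have "norm (y + a) ^ (2 * DIM('a)) \<le> (norm (x + a) * exp (\<rho> * dist x y)) ^ (2 * DIM('a))"
    by (intro power_mono) auto
  also have "\<dots> = norm (x + a) ^ (2 * DIM('a)) * exp (2 * real DIM('a) * \<rho> * dist x y)"
    by (simp add: power_mult_distrib exp_of_nat_mult[symmetric] mult_ac)
  finally have "1 / norm (x + a) ^ (2 * DIM('a)) \<le> exp (2 * real DIM('a) * \<rho> * dist x y) * (1 / norm (y + a) ^ (2 * DIM('a)))"
    using nx by (simp add: divide_simps mult.commute)
  then show ?thesis unfolding jac_def by (simp add: ennreal_mult[symmetric] ennreal_leI)
qed

text \<open>Composition with the branch shrinks the constant by its contraction factor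
  \<open>\<rho>\<^sup>2\<close>, and the distortion of the Jacobian adds a fixed amount.\<close>

lemma reg_branch:
  assumes "reg B f" "0 \<le> B" "a \<in> Z"
  shows "reg (B * \<rho>\<^sup>2 + 2 * real DIM('a) * \<rho>) (branch a f)"
  unfolding reg_def
proof (intro ballI impI)
  fix x y assume xy: "x \<in> K0" "y \<in> K0" "sim x y"
  show "branch a f x \<le> ennreal (exp ((B * \<rho>\<^sup>2 + 2 * real DIM('a) * \<rho>) * dist x y)) * branch a f y"
  proof (cases "\<iota> (x + a) \<in> K0")
    case True
    then have xK: "\<iota> (x + a) \<in> K" using K0_subset_K by auto
    note y = branch_sim[OF xy assms(3) xK]
    have yK: "\<iota> (y + a) \<in> K" using y K0_subset_K by auto
    have "f (\<iota> (x + a)) \<le> ennreal (exp (B * dist (\<iota> (x + a)) (\<iota> (y + a)))) * f (\<iota> (y + a))"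
      using assms(1) True y unfolding reg_def by blast
    also have "\<dots> \<le> ennreal (exp (B * (\<rho>\<^sup>2 * dist x y))) * f (\<iota> (y + a))"
      using dist_branch_le[OF xy(1,2) assms(3) xK yK] assms(2)
      by (intro mult_right_mono ennreal_leI) (auto intro!: mult_left_mono)
    finally have "f (\<iota> (x + a)) * jac (x + a) \<le>
      (ennreal (exp (B * (\<rho>\<^sup>2 * dist x y))) * f (\<iota> (y + a))) *
      (ennreal (exp (2 * real DIM('a) * \<rho> * dist x y)) * jac (y + a))"
      using jac_le[OF xy(2,1) assms(3) xK] by (intro mult_mono) auto
    also have "\<dots> = (ennreal (exp (B * (\<rho>\<^sup>2 * dist x y))) * ennreal (exp (2 * real DIM('a) * \<rho> * dist x y))) *
       (f (\<iota> (y + a)) * jac (y + a))" by (simp add: mult_ac)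
    also have "ennreal (exp (B * (\<rho>\<^sup>2 * dist x y))) * ennreal (exp (2 * real DIM('a) * \<rho> * dist x y)) =
       ennreal (exp ((B * \<rho>\<^sup>2 + 2 * real DIM('a) * \<rho>) * dist x y))"
      by (simp add: ennreal_mult[symmetric] exp_add[symmetric] algebra_simps)
    finally show ?thesis using True y xy by (simp add: branch_def)
  qed (simp add: branch_def)
qed

lemma reg_transfer:
  assumes "reg B f" "0 \<le> B"
  shows "reg (B * \<rho>\<^sup>2 + 2 * real DIM('a) * \<rho>) (transfer f)"
  unfolding reg_def
proof (intro ballI impI)
  fix x y assume xy: "x \<in> K0" "y \<in> K0" "sim x y"
  let ?E = "ennreal (exp ((B * \<rho>\<^sup>2 + 2 * real DIM('a) * \<rho>) * dist x y))"
  have "transfer f x \<le> (\<integral>\<^sup>+a. ?E * branch a f y \<partial>count_space Z)"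
    unfolding transfer_def
    using reg_branch[OF assms] xy by (intro nn_integral_mono) (auto simp: reg_def)
  also have "\<dots> = ?E * transfer f y" unfolding transfer_def by (intro nn_integral_cmult) auto
  finally show "transfer f x \<le> ?E * transfer f y" .
qed

text \<open>One more than the fixed point of
  \<open>B \<mapsto> B * \<rho>\<^sup>2 + 2 * real DIM('a) * \<rho>\<close>. The surplus 1 yields
  the gap \<open>1 - \<rho>\<^sup>2\<close> gained in every application of the operator.\<close>

definition BB :: real where "BB = 2 * real DIM('a) * \<rho> / (1 - \<rho>\<^sup>2) + 1"

lemma rho_sq: "0 < 1 - \<rho>\<^sup>2" "\<rho>\<^sup>2 < 1"
  using rho power_strict_mono[of \<rho> 1 2] by auto

lemma BB_pos: "0 < BB" using rho rho_sq by (simp add: BB_def add_nonneg_pos)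

lemma BB_contract: "BB * \<rho>\<^sup>2 + 2 * real DIM('a) * \<rho> = BB - (1 - \<rho>\<^sup>2)"
proof -
  have "BB * (1 - \<rho>\<^sup>2) = 2 * real DIM('a) * \<rho> + (1 - \<rho>\<^sup>2)" using rho_sq by (simp add: BB_def field_simps)
  then show ?thesis by (simp add: algebra_simps)
qed

lemma reg_transfer_BB: "reg BB f \<Longrightarrow> reg (BB - (1 - \<rho>\<^sup>2)) (transfer f)"
  using reg_transfer[of BB f] BB_pos by (simp add: BB_contract)

lemma reg_branch_BB: "reg BB f \<Longrightarrow> a \<in> Z \<Longrightarrow> reg BB (branch a f)"
  using reg_branch[of BB f a] BB_pos rho_sq reg_mono[of _ "branch a f" BB] by (simp add: BB_contract)

lemma reg_transfer_pow: "reg BB f \<Longrightarrow> reg BB ((transfer ^^ n) f)"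
  by (induction n) (use rho_sq in \<open>auto intro: reg_mono[OF reg_transfer_BB]\<close>)

lemma reg_const: "0 \<le> B \<Longrightarrow> reg B (\<lambda>_. c)"
proof -
  assume "0 \<le> B"
  have "c \<le> ennreal (exp (B * dist x y)) * c" for x y :: 'a
  proof -
    have "ennreal 1 * c \<le> ennreal (exp (B * dist x y)) * c"
      using \<open>0 \<le> B\<close> by (intro mult_right_mono ennreal_leI) auto
    then show ?thesis by simp
  qed
  then show ?thesis by (simp add: reg_def)
qed

lemma reg_cmult: "reg B f \<Longrightarrow> reg B (\<lambda>x. c * f x)"
  unfolding reg_def by (metis mult.left_commute mult_left_mono zero_le)

section \<open>Finitely many cells of positive volume, and comparison with the integral\<close>

definition cell :: "'a \<Rightarrow> 'a set" where "cell x = {y \<in> K0. sim x y}"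

lemma cell_eq: "y \<in> cell x \<Longrightarrow> cell y = cell x"
  unfolding cell_def using sim_sym sim_trans by blast

lemma cell_subset: "cell x \<subseteq> K0" by (auto simp: cell_def)

lemma in_cell: "x \<in> K0 \<Longrightarrow> x \<in> cell x" by (simp add: cell_def)

lemma open_cell': "x \<in> K0 \<Longrightarrow> open (cell x)"
  using open_cell by (simp add: cell_def)

lemma finite_cells: "finite (cell ` K0)"
proof -
  define S where "S x = {p \<in> Phi. qf (fst p) (fst (snd p)) (snd (snd p)) x > 0}" for x
  have "cell x = {y \<in> K0. S y = S x}" if x: "x \<in> K0" for x
  proof -
    have "sim x y \<longleftrightarrow> S y = S x" if y: "y \<in> K0" for y
    proof
      assume s: "sim x y"
      show "S y = S x"
      proof (rule set_eqI)
        fix p :: "int \<times> 'a \<times> int"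
        obtain A z C where p: "p = (A, z, C)" by (cases p) auto
        show "p \<in> S y \<longleftrightarrow> p \<in> S x"
        proof (cases "p \<in> Phi")
          case True
          then have "sgn (qf A z C x) = sgn (qf A z C y)" using s p by (auto simp: sim_def)
          then show ?thesis using True p by (auto simp: S_def sgn_if split: if_splits)
        qed (simp add: S_def)
      qed
    next
      assume s: "S y = S x"
      have "sgn (qf A z C x) = sgn (qf A z C y)" if p: "(A, z, C) \<in> Phi" for A z C
      proof -
        have "(A, z, C) \<in> S y \<longleftrightarrow> (A, z, C) \<in> S x" using s by simp
        then have "qf A z C y > 0 \<longleftrightarrow> qf A z C x > 0" using p by (simp add: S_def)
        moreover have "qf A z C x \<noteq> 0" "qf A z C y \<noteq> 0" using x y p by (auto simp: K0_def)
        ultimately show ?thesis by (auto simp: sgn_if)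
      qed
      then show "sim x y" by (auto simp: sim_def)
    qed
    then show ?thesis by (auto simp: cell_def)
  qed
  then have "cell ` K0 \<subseteq> (\<lambda>s. {y \<in> K0. S y = s}) ` Pow Phi" by (force simp: S_def)
  then show ?thesis using finite_Phi finite_subset by blast
qed

lemma emeasure_K0_finite: "emeasure lebesgue K0 < \<infinity>"
proof -
  have "bounded K0" using bounded_K K0_subset_K bounded_subset by blast
  then have "K0 \<in> lmeasurable" using sets_K0 by (rule bounded_set_imp_lmeasurable)
  then show ?thesis by (simp add: fmeasurable_def)
qed

lemma K0_nonempty: "K0 \<noteq> {}"
proof
  assume "K0 = {}"
  then have "negligible K" using negligible_K_diff_K0 by simp
  then have "negligible (ball (0::'a) (1/2))" using ball_subset_Ko Ko_subset_K negligible_subset by blast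
  moreover have "\<not> negligible (ball (0::'a) (1/2))" by (intro open_not_negligible) auto
  ultimately show False by blast
qed

lemma emeasure_cell_pos: "x \<in> K0 \<Longrightarrow> 0 < emeasure lebesgue (cell x)"
proof -
  assume x: "x \<in> K0"
  then have "\<not> negligible (cell x)" using open_cell' in_cell by (intro open_not_negligible) auto
  then show ?thesis using open_cell'[OF x]
    by (auto simp: negligible_iff_emeasure0 zero_less_iff_neq_zero)
qed

definition vol :: real where "vol = measure lebesgue K0"

lemma vol: "emeasure lebesgue K0 = ennreal vol" "vol > 0"
proof -
  show *: "emeasure lebesgue K0 = ennreal vol"
    unfolding vol_def using emeasure_K0_finite by (intro emeasure_eq_ennreal_measure) auto
  obtain x where "x \<in> K0" using K0_nonempty by blast
  then have "0 < emeasure lebesgue K0"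
    using emeasure_cell_pos[of x] emeasure_mono[OF cell_subset sets_K0, of x] by (rule_tac less_le_trans)
  then show "vol > 0" using * by (simp add: ennreal_less_zero_iff)
qed

definition cmin :: ennreal where "cmin = Min (emeasure lebesgue ` cell ` K0)"

lemma cmin: "0 < cmin" "cmin < \<infinity>" "x \<in> K0 \<Longrightarrow> cmin \<le> emeasure lebesgue (cell x)"
proof -
  have fin: "finite (emeasure lebesgue ` cell ` K0)" "emeasure lebesgue ` cell ` K0 \<noteq> {}"
    using finite_cells K0_nonempty by auto
  show "0 < cmin" unfolding cmin_def using emeasure_cell_pos fin by (subst Min_gr_iff) auto
  show le: "cmin \<le> emeasure lebesgue (cell x)" if "x \<in> K0" for x
    unfolding cmin_def using fin that by (intro Min_le) auto
  obtain x where "x \<in> K0" using K0_nonempty by blast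
  then have "cmin \<le> emeasure lebesgue K0"
    using le[of x] emeasure_mono[OF cell_subset sets_K0, of x] by auto
  then show "cmin < \<infinity>" using emeasure_K0_finite by (rule le_less_trans)
qed

lemma dist_K0: "x \<in> K0 \<Longrightarrow> y \<in> K0 \<Longrightarrow> dist x y \<le> 2"
  using norm_K0[of x] norm_K0[of y] rho norm_triangle_ineq4[of x y] by (simp add: dist_norm)

lemma reg_le_cell:
  assumes "reg BB f" "x \<in> K0" "y \<in> cell x" shows "f x \<le> ennreal (exp (2 * BB)) * f y"
proof -
  have y: "y \<in> K0" "sim x y" using assms by (auto simp: cell_def)
  then have "f x \<le> ennreal (exp (BB * dist x y)) * f y" using assms by (auto simp: reg_def)
  also have "\<dots> \<le> ennreal (exp (2 * BB)) * f y"
    using dist_K0[OF assms(2) y(1)] BB_pos by (intro mult_right_mono ennreal_leI) auto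
  finally show ?thesis .
qed

definition Csup :: ennreal where "Csup = ennreal (exp (2 * BB)) / cmin"

lemma Csup_finite: "Csup < \<infinity>"
proof -
  have "ennreal (exp (2 * BB)) / cmin \<noteq> top" using cmin(1,2) by (auto simp: ennreal_divide_eq_top_iff)
  then show ?thesis by (simp add: Csup_def less_top)
qed

text \<open>A Harnack inequality: the value at \<open>x\<close> is at most
  \<open>exp (2 * BB)\<close> times every value on its cell, whose volume is at least
  \<open>cmin\<close>. The exponent uses the bound 2 for distances in \<open>K0\<close>.\<close>

lemma reg_le_mass:
  assumes f [measurable]: "f \<in> borel_measurable lebesgue" and "reg BB f" "x \<in> K0"
  shows "f x \<le> Csup * mass f"
proof -
  have [measurable]: "cell x \<in> sets lebesgue" using open_cell'[OF assms(3)] by simp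
  have "f x * cmin \<le> f x * emeasure lebesgue (cell x)" 
    by (rule mult_left_mono[OF cmin(3)[OF assms(3)]]) simp
  also have "\<dots> = (\<integral>\<^sup>+y\<in>cell x. f x \<partial>lebesgue)" by (simp add: nn_integral_cmult_indicator)
  also have "\<dots> \<le> (\<integral>\<^sup>+y. ennreal (exp (2 * BB)) * (f y * indicator K0 y) \<partial>lebesgue)"
    using reg_le_cell[OF assms(2,3)] cell_subset[of x]
    by (intro nn_integral_mono) (auto split: split_indicator)
  also have "\<dots> = ennreal (exp (2 * BB)) * mass f" unfolding mass_def by (intro nn_integral_cmult) measurable
  finally have *: "f x * cmin \<le> ennreal (exp (2 * BB)) * mass f" .
  have "f x = f x * cmin / cmin" using cmin by (simp add: ennreal_mult_divide_eq)
  also have "\<dots> \<le> ennreal (exp (2 * BB)) * mass f / cmin" using * by (rule divide_right_mono_ennreal)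
  also have "\<dots> = Csup * mass f" by (simp add: Csup_def ennreal_times_divide mult.commute divide_ennreal_def mult_ac)
  finally show ?thesis .
qed

end

section \<open>Irreducibility\<close>

context cf_lattice
begin

definition supp :: "('a \<Rightarrow> ennreal) \<Rightarrow> 'a set" where "supp f = {x \<in> K0. f x \<noteq> 0}"

lemma supp_cell: "reg B f \<Longrightarrow> x \<in> supp f \<Longrightarrow> y \<in> cell x \<Longrightarrow> y \<in> supp f"
  unfolding supp_def reg_def cell_def by fastforce

lemma open_supp: assumes "reg B f" shows "open (supp f)"
proof -
  have "x \<in> K0" if "x \<in> supp f" for x using that by (simp add: supp_def)
  then have "supp f = (\<Union>x\<in>supp f. cell x)" and "open (\<Union>x\<in>supp f. cell x)"
    using supp_cell[OF assms] in_cell open_cell' by blast+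
  then show ?thesis by simp
qed

lemma supp_transfer:
  assumes "y \<in> K0" "a \<in> Z" "\<iota> (y + a) \<in> supp f" shows "y \<in> supp (transfer f)"
proof -
  have "norm (y + a) > 0" using K0_add_ne_0 assms by auto
  then have "branch a f y \<noteq> 0" using assms by (auto simp: supp_def branch_def jac_def)
  moreover have "branch a f y \<le> transfer f y"
    unfolding transfer_def by (rule nn_integral_ge_point[OF assms(2)])
  ultimately show ?thesis using assms by (auto simp: supp_def)
qed

lemma generic_point:
  assumes "open S" "S \<noteq> {}" shows "\<exists>y\<in>S. y \<noteq> 0 \<and> (\<exists>a\<in>Z. \<iota> y - a \<in> K0)"
proof (rule ccontr)
  assume *: "\<not> ?thesis"
  have "S \<subseteq> insert 0 (\<iota> ` {x. \<not> (\<exists>a\<in>Z. x - a \<in> K0)})"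
  proof
    fix y assume "y \<in> S"
    then have "y = 0 \<or> \<not> (\<exists>a\<in>Z. \<iota> y - a \<in> K0)" using * by auto
    moreover have "y = \<iota> (\<iota> y)" by simp
    ultimately show "y \<in> insert 0 (\<iota> ` {x. \<not> (\<exists>a\<in>Z. x - a \<in> K0)})" by blast
  qed
  moreover have "negligible (insert 0 (\<iota> ` {x. \<not> (\<exists>a\<in>Z. x - a \<in> K0)}))"
    using negligible_inv_image[OF negligible_not_K0_translate] by simp
  ultimately have "negligible S" using negligible_subset by blast
  then show False using open_not_negligible assms by blast
qed

text \<open>The constant term is a nonzero integer. The other terms add up to less than 1 at this
  radius, by the bounds 2 and 5 on the coefficients of forms of the family.\<close>

lemma qf_sgn_near_0:
  assumes "(A, z, C) \<in> Phi" "C \<noteq> 0" "norm x < 1/20" shows "sgn (qf A z C x) = sgn (of_int C)"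
proof -
  have "\<bar>of_int A * (x \<bullet> x)\<bar> \<le> 2 * (1/20 * (1/20))"
  proof -
    have "norm x * norm x \<le> 1/20 * (1/20)" using assms(3) by (intro mult_mono) auto
    then have "x \<bullet> x \<le> 1/20 * (1/20)"
      by (simp add: power2_norm_eq_inner[symmetric] power2_eq_square)
    moreover have "\<bar>real_of_int A\<bar> \<le> 2" using Phi_bounds(1)[OF assms(1)] by linarith
    ultimately show ?thesis unfolding abs_mult by (intro mult_mono) auto
  qed
  moreover have "\<bar>x \<bullet> z\<bar> \<le> 1/20 * 5"
  proof -
    have "\<bar>x \<bullet> z\<bar> \<le> norm x * norm z" by (rule Cauchy_Schwarz_ineq2)
    also have "\<dots> \<le> 1/20 * 5" using assms(3) Phi_bounds(2)[OF assms(1)] by (intro mult_mono) auto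
    finally show ?thesis .
  qed
  ultimately have "\<bar>qf A z C x - of_int C\<bar> < 1" unfolding qf_def by linarith
  moreover have "C \<ge> 1 \<or> C \<le> -1" using assms by linarith
  then have "real_of_int C \<ge> 1 \<or> real_of_int C \<le> -1" by linarith
  ultimately show ?thesis by (auto simp: sgn_if)
qed

lemma norm_small_in_Ko: "norm x < 1/2 \<Longrightarrow> x \<in> Ko"
  using ball_subset_Ko by auto

lemma units_uminus: "u \<in> units \<Longrightarrow> - u \<in> units" and units_orth: "u \<in> units \<Longrightarrow> orth u \<in> units"
  by (auto simp: units_def Z_uminus orth_Z)

lemma K0_unit_inner: "y \<in> K0 \<Longrightarrow> u \<in> units \<Longrightarrow> \<bar>2 * (y \<bullet> u)\<bar> < 1" "y \<in> K0 \<Longrightarrow> u \<in> units \<Longrightarrow> y \<bullet> u \<noteq> 0"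
proof -
  assume y: "y \<in> K0" "u \<in> units"
  then have "y \<bullet> u < 1/2" "y \<bullet> (- u) < 1/2" using units_uminus K0_subset_Ko unfolding Ko_def by blast+
  then show "\<bar>2 * (y \<bullet> u)\<bar> < 1" by simp
  have "(0, u, 0) \<in> Phi" using y by (simp add: unit_form mm_def)
  then show "y \<bullet> u \<noteq> 0" using y by (auto simp: K0_def qf_def)
qed

text \<open>Serves forms that vanish at 0. Along a branch they become an integer plus a linear term
  of absolute value below 1, so only the sign of the linear term can matter.\<close>

lemma sgn_int_add:
  fixes s t :: real
  assumes "\<bar>s\<bar> < 1" "\<bar>t\<bar> < 1" "sgn s = sgn t"
  shows "sgn (of_int k + s) = sgn (of_int k + t)"
proof -
  consider "k = 0" | "real_of_int k \<ge> 1" | "real_of_int k \<le> -1" by linarith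
  then show ?thesis using assms by cases (auto simp: sgn_if split: if_splits)
qed

text \<open>A regular function whose support accumulates at 0 becomes positive after two steps: the
  part of a cell near 0 is mapped by \<open>\<iota>\<close> onto the far part of a polyhedron; one lattice translate
  of \<open>K0\<close> in it contains a cone with vertex 0, and the inversion of a cone contains
  complete translates of \<open>K0\<close>.\<close>

lemma supp_transfer2_of_zero_closure:
  assumes reg: "reg BB f" and 0: "0 \<in> closure (supp f)"
  shows "K0 \<subseteq> supp (transfer (transfer f))"
proof -
  have "open (supp f \<inter> ball 0 (1/22))" using open_supp[OF reg] by auto
  moreover have "\<exists>y\<in>supp f. dist y 0 < 1/22"
    using 0[unfolded closure_approachable, THEN spec[of _ "1/22"]] by simp
  then have "supp f \<inter> ball 0 (1/22) \<noteq> {}" by (auto simp: dist_commute)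
  ultimately obtain y a where y: "y \<in> supp f" "norm y < 1/22" "y \<noteq> 0" "a \<in> Z" "\<iota> y - a \<in> K0"
    using generic_point[of "supp f \<inter> ball 0 (1/22)"] by auto
  define y0 where "y0 = \<iota> y - a"
  have y0: "y0 \<in> K0" "\<iota> (y0 + a) = y" "y0 + a \<noteq> 0" using y by (auto simp: y0_def)
  \<comment> \<open>Replacing \<open>y0\<close> by another point of \<open>K0\<close> costs at most
    2, which leaves a norm above 20. This matches the radius 1/20 at which forms with nonzero
    constant coefficient have a determined sign.\<close>
  have nw: "norm (y0 + a) > 22"
  proof -
    have "22 < 1 / norm y" using y(2,3) by (simp add: less_divide_eq mult.commute)
    then show ?thesis by (simp add: y0_def norm_inv)
  qed
  \<comment> \<open>For fixed \<open>a\<close> the cell of the preimage of \<open>y1\<close> depends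
    only on the signs of \<open>y1 \<bullet> u\<close>: near 0, forms with
    \<open>C \<noteq> 0\<close> have the sign of \<open>C\<close>, and the others become an integer
    plus a linear term in a unit. Hence the new support contains the part of \<open>K0\<close> in a
    whole cone.\<close>
  have W1: "y1 \<in> supp (transfer f)" if y1: "y1 \<in> K0" "\<And>u. u \<in> units \<Longrightarrow> sgn (y1 \<bullet> u) = sgn (y0 \<bullet> u)" for y1
  proof -
    define x1 where "x1 = \<iota> (y1 + a)"
    have "norm (y0 + a) \<le> norm (y1 + a) + dist y1 y0"
    proof -
      have eq: "y0 + a = (y1 + a) + (y0 - y1)" by simp
      show ?thesis unfolding dist_norm norm_minus_commute[of y1] by (subst eq) (rule norm_triangle_ineq)
    qed
    then have nw1: "norm (y1 + a) > 20" using nw dist_K0[OF y1(1) y0(1)] by linarith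
    then have "1 / norm (y1 + a) < 1 / 20" by (intro divide_strict_left_mono) auto
    then have nx1: "norm x1 < 1/20" by (simp add: x1_def norm_inv)
    then have "x1 \<in> K" using norm_small_in_Ko Ko_subset_K by auto
    then have x1: "x1 \<in> K0" using branch_in_K0 y1 y by (simp add: x1_def)
    have "sgn (qf A z C y) = sgn (qf A z C x1)" if p: "(A, z, C) \<in> Phi" for A z C
    proof (cases "C = 0")
      case False
      then show ?thesis using qf_sgn_near_0[OF p False, of y] qf_sgn_near_0[OF p False nx1] y by simp
    next
      case True
      then have z: "z \<in> units" using p by (auto simp: Phi_def form_def units_def norm_eq_1)
      then have oz: "orth z \<in> units" by (rule units_orth)
      obtain k where k: "2 * (a \<bullet> orth z) = of_int k"
        using Z_double_inner[of a "orth z"] y unitsD(1)[OF oz] by (auto elim: Ints_cases)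
      have *: "sgn (qf A z C (\<iota> (v + a))) = sgn (of_int (A - k) + (- 2 * (v \<bullet> orth z)))"
        if v: "v + a \<noteq> 0" for v
      proof -
        have "qf A z C (\<iota> (v + a)) * ((v + a) \<bullet> (v + a)) = of_int (A - k) + (- 2 * (v \<bullet> orth z))"
          using qf_inv[OF v, of A z C] True k by (simp add: qf_def inner_add_left)
        then have "sgn (of_int (A - k) + (- 2 * (v \<bullet> orth z))) = sgn (qf A z C (\<iota> (v + a)) * ((v + a) \<bullet> (v + a)))"
          by simp
        also have "\<dots> = sgn (qf A z C (\<iota> (v + a)))" using v by (simp add: sgn_mult)
        finally show ?thesis by simp
      qed
      have "sgn (of_int (A - k) + (- 2 * (y0 \<bullet> orth z))) = sgn (of_int (A - k) + (- 2 * (y1 \<bullet> orth z)))"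
        using K0_unit_inner(1)[OF y0(1) oz] K0_unit_inner(1)[OF y1(1) oz] y1(2)[OF oz]
        by (intro sgn_int_add) (auto simp: sgn_mult)
      then show ?thesis using *[of y0] *[of y1] y0 K0_add_ne_0[OF y1(1) y(4)] by (simp add: x1_def)
    qed
    then have "x1 \<in> cell y" using x1 by (auto simp: cell_def sim_def)
    then have "x1 \<in> supp f" using supp_cell[OF reg y(1)] by simp
    then show ?thesis using supp_transfer[OF y1(1) y(4)] by (simp add: x1_def)
  qed
  define \<delta> where "\<delta> = Min ((\<lambda>u. \<bar>y0 \<bullet> u\<bar>) ` units)"
  have fin: "finite ((\<lambda>u. \<bar>y0 \<bullet> u\<bar>) ` units)" "(\<lambda>u. \<bar>y0 \<bullet> u\<bar>) ` units \<noteq> {}"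
    using finite_units units_ne by auto
  have \<delta>: "\<delta> > 0" unfolding \<delta>_def using fin K0_unit_inner(2)[OF y0(1)] by (subst Min_gr_iff) auto
  have \<delta>_le: "\<delta> \<le> \<bar>y0 \<bullet> u\<bar>" if "u \<in> units" for u unfolding \<delta>_def using fin that by (intro Min_le) auto
  show ?thesis
  proof
    fix y2 assume y2: "y2 \<in> K0"
    \<comment> \<open>At this distance along \<open>orth y0\<close> every inner product with
      \<open>orth u\<close>, for a unit \<open>u\<close>, is at least 5 in absolute value. Rounding
      to the lattice and adding \<open>y2\<close> disturb it by at most 2, so all signs are those of
      \<open>y0 \<bullet> u\<close>, and the norm is at least 3.\<close>
    define t where "t = 5 / \<delta>"
    define b where "b = nearest Z K (t *\<^sub>R orth y0)"
    define e where "e = t *\<^sub>R orth y0 - b"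
    have b: "b \<in> Z" "b = t *\<^sub>R orth y0 - e" using nearest by (auto simp: b_def e_def)
    have "e \<in> K" using nearest by (auto simp: b_def e_def)
    then have ne2: "norm (y2 - e) \<le> 2"
      using norm_K[of e] norm_K0[OF y2] rho norm_triangle_ineq4[of y2 e] by linarith
    have t: "t > 0" "t * \<delta> = 5" using \<delta> by (auto simp: t_def)
    have big: "5 \<le> \<bar>t * (y0 \<bullet> u)\<bar>" if "u \<in> units" for u
      using mult_left_mono[OF \<delta>_le[OF that], of t] t by (simp add: abs_mult)
    have inner: "(y2 + b) \<bullet> orth u = t * (y0 \<bullet> u) + (y2 - e) \<bullet> orth u" for u
      by (simp add: b(2) inner_add_left inner_diff_left orth_inner)
    have small: "\<bar>(y2 - e) \<bullet> orth u\<bar> \<le> 2" if "u \<in> units" for u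
      using Cauchy_Schwarz_ineq2[of "y2 - e" "orth u"] ne2 unitsD(2)[OF that] by simp
    define x2 where "x2 = \<iota> (y2 + b)"
    obtain u0 where u0: "u0 \<in> units" using units_ne by blast
    have "3 \<le> \<bar>(y2 + b) \<bullet> orth u0\<bar>" using inner[of u0] big[OF u0] small[OF u0] by linarith
    also have "\<dots> \<le> norm (y2 + b)" using Cauchy_Schwarz_ineq2[of "y2 + b" "orth u0"] unitsD(2)[OF u0] by simp
    finally have n3: "3 \<le> norm (y2 + b)" .
    then have "1 / norm (y2 + b) \<le> 1 / 3" by (intro divide_left_mono) auto
    then have "norm x2 < 1/2" by (simp add: x2_def norm_inv)
    then have "x2 \<in> K" using norm_small_in_Ko Ko_subset_K by auto
    then have x2: "x2 \<in> K0" using branch_in_K0 y2 b by (simp add: x2_def)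
    have "sgn (x2 \<bullet> u) = sgn (y0 \<bullet> u)" if u: "u \<in> units" for u
    proof -
      have "sgn (x2 \<bullet> u) = sgn ((y2 + b) \<bullet> orth u)"
      proof -
        have "sgn (norm (y2 + b)) = 1" using n3 by (intro sgn_pos) linarith
        then show ?thesis by (simp add: x2_def inv_inner sgn_divide)
      qed
      also have "\<dots> = sgn (t * (y0 \<bullet> u))"
        using big[OF u] small[OF u] unfolding inner by (auto simp: sgn_if)
      also have "\<dots> = sgn (y0 \<bullet> u)" using t by (simp add: sgn_mult)
      finally show ?thesis .
    qed
    then have "x2 \<in> supp (transfer f)" using W1 x2 by blast
    then show "y2 \<in> supp (transfer (transfer f))" using supp_transfer[OF y2 b(1)] by (simp add: x2_def)
  qed
qed

text \<open>A limit point of a cell may have no digit compatible with that cell. Nearby generic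
  points of the support do, and their digits lie within distance 2 of \<open>\<iota> x\<close>; if
  all these finitely many candidates failed, a uniform gap would separate the orbit points from the
  new support.\<close>

lemma closure_supp_step:
  assumes reg: "reg BB f" and x: "x \<in> closure (supp f)" "x \<noteq> 0"
  shows "\<exists>a\<in>Z. \<iota> x - a \<in> closure (supp (transfer f))"
proof (rule ccontr)
  assume no: "\<not> ?thesis"
  let ?g = "transfer f"
  define F where "F = Z \<inter> cball (\<iota> x) 2"
  have "\<exists>e>0. \<forall>y\<in>supp ?g. e \<le> dist y (\<iota> x - a)" if "a \<in> F" for a
    using no that unfolding closure_approachable F_def by (meson IntD1 not_less)
  then obtain ea where ea: "\<And>a. a \<in> F \<Longrightarrow> ea a > 0" "\<And>a y. a \<in> F \<Longrightarrow> y \<in> supp ?g \<Longrightarrow> ea a \<le> dist y (\<iota> x - a)"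
    by metis
  define e where "e = Min (insert 1 (ea ` F))"
  have fin: "finite (insert 1 (ea ` F))" using finite_Z_cball by (simp add: F_def)
  have e: "0 < e" "e \<le> 1" "\<And>a. a \<in> F \<Longrightarrow> e \<le> ea a"
  proof -
    show "0 < e" unfolding e_def using fin ea(1) by (subst Min_gr_iff) auto
    show "e \<le> 1" unfolding e_def using fin by (intro Min_le) auto
    show "e \<le> ea a" if "a \<in> F" for a unfolding e_def using fin that by (intro Min_le) auto
  qed
  obtain d where d: "d > 0" "\<And>y. dist y x < d \<Longrightarrow> dist (\<iota> y) (\<iota> x) < e"
    using isCont_inv[OF x(2)] e unfolding continuous_at_eps_delta by blast
  have "open (supp f \<inter> ball x d)" using open_supp[OF reg] by auto
  moreover have "\<exists>y\<in>supp f. dist y x < d"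
    using x d unfolding closure_approachable by blast
  then have "supp f \<inter> ball x d \<noteq> {}" by (auto simp: dist_commute)
  ultimately obtain y a where y: "y \<in> supp f" "dist y x < d" "y \<noteq> 0" "a \<in> Z" "\<iota> y - a \<in> K0"
    using generic_point[of "supp f \<inter> ball x d"] by (auto simp: dist_commute)
  have dd: "dist (\<iota> y) (\<iota> x) < e" using d y by auto
  have "\<iota> y - a \<in> supp ?g" using supp_transfer[OF y(5,4)] y by simp
  moreover have "a \<in> F"
  proof -
    have "dist (\<iota> x) a \<le> dist (\<iota> y) (\<iota> x) + norm (\<iota> y - a)"
      by (metis dist_norm dist_commute dist_triangle)
    also have "\<dots> \<le> 2" using dd e(2) norm_K0[OF y(5)] rho by linarith
    finally show ?thesis using y by (simp add: F_def)
  qed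
  moreover have "dist (\<iota> y - a) (\<iota> x - a) = dist (\<iota> y) (\<iota> x)" by (simp add: dist_norm)
  ultimately show False using ea(2) e(3) dd by fastforce
qed

lemma closure_supp_norm: "x \<in> closure (supp f) \<Longrightarrow> norm x \<le> \<rho>"
proof -
  assume "x \<in> closure (supp f)"
  moreover have "supp f \<subseteq> cball 0 \<rho>" using norm_K0 by (auto simp: supp_def)
  ultimately have "x \<in> cball 0 \<rho>" using closure_minimal closed_cball by blast
  then show ?thesis by simp
qed

text \<open>Along the orbit of a point \<open>z / q\<close> with \<open>q\<close> dividing \<open>|z|\<^sup>2\<close> the denominators decrease.\<close>

lemma supp_everything_of_rational:
  assumes "reg BB f" "z \<in> Z" "0 < q" "z \<bullet> z = real q * real l" "z /\<^sub>R real q \<in> closure (supp f)"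
  shows "\<exists>n. K0 \<subseteq> supp ((transfer ^^ n) f)"
  using assms
proof (induction q arbitrary: f z l rule: less_induct)
  case (less q)
  show ?case
  proof (cases "z = 0")
    case True
    then have "K0 \<subseteq> supp (transfer (transfer f))"
      using supp_transfer2_of_zero_closure less.prems by simp
    then show ?thesis by (intro exI[of _ 2]) (simp add: numeral_2_eq_2)
  next
    case False
    let ?x = "z /\<^sub>R real q"
    have zz: "z \<bullet> z > 0" using False by simp
    then have l: "l > 0" using less.prems(4) by (cases l) auto
    have "(norm ?x)\<^sup>2 < 1"
      using closure_supp_norm[OF less.prems(5)] rho power_strict_mono[of "norm ?x" 1 2] by auto
    then have "(z \<bullet> z) / (real q)\<^sup>2 < 1"
      by (simp add: power_mult_distrib power2_norm_eq_inner power_inverse divide_inverse mult.commute)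
    \<comment> \<open>The squared norm of \<open>z / q\<close> is \<open>l / q\<close>, so lying in
      the open unit ball means that the next denominator \<open>l\<close> is smaller.\<close>
    then have lq: "l < q" using less.prems(3,4) by (simp add: power2_eq_square)
    have "orth ?x = orth z /\<^sub>R real q" using linear_orth by (simp add: linear_cmul)
    moreover have "(norm ?x)\<^sup>2 = real l / real q"
      using less.prems(3,4) by (simp add: power_mult_distrib power2_norm_eq_inner power_inverse)
        (simp add: field_simps power2_eq_square)
    ultimately have ix: "\<iota> ?x = orth z /\<^sub>R real l"
      using less.prems(3) l by (subst inv_eq_orth) (simp add: divide_inverse)
    have "?x \<noteq> 0" using False less.prems by simp
    then obtain a where a: "a \<in> Z" "\<iota> ?x - a \<in> closure (supp (transfer f))"
      using closure_supp_step less.prems by blast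
    define z' where "z' = orth z - real l *\<^sub>R a"
    have z': "z' \<in> Z" using less.prems a by (auto simp: z'_def orth_Z Z_scaleR_nat intro!: Z_diff)
    have x': "\<iota> ?x - a = z' /\<^sub>R real l" using l by (simp add: ix z'_def scaleR_diff_right)
    obtain k where k: "2 * (orth z \<bullet> a) = of_int k"
      using Z_double_inner[of "orth z" a] less.prems a orth_Z by (auto elim: Ints_cases)
    obtain j where j: "a \<bullet> a = of_int j" using Z_norm_sq[of a] a by (auto elim: Ints_cases)
    \<comment> \<open>The cofactor of \<open>l\<close> in \<open>z' \<bullet> z'\<close>;
      integrality of the lattice makes it an integer, which restores the divisibility condition for
      the denominator \<open>l\<close>.\<close>
    define l' where "l' = int q - k + int l * j"
    have "z' \<bullet> z' = z \<bullet> z - real l * (2 * (orth z \<bullet> a)) + real l * real l * (a \<bullet> a)"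
      by (simp add: z'_def inner_diff_left inner_diff_right orth_inner inner_commute algebra_simps)
    then have zl: "z' \<bullet> z' = real l * of_int l'"
      using less.prems(4) k j by (simp add: l'_def algebra_simps)
    then have "l' \<ge> 0" using l inner_ge_zero[of z'] by (simp add: zero_le_mult_iff)
    then have "z' \<bullet> z' = real l * real (nat l')" using zl by simp
    then obtain n where "K0 \<subseteq> supp ((transfer ^^ n) (transfer f))"
      using less.IH[OF lq reg_transfer_pow[OF less.prems(1), of 1, simplified] z' l] a(2)
      unfolding x' by blast
    then show ?thesis by (intro exI[of _ "Suc n"]) (simp add: funpow_Suc_right del: funpow.simps)
  qed
qed

lemma supp_eventually_everything:
  assumes "reg BB f" "supp f \<noteq> {}" shows "\<exists>n. K0 \<subseteq> supp ((transfer ^^ n) f)"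
proof -
  obtain y where y: "y \<in> supp f" using assms by blast
  then obtain e where e: "e > 0" "ball y e \<subseteq> supp f" using open_supp[OF assms(1)] openE by blast
  obtain m :: nat where m: "1 / e < real m" using reals_Archimedean2 by blast
  have m0: "m > 0" using m e by (cases m) (auto simp: field_simps)
  define w where "w = nearest Z K (real m *\<^sub>R y)"
  have w: "w \<in> Z" "real m *\<^sub>R y - w \<in> K" using nearest by (auto simp: w_def)
  have "y - w /\<^sub>R real m = (real m *\<^sub>R y - w) /\<^sub>R real m" using m0 by (simp add: scaleR_diff_right)
  then have "dist y (w /\<^sub>R real m) = norm (real m *\<^sub>R y - w) / real m"
    by (simp add: dist_norm divide_inverse mult.commute)
  also have "\<dots> \<le> 1 / real m" using norm_K[OF w(2)] rho m0 by (intro divide_right_mono) auto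
  also have "\<dots> < e" using m e m0 by (simp add: field_simps)
  finally have "w /\<^sub>R real m \<in> supp f" using e by auto
  then have cl: "w /\<^sub>R real m \<in> closure (supp f)" using closure_subset by blast
  obtain k where k: "w \<bullet> w = of_int k" using Z_norm_sq[OF w(1)] by (auto elim: Ints_cases)
  have "k \<ge> 0" using inner_ge_zero[of w] k by simp
  show ?thesis
  \<comment> \<open>The rational point \<open>w / m\<close> is written as \<open>m w / m^2\<close>:
    the denominator then divides the squared norm of the numerator.\<close>
  proof (rule supp_everything_of_rational[of f "real m *\<^sub>R w" "m * m" "nat k"])
    show "real m *\<^sub>R w \<in> Z" using w by (rule_tac Z_scaleR_nat)
    show "(real m *\<^sub>R w) \<bullet> (real m *\<^sub>R w) = real (m * m) * real (nat k)" using k \<open>k \<ge> 0\<close> by simp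
    show "(real m *\<^sub>R w) /\<^sub>R real (m * m) \<in> closure (supp f)" using cl m0 by (simp add: field_simps)
  qed (use assms m0 in auto)
qed

text \<open>Every point of \<open>K0\<close> has a preimage in \<open>K0\<close>: the digit
  \<open>5 u\<close> with a unit \<open>u\<close> sends it into the ball of radius 1/2.\<close>

lemma supp_persists: "K0 \<subseteq> supp f \<Longrightarrow> K0 \<subseteq> supp (transfer f)"
proof
  fix y assume y: "y \<in> K0" and s: "K0 \<subseteq> supp f"
  obtain u where u: "u \<in> units" using units_ne by blast
  define b where "b = real 5 *\<^sub>R u"
  have b: "b \<in> Z" "norm b = 5" 
    using Z_scaleR_nat[OF unitsD(1)[OF u], of 5] unitsD(2)[OF u] by (auto simp: b_def)
  have "norm (y + b) \<ge> 4" using norm_triangle_ineq[of "y + b" "- y"] b norm_K0[OF y] rho by simp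
  then have "1 / norm (y + b) \<le> 1 / 4" by (intro divide_left_mono) auto
  then have "norm (\<iota> (y + b)) < 1/2" by (simp add: norm_inv)
  then have "\<iota> (y + b) \<in> K0" using branch_in_K0[OF y b(1)] norm_small_in_Ko Ko_subset_K by blast
  then show "y \<in> supp (transfer f)" using supp_transfer[OF y b(1)] s by blast
qed

lemma reg_indicator_cell: "reg BB (indicator (cell x))"
  unfolding reg_def
proof (intro ballI impI)
  fix y z assume yz: "y \<in> K0" "z \<in> K0" "sim y z"
  then have "y \<in> cell x \<longleftrightarrow> z \<in> cell x" 
    unfolding cell_def using sim_trans sim_sym by blast
  moreover have "(1::ennreal) \<le> ennreal (exp (BB * dist y z))" using BB_pos by simp
  ultimately show "(indicator (cell x) y :: ennreal) \<le> ennreal (exp (BB * dist y z)) * indicator (cell x) z"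
    by (simp add: indicator_def)
qed

section \<open>A lower bound for the iterates by a multiple of the integral\<close>

lemma uniform_covering_time: "\<exists>N. \<forall>x\<in>K0. K0 \<subseteq> supp ((transfer ^^ N) (indicator (cell x)))"
proof -
  have "\<exists>n. K0 \<subseteq> supp ((transfer ^^ n) (indicator P))" if P: "P \<in> cell ` K0" for P
  proof -
    obtain x where x: "x \<in> K0" "P = cell x" using P by blast
    then have "x \<in> supp (indicator P)" using in_cell by (auto simp: supp_def)
    then show ?thesis using supp_eventually_everything[OF reg_indicator_cell] x by blast
  qed
  then obtain n where n: "\<And>P. P \<in> cell ` K0 \<Longrightarrow> K0 \<subseteq> supp ((transfer ^^ n P) (indicator P))" by metis
  define N where "N = Max (n ` cell ` K0)"
  have pers: "K0 \<subseteq> supp ((transfer ^^ (k + m)) f)" if "K0 \<subseteq> supp ((transfer ^^ m) f)" for k m f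
    by (induction k) (use that supp_persists in auto)
  have "K0 \<subseteq> supp ((transfer ^^ N) (indicator (cell x)))" if "x \<in> K0" for x
  proof -
    have "n (cell x) \<le> N" unfolding N_def using finite_cells that by (intro Max_ge) auto
    then show ?thesis using pers[OF n[of "cell x"], of "N - n (cell x)"] that by auto
  qed
  then show ?thesis by blast
qed

text \<open>If every cell had a point with a smaller value, the Harnack inequality would bound the
  function everywhere by half its mean. The mass would then be 0, and no value lies strictly below
  0.\<close>

lemma reg_ge_mass:
  assumes f [measurable]: "f \<in> borel_measurable lebesgue" and "reg BB f" "mass f < \<infinity>"
  shows "\<exists>x\<in>K0. \<forall>y\<in>cell x. ennreal (exp (- 2 * BB) / (2 * vol)) * mass f \<le> f y"
proof (rule ccontr)
  assume no: "\<not> ?thesis"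
  obtain M where M: "mass f = ennreal M" "M \<ge> 0" using assms(3) by (cases "mass f") auto
  let ?c = "exp (- 2 * BB) / (2 * vol)"
  have up: "f x \<le> ennreal (M / (2 * vol))" if x: "x \<in> K0" for x
  proof -
    obtain y where y: "y \<in> cell x" "f y < ennreal ?c * mass f" using no x by (auto simp: not_le)
    have "f x \<le> ennreal (exp (2 * BB)) * f y" by (rule reg_le_cell[OF assms(2) x y(1)])
    also have "\<dots> \<le> ennreal (exp (2 * BB)) * (ennreal ?c * ennreal M)"
      using y M by (intro mult_left_mono) auto
    also have "\<dots> = ennreal (exp (2 * BB) * (?c * M))" using M vol by (simp add: ennreal_mult[symmetric])
    also have "exp (2 * BB) * (?c * M) = M / (2 * vol)"
      using vol by (simp add: exp_minus field_simps)
    finally show ?thesis .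
  qed
  have "mass f \<le> (\<integral>\<^sup>+x\<in>K0. ennreal (M / (2 * vol)) \<partial>lebesgue)"
    unfolding mass_def using up by (intro nn_integral_mono) (auto split: split_indicator)
  also have "\<dots> = ennreal (M / (2 * vol)) * ennreal vol" using vol by (simp add: nn_integral_cmult_indicator)
  also have "\<dots> = ennreal (M / 2)" using vol M by (simp add: ennreal_mult[symmetric])
  finally have "M \<le> M / 2" using M by (simp add: ennreal_le_iff)
  then have "M = 0" using M by simp
  obtain x where x: "x \<in> K0" using K0_nonempty by blast
  then obtain y where "f y < ennreal ?c * mass f" using no by (auto simp: not_le)
  then show False using \<open>M = 0\<close> M by simp
qed

text \<open>A Doeblin minorisation. A regular function dominates a multiple of the indicator of some
  cell, whose \<open>N\<close>-th iterate is positive on all cells; finitely many cells and the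
  Harnack inequality make the bound uniform.\<close>

lemma doeblin:
  "\<exists>N. \<exists>\<eta>>0. \<forall>f. f \<in> borel_measurable lebesgue \<longrightarrow> reg BB f \<longrightarrow> mass f < \<infinity> \<longrightarrow>
     (\<forall>y\<in>K0. ennreal \<eta> * mass f \<le> (transfer ^^ N) f y)"
proof -
  obtain N where N: "\<And>x. x \<in> K0 \<Longrightarrow> K0 \<subseteq> supp ((transfer ^^ N) (indicator (cell x)))"
    using uniform_covering_time by blast
  define rep where "rep P = (SOME y. y \<in> K0 \<and> cell y = P)" for P
  have rep: "rep (cell y) \<in> K0" "cell (rep (cell y)) = cell y" if "y \<in> K0" for y
    using someI[of "\<lambda>z. z \<in> K0 \<and> cell z = cell y" y] that by (auto simp: rep_def)
  define \<phi> where "\<phi> P = (transfer ^^ N) (indicator P)" for P :: "'a set"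
  \<comment> \<open>Evaluating at one representative per cell leaves finitely many positive numbers;
    the inserted 1 keeps their minimum finite.\<close>
  define \<kappa> where "\<kappa> = Min (insert 1 ((\<lambda>(P, Q). \<phi> P (rep Q)) ` (cell ` K0 \<times> cell ` K0)))"
  have fin: "finite (insert 1 ((\<lambda>(P, Q). \<phi> P (rep Q)) ` (cell ` K0 \<times> cell ` K0)))"
    using finite_cells by simp
  have \<kappa>_pos: "0 < \<kappa>"
    unfolding \<kappa>_def using fin N rep by (subst Min_gr_iff) (auto simp: \<phi>_def supp_def zero_less_iff_neq_zero)
  have "\<kappa> \<le> 1" unfolding \<kappa>_def using fin by (intro Min_le) auto
  then obtain k where k: "\<kappa> = ennreal k" "k > 0"
    using \<kappa>_pos by (cases \<kappa>) (auto simp: ennreal_less_zero_iff top_unique)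
  have \<kappa>_le: "\<kappa> \<le> \<phi> (cell x) (rep (cell y))" if "x \<in> K0" "y \<in> K0" for x y
    unfolding \<kappa>_def using fin that by (intro Min_le) auto
  have low: "ennreal (exp (- 2 * BB) * k) \<le> \<phi> (cell x) y" if "x \<in> K0" "y \<in> K0" for x y
  proof -
    have "\<kappa> \<le> \<phi> (cell x) (rep (cell y))" using \<kappa>_le that by auto
    also have "\<dots> \<le> ennreal (exp (2 * BB)) * \<phi> (cell x) y"
      unfolding \<phi>_def using rep[OF that(2)] in_cell[OF that(2)]
      by (intro reg_le_cell reg_transfer_pow reg_indicator_cell) auto
    finally have "ennreal (exp (- 2 * BB)) * \<kappa> \<le> ennreal (exp (- 2 * BB)) * (ennreal (exp (2 * BB)) * \<phi> (cell x) y)"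
      by (intro mult_left_mono) auto
    also have "\<dots> = \<phi> (cell x) y"
      by (simp add: mult.assoc[symmetric] ennreal_mult[symmetric] exp_add[symmetric])
    finally show ?thesis using k by (simp add: ennreal_mult[symmetric])
  qed
  let ?c = "exp (- 2 * BB) / (2 * vol)"
  show ?thesis
  proof (intro exI[of _ N] exI[of _ "?c * (exp (- 2 * BB) * k)"] conjI allI impI ballI)
    show "0 < ?c * (exp (- 2 * BB) * k)" using vol k by simp
    fix f y assume f: "f \<in> borel_measurable lebesgue" "reg BB f" "mass f < \<infinity>" and y: "y \<in> K0"
    obtain x where x: "x \<in> K0" "\<And>z. z \<in> cell x \<Longrightarrow> ennreal ?c * mass f \<le> f z"
      using reg_ge_mass[OF f] by blast
    have "ennreal (?c * (exp (- 2 * BB) * k)) * mass f = (ennreal ?c * mass f) * ennreal (exp (- 2 * BB) * k)"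
      using vol k by (subst ennreal_mult) (auto simp: mult_ac)
    also have "\<dots> \<le> (ennreal ?c * mass f) * \<phi> (cell x) y" using low[OF x(1) y] by (intro mult_left_mono) auto
    also have "\<dots> = (transfer ^^ N) (\<lambda>z. (ennreal ?c * mass f) * indicator (cell x) z) y"
      by (simp add: transfer_pow_cmult \<phi>_def)
    also have "\<dots> \<le> (transfer ^^ N) f y"
      using x(2) y by (intro transfer_pow_mono) (auto split: split_indicator)
    finally show "ennreal (?c * (exp (- 2 * BB) * k)) * mass f \<le> (transfer ^^ N) f y" .
  qed
qed

end

section \<open>Exponential convergence to the invariant density\<close>

context cf_lattice
begin

lemma mass_const: "mass (\<lambda>_. c) = c * ennreal vol"
  using vol by (simp add: mass_def nn_integral_cmult_indicator)

lemma mass_mono: "(\<And>x. x \<in> K0 \<Longrightarrow> f x \<le> g x) \<Longrightarrow> mass f \<le> mass g"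
  unfolding mass_def by (intro nn_integral_mono) (auto split: split_indicator)

lemma mass_cong: "(\<And>x. x \<in> K0 \<Longrightarrow> f x = g x) \<Longrightarrow> mass f = mass g"
  unfolding mass_def by (intro nn_integral_cong) (auto split: split_indicator)

lemma mass_add:
  assumes [measurable]: "f \<in> borel_measurable lebesgue" "g \<in> borel_measurable lebesgue"
  shows "mass (\<lambda>x. f x + g x) = mass f + mass g"
  unfolding mass_def by (simp add: distrib_right nn_integral_add)

lemma mass_cmult:
  assumes [measurable]: "f \<in> borel_measurable lebesgue"
  shows "mass (\<lambda>x. c * f x) = c * mass f"
  unfolding mass_def by (simp add: mult.assoc nn_integral_cmult)

lemma transfer_pow_finite:
  assumes "f \<in> borel_measurable lebesgue" "reg BB f" "mass f = ennreal M" "y \<in> K0"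
  shows "(transfer ^^ n) f y = ennreal (enn2real ((transfer ^^ n) f y))"
proof -
  have "(transfer ^^ n) f y \<le> Csup * ennreal M"
    using reg_le_mass[of "(transfer ^^ n) f" y] assms reg_transfer_pow mass_transfer_pow
    by (simp add: transfer_pow_measurable)
  moreover have "Csup * ennreal M < top" using Csup_finite by (simp add: ennreal_mult_less_top)
  ultimately show ?thesis by simp
qed

text \<open>Subtracting \<open>\<kappa>\<close> is allowed if
  \<open>\<kappa> * (exp (B * \<delta>) - 1)\<close> is at most
  \<open>(exp (B * \<delta>) - exp ((B - s) * \<delta>)) * Y\<close>. The left side is at most
  \<open>\<kappa> * B * \<delta> * exp (2 * B)\<close> and the right side at least
  \<open>s * \<delta> * Y\<close>; this is the origin of the factor
  \<open>s * exp (- 2 * B) / B\<close>, hence of \<open>c1\<close>.\<close>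

lemma exp_gap:
  fixes B s \<delta> :: real
  assumes "0 < s" "s \<le> B" "0 \<le> \<delta>" "\<delta> \<le> 2"
    and X: "X \<le> exp ((B - s) * \<delta>) * Y" and Y: "0 \<le> \<kappa>0" "\<kappa>0 \<le> Y"
    and \<kappa>: "0 \<le> \<kappa>" "\<kappa> \<le> s * exp (- 2 * B) / B * \<kappa>0"
  shows "X - \<kappa> \<le> exp (B * \<delta>) * (Y - \<kappa>)"
proof -
  have B: "B > 0" using assms by simp
  have t: "exp t - 1 \<le> t * exp t" if "t \<ge> 0" for t :: real
  proof -
    have "1 - t \<le> exp (- t)" using exp_ge_add_one_self[of "- t"] by simp
    then have "(1 - t) * exp t \<le> exp (- t) * exp t" by (intro mult_right_mono) auto
    also have "\<dots> = 1" by (simp add: exp_add[symmetric])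
    finally show ?thesis by (simp add: algebra_simps)
  qed
  have "\<kappa> * (exp (B * \<delta>) - 1) \<le> \<kappa> * (B * \<delta> * exp (B * \<delta>))"
    using \<kappa> t[of "B * \<delta>"] B assms by (intro mult_left_mono) auto
  also have "\<dots> \<le> (s * exp (- 2 * B) / B * \<kappa>0) * (B * \<delta> * exp (2 * B))"
    using \<kappa> B assms Y by (intro mult_mono) (auto intro!: mult_left_mono mult_nonneg_nonneg)
  also have "\<dots> = s * \<delta> * \<kappa>0" using B by (simp add: exp_minus field_simps)
  also have "\<dots> \<le> s * \<delta> * Y" using assms by (intro mult_left_mono) auto
  also have "\<dots> \<le> (exp (B * \<delta>) - exp ((B - s) * \<delta>)) * Y"
  proof (intro mult_right_mono)
    have "1 * (s * \<delta>) \<le> exp ((B - s) * \<delta>) * (exp (s * \<delta>) - 1)"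
    proof (intro mult_mono)
      show "s * \<delta> \<le> exp (s * \<delta>) - 1" using exp_ge_add_one_self[of "s * \<delta>"] by linarith
    qed (use assms in auto)
    also have "\<dots> = exp (B * \<delta>) - exp ((B - s) * \<delta>)"
      by (simp add: algebra_simps exp_add[symmetric])
    finally show "s * \<delta> \<le> exp (B * \<delta>) - exp ((B - s) * \<delta>)" by simp
  qed (use Y in auto)
  finally have "\<kappa> * (exp (B * \<delta>) - 1) \<le> (exp (B * \<delta>) - exp ((B - s) * \<delta>)) * Y" .
  then show ?thesis using X by (simp add: algebra_simps)
qed

lemma BB_ge: "1 - \<rho>\<^sup>2 \<le> BB" "1 \<le> BB"
proof -
  show "1 \<le> BB" using rho rho_sq by (simp add: BB_def)
  then show "1 - \<rho>\<^sup>2 \<le> BB" using zero_le_power2[of \<rho>] by linarith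
qed

definition c1 :: real where "c1 = (1 - \<rho>\<^sup>2) * exp (- 2 * BB) / BB"

lemma c1: "0 < c1" "c1 \<le> 1"
proof -
  show "0 < c1" using rho_sq BB_pos by (simp add: c1_def)
  have "(1 - \<rho>\<^sup>2) * exp (- 2 * BB) \<le> BB * 1" using BB_ge BB_pos rho_sq by (intro mult_mono) auto
  then show "c1 \<le> 1" using BB_pos by (simp add: c1_def)
qed

text \<open>The strict improvement of the regularity constant under \<open>transfer\<close> leaves room for subtracting a constant.\<close>
lemma reg_minus_const:
  assumes reg: "reg (BB - (1 - \<rho>\<^sup>2)) F" and fin: "\<And>x. x \<in> K0 \<Longrightarrow> F x < \<infinity>"
    and low: "\<And>x. x \<in> K0 \<Longrightarrow> ennreal \<kappa>0 \<le> F x" and \<kappa>: "0 \<le> \<kappa>0" "0 \<le> \<kappa>" "\<kappa> \<le> c1 * \<kappa>0"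
  shows "reg BB (\<lambda>x. F x - ennreal \<kappa>)"
  unfolding reg_def
proof (intro ballI impI)
  fix x y assume xy: "x \<in> K0" "y \<in> K0" "sim x y"
  obtain X where X: "F x = ennreal X" "X \<ge> 0" using fin[OF xy(1)] by (cases "F x") auto
  obtain Y where Y: "F y = ennreal Y" "Y \<ge> 0" using fin[OF xy(2)] by (cases "F y") auto
  have "ennreal X \<le> ennreal (exp ((BB - (1 - \<rho>\<^sup>2)) * dist x y)) * ennreal Y"
    using reg xy X Y unfolding reg_def by metis
  then have "X \<le> exp ((BB - (1 - \<rho>\<^sup>2)) * dist x y) * Y"
    using X Y by (simp add: ennreal_mult[symmetric])
  moreover have "\<kappa>0 \<le> Y" using low[OF xy(2)] Y by simp
  ultimately have "X - \<kappa> \<le> exp (BB * dist x y) * (Y - \<kappa>)"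
    using exp_gap[of "1 - \<rho>\<^sup>2" BB "dist x y" X Y \<kappa>0 \<kappa>] rho_sq BB_ge dist_K0[OF xy(1,2)] \<kappa>
    by (simp add: c1_def)
  moreover have "\<kappa> \<le> Y"
  proof -
    have "c1 * \<kappa>0 \<le> 1 * \<kappa>0" using c1 \<kappa> by (intro mult_right_mono) auto
    then show ?thesis using \<kappa> \<open>\<kappa>0 \<le> Y\<close> by simp
  qed
  ultimately show "F x - ennreal \<kappa> \<le> ennreal (exp (BB * dist x y)) * (F y - ennreal \<kappa>)"
    using X Y \<kappa> by (simp add: ennreal_minus ennreal_mult[symmetric] ennreal_leI)
qed

text \<open>One step more than in \<open>doeblin\<close> is used: read as \<open>N\<close> steps
  after one, the iterate has the lower bound; read as one step after \<open>N\<close>, it has the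
  improved regularity. Together they leave a regular remainder once a constant is removed.\<close>

lemma doeblin_split:
  "\<exists>N>0. \<exists>\<theta> c \<eta>. 0 < \<theta> \<and> \<theta> < 1 \<and> 0 < \<eta> \<and> 0 < c \<and>
    (\<forall>f M. f \<in> borel_measurable lebesgue \<longrightarrow> reg BB f \<longrightarrow> mass f = ennreal M \<longrightarrow> 0 \<le> M \<longrightarrow>
       (\<forall>y\<in>K0. ennreal (\<eta> * M) \<le> (transfer ^^ N) f y) \<and>
       (\<exists>g. g \<in> borel_measurable lebesgue \<and> reg BB g \<and> mass g = ennreal (\<theta> * M) \<and>
          (\<forall>y\<in>K0. (transfer ^^ N) f y = ennreal (c * M) + g y)))"
proof -
  obtain N \<eta> where \<eta>: "\<eta> > 0" and dob: "\<And>f y. f \<in> borel_measurable lebesgue \<Longrightarrow> reg BB f \<Longrightarrow> mass f < \<infinity> \<Longrightarrow>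
     y \<in> K0 \<Longrightarrow> ennreal \<eta> * mass f \<le> (transfer ^^ N) f y"
    using doeblin by blast
  have low: "ennreal (\<eta> * M) \<le> (transfer ^^ Suc N) f y"
    if "f \<in> borel_measurable lebesgue" "reg BB f" "mass f = ennreal M" "0 \<le> M" "y \<in> K0" for f M y
    using dob[of "transfer f" y] that \<eta> mass_transfer_pow[of f 1] reg_transfer_pow[of f 1]
    by (simp add: ennreal_mult funpow_Suc_right del: funpow.simps)
  \<comment> \<open>\<open>reg_minus_const\<close> permits up to \<open>c1 * \<eta>\<close> times
    the mass. Half of that keeps \<open>\<theta>\<close> at least 1/2, since
    \<open>\<eta> * vol \<le> 1\<close>.\<close>
  define c where "c = c1 * \<eta> / 2"
  have c: "c > 0" using c1 \<eta> by (simp add: c_def)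
  have \<eta>V: "\<eta> * vol \<le> 1"
  proof -
    have "ennreal \<eta> * ennreal vol = mass (\<lambda>_. ennreal \<eta>)" by (simp add: mass_const)
    also have "\<dots> \<le> mass ((transfer ^^ Suc N) (\<lambda>_. ennreal (1 / vol)))"
      using low[of "\<lambda>_. ennreal (1 / vol)" 1] vol BB_pos
      by (intro mass_mono) (auto simp: reg_const mass_const ennreal_mult[symmetric] simp del: funpow.simps)
    also have "\<dots> = mass (\<lambda>_. ennreal (1 / vol))" by (rule mass_transfer_pow) auto
    also have "\<dots> = 1" using vol by (simp add: mass_const ennreal_mult[symmetric])
    finally show ?thesis using \<eta> vol by (simp add: ennreal_mult[symmetric] ennreal_le_1)
  qed
  define \<theta> where "\<theta> = 1 - c * vol"
  have "c * vol \<le> 1 / 2"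
  proof -
    have "c1 * (\<eta> * vol) \<le> 1 * 1" using c1 \<eta> vol \<eta>V by (intro mult_mono) auto
    then show ?thesis by (simp add: c_def)
  qed
  then have \<theta>: "0 < \<theta>" "\<theta> < 1" using c vol by (auto simp: \<theta>_def)
  have split: "\<exists>g. g \<in> borel_measurable lebesgue \<and> reg BB g \<and> mass g = ennreal (\<theta> * M) \<and>
          (\<forall>y\<in>K0. (transfer ^^ Suc N) f y = ennreal (c * M) + g y)"
    if f: "f \<in> borel_measurable lebesgue" "reg BB f" "mass f = ennreal M" and M: "0 \<le> M" for f M
  proof -
    define F where "F = (transfer ^^ Suc N) f"
    define g where "g = (\<lambda>x. F x - ennreal (c * M))"
    have F [measurable]: "F \<in> borel_measurable lebesgue" unfolding F_def using f by (intro transfer_pow_measurable)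
    have g: "g \<in> borel_measurable lebesgue" unfolding g_def by measurable
    have fin: "F x < \<infinity>" if "x \<in> K0" for x
    proof -
      have "F x = ennreal (enn2real (F x))" unfolding F_def by (rule transfer_pow_finite[OF f that])
      also have "\<dots> < \<infinity>" by simp
      finally show ?thesis .
    qed
    have regF: "reg (BB - (1 - \<rho>\<^sup>2)) F"
      unfolding F_def using reg_transfer_BB[OF reg_transfer_pow[OF f(2), of N]] by simp
    have lowF: "ennreal (\<eta> * M) \<le> F x" if "x \<in> K0" for x unfolding F_def using low f M that by blast
    have cM: "c * M \<le> c1 * (\<eta> * M)" "c * M \<le> \<eta> * M"
    proof -
      have "c1 * (\<eta> * M) \<ge> 0" using c1 \<eta> M by simp
      then show "c * M \<le> c1 * (\<eta> * M)" by (simp add: c_def mult_ac)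
      also have "\<dots> \<le> 1 * (\<eta> * M)" using c1 \<eta> M by (intro mult_right_mono) auto
      finally show "c * M \<le> \<eta> * M" by simp
    qed
    have regg: "reg BB g"
      unfolding g_def using \<eta> M c cM by (intro reg_minus_const[OF regF fin lowF]) auto
    have eq: "F y = ennreal (c * M) + g y" if "y \<in> K0" for y
    proof -
      have "ennreal (c * M) \<le> F y" using lowF[OF that] cM(2) by (meson ennreal_leI order_trans)
      then show ?thesis unfolding g_def by (simp add: add_diff_inverse_ennreal)
    qed
    have "ennreal M = mass F" unfolding F_def using mass_transfer_pow[OF f(1)] f(3) by metis
    also have "\<dots> = mass (\<lambda>y. ennreal (c * M) + g y)" using eq by (intro mass_cong) auto
    also have "\<dots> = ennreal (c * M * vol) + mass g"
      using g c M vol by (simp add: mass_add mass_const ennreal_mult[symmetric])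
    finally have "mass g = ennreal M - ennreal (c * M * vol)" by (simp add: ennreal_add_diff_cancel_left)
    also have "\<dots> = ennreal (\<theta> * M)" using c M vol by (simp add: ennreal_minus \<theta>_def algebra_simps)
    finally show ?thesis using g regg eq unfolding F_def by blast
  qed
  show ?thesis
    by (rule exI[of _ "Suc N"], rule conjI, simp, rule exI[of _ \<theta>], rule exI[of _ c], rule exI[of _ \<eta>])
      (use low split \<theta> \<eta> c in blast)
qed

text \<open>A coupling: both functions shed the same constant in every block of \<open>N\<close>
  steps, so their iterates share a common part \<open>r\<close> and differ only in remainders of
  geometrically decreasing mass, which the Harnack inequality bounds pointwise.\<close>

lemma loss_of_memory:
  "\<exists>C \<alpha>. 0 \<le> C \<and> 0 < \<alpha> \<and> \<alpha> < 1 \<and> (\<forall>f1 f2 M n. \<forall>y\<in>K0.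
     f1 \<in> borel_measurable lebesgue \<longrightarrow> f2 \<in> borel_measurable lebesgue \<longrightarrow> reg BB f1 \<longrightarrow> reg BB f2 \<longrightarrow>
     mass f1 = ennreal M \<longrightarrow> mass f2 = ennreal M \<longrightarrow> 0 \<le> M \<longrightarrow>
     \<bar>enn2real ((transfer ^^ n) f1 y) - enn2real ((transfer ^^ n) f2 y)\<bar> \<le> C * \<alpha> ^ n * M)"
proof -
  obtain N \<theta> c where N: "N > 0" and \<theta>: "0 < \<theta>" "\<theta> < 1" and c: "0 < c" and
    split: "\<And>f M. f \<in> borel_measurable lebesgue \<Longrightarrow> reg BB f \<Longrightarrow> mass f = ennreal M \<Longrightarrow> 0 \<le> M \<Longrightarrow>
       \<exists>g. g \<in> borel_measurable lebesgue \<and> reg BB g \<and> mass g = ennreal (\<theta> * M) \<and>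
          (\<forall>y\<in>K0. (transfer ^^ N) f y = ennreal (c * M) + g y)"
    using doeblin_split by blast
  have iter: "\<exists>r g1 g2. g1 \<in> borel_measurable lebesgue \<and> g2 \<in> borel_measurable lebesgue \<and> reg BB g1 \<and> reg BB g2 \<and>
      mass g1 = ennreal (\<theta> ^ k * M) \<and> mass g2 = ennreal (\<theta> ^ k * M) \<and>
      (\<forall>y\<in>K0. (transfer ^^ (N * k)) f1 y = r y + g1 y \<and> (transfer ^^ (N * k)) f2 y = r y + g2 y)"
    if f: "f1 \<in> borel_measurable lebesgue" "f2 \<in> borel_measurable lebesgue" "reg BB f1" "reg BB f2"
      "mass f1 = ennreal M" "mass f2 = ennreal M" and M: "0 \<le> M" for f1 f2 M k
  proof (induction k)
    case 0
    show ?case by (rule exI[of _ "\<lambda>_. 0"], rule exI[of _ f1], rule exI[of _ f2]) (use f in auto)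
  next
    case (Suc k)
    then obtain r g1 g2 where g: "g1 \<in> borel_measurable lebesgue" "g2 \<in> borel_measurable lebesgue" "reg BB g1" "reg BB g2"
      "mass g1 = ennreal (\<theta> ^ k * M)" "mass g2 = ennreal (\<theta> ^ k * M)"
      and eq: "\<And>y. y \<in> K0 \<Longrightarrow> (transfer ^^ (N * k)) f1 y = r y + g1 y"
       "\<And>y. y \<in> K0 \<Longrightarrow> (transfer ^^ (N * k)) f2 y = r y + g2 y" by blast
    have M': "0 \<le> \<theta> ^ k * M" using \<theta> M by simp
    obtain g1' where g1': "g1' \<in> borel_measurable lebesgue" "reg BB g1'" "mass g1' = ennreal (\<theta> * (\<theta> ^ k * M))"
      "\<And>y. y \<in> K0 \<Longrightarrow> (transfer ^^ N) g1 y = ennreal (c * (\<theta> ^ k * M)) + g1' y"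
      using split[OF g(1,3,5) M'] by blast
    obtain g2' where g2': "g2' \<in> borel_measurable lebesgue" "reg BB g2'" "mass g2' = ennreal (\<theta> * (\<theta> ^ k * M))"
      "\<And>y. y \<in> K0 \<Longrightarrow> (transfer ^^ N) g2 y = ennreal (c * (\<theta> ^ k * M)) + g2' y"
      using split[OF g(2,4,6) M'] by blast
    let ?r = "\<lambda>y. (transfer ^^ N) r y + ennreal (c * (\<theta> ^ k * M))"
    have pw: "(transfer ^^ (N * Suc k)) f y = (transfer ^^ N) ((transfer ^^ (N * k)) f) y" for f y
      by (simp add: funpow_add)
    have "(transfer ^^ (N * Suc k)) f1 y = ?r y + g1' y" if "y \<in> K0" for y
    proof -
      have "(transfer ^^ N) ((transfer ^^ (N * k)) f1) y = (transfer ^^ N) (\<lambda>y. r y + g1 y) y"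
        using eq(1) that by (intro transfer_pow_cong) auto
      then show ?thesis using g1'(4)[OF that] pw by (simp add: transfer_pow_add add.assoc)
    qed
    moreover have "(transfer ^^ (N * Suc k)) f2 y = ?r y + g2' y" if "y \<in> K0" for y
    proof -
      have "(transfer ^^ N) ((transfer ^^ (N * k)) f2) y = (transfer ^^ N) (\<lambda>y. r y + g2 y) y"
        using eq(2) that by (intro transfer_pow_cong) auto
      then show ?thesis using g2'(4)[OF that] pw by (simp add: transfer_pow_add add.assoc)
    qed
    ultimately show ?case using g1' g2'
      by (intro exI[of _ ?r] exI[of _ g1'] exI[of _ g2']) (simp add: mult.assoc)
  qed
  define \<alpha> where "\<alpha> = \<theta> powr (1 / real N)"
  have \<alpha>: "0 < \<alpha>" "\<alpha> < 1" using \<theta> N powr_less_mono'[of \<theta> 0 "1 / real N"] by (auto simp: \<alpha>_def)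
  have \<alpha>N: "\<alpha> ^ N = \<theta>" using \<theta> N by (simp add: \<alpha>_def powr_realpow[symmetric] powr_powr)
  \<comment> \<open>The incomplete last block costs at most the factor
    \<open>1 / \<theta>\<close>.\<close>
  have pw: "\<theta> ^ (n div N) \<le> \<alpha> ^ n / \<theta>" for n
  proof -
    have "\<theta> ^ (n div N) * \<theta> = \<alpha> ^ (N * (n div N) + N)" by (simp add: power_add power_mult \<alpha>N)
    also have "\<dots> \<le> \<alpha> ^ n"
    proof (rule power_decreasing)
      have "n mod N \<le> N" using N by (simp add: less_imp_le)
      moreover have "n = N * (n div N) + n mod N" by simp
      ultimately show "n \<le> N * (n div N) + N" by linarith
    qed (use \<alpha> in auto)
    finally show ?thesis using \<theta> by (simp add: field_simps)
  qed
  define C where "C = enn2real Csup / \<theta>"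
  have C: "0 \<le> C" using \<theta> by (simp add: C_def)
  show ?thesis
  proof (rule exI[of _ C], rule exI[of _ \<alpha>], intro conjI allI impI ballI)
    fix f1 f2 M n y
    assume f: "f1 \<in> borel_measurable lebesgue" "f2 \<in> borel_measurable lebesgue" "reg BB f1" "reg BB f2"
      "mass f1 = ennreal M" "mass f2 = ennreal M" and M: "0 \<le> M" and y: "y \<in> K0"
    let ?j = "n mod N" and ?k = "n div N"
    have n: "(transfer ^^ n) f = (transfer ^^ (N * ?k)) ((transfer ^^ ?j) f)" for f
    proof -
      have "(transfer ^^ (N * ?k + ?j)) f = (transfer ^^ (N * ?k)) ((transfer ^^ ?j) f)" by (simp only: funpow_add comp_apply)
      then show ?thesis by simp
    qed
    obtain r g1 g2 where g: "g1 \<in> borel_measurable lebesgue" "g2 \<in> borel_measurable lebesgue" "reg BB g1" "reg BB g2"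
      "mass g1 = ennreal (\<theta> ^ ?k * M)" "mass g2 = ennreal (\<theta> ^ ?k * M)"
      and eq: "(transfer ^^ n) f1 y = r y + g1 y" "(transfer ^^ n) f2 y = r y + g2 y"
      unfolding n
      using iter[of "(transfer ^^ ?j) f1" "(transfer ^^ ?j) f2" M ?k] f M y reg_transfer_pow mass_transfer_pow
        transfer_pow_measurable by metis
    have fin1: "(transfer ^^ n) f1 y < top"
      using transfer_pow_finite[OF f(1,3,5) y, of n] by (metis ennreal_less_top)
    have G: "g = ennreal (enn2real g) \<and> enn2real g \<le> enn2real Csup * (\<theta> ^ ?k * M)"
      if "g \<le> Csup * ennreal (\<theta> ^ ?k * M)" for g
    proof -
      have fin: "Csup * ennreal (\<theta> ^ ?k * M) < top" using Csup_finite by (simp add: ennreal_mult_less_top)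
      then have "g < top" using that by (rule le_less_trans[rotated])
      moreover have "enn2real g \<le> enn2real (Csup * ennreal (\<theta> ^ ?k * M))" using that fin by (rule enn2real_mono)
      ultimately show ?thesis using \<theta> M by (simp add: enn2real_mult)
    qed
    have b1: "g1 y = ennreal (enn2real (g1 y))" "enn2real (g1 y) \<le> enn2real Csup * (\<theta> ^ ?k * M)"
      using G[OF reg_le_mass[OF g(1,3) y, unfolded g(5)]] by auto
    have b2: "g2 y = ennreal (enn2real (g2 y))" "enn2real (g2 y) \<le> enn2real Csup * (\<theta> ^ ?k * M)"
      using G[OF reg_le_mass[OF g(2,4) y, unfolded g(6)]] by auto
    have "r y \<le> (transfer ^^ n) f1 y" unfolding eq by simp
    then obtain R where R: "r y = ennreal R" "R \<ge> 0" using fin1 by (cases "r y") (auto simp: top_unique)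
    have e1: "enn2real ((transfer ^^ n) f1 y) = R + enn2real (g1 y)"
      unfolding eq R by (subst b1(1)) (simp add: R(2) ennreal_plus[symmetric] del: ennreal_plus)
    have e2: "enn2real ((transfer ^^ n) f2 y) = R + enn2real (g2 y)"
      unfolding eq R by (subst b2(1)) (simp add: R(2) ennreal_plus[symmetric] del: ennreal_plus)
    have "\<bar>enn2real ((transfer ^^ n) f1 y) - enn2real ((transfer ^^ n) f2 y)\<bar> \<le> enn2real Csup * (\<theta> ^ ?k * M)"
      using e1 e2 b1(2) b2(2) enn2real_nonneg[of "g1 y"] enn2real_nonneg[of "g2 y"] by linarith
    also have "\<dots> \<le> enn2real Csup * (\<alpha> ^ n / \<theta> * M)"
      using pw M by (intro mult_left_mono mult_right_mono) auto
    also have "\<dots> = C * \<alpha> ^ n * M" by (simp add: C_def)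
    finally show "\<bar>enn2real ((transfer ^^ n) f1 y) - enn2real ((transfer ^^ n) f2 y)\<bar> \<le> C * \<alpha> ^ n * M" .
  qed (use C \<alpha> in auto)
qed

section \<open>The invariant density as a limit of iterates\<close>

definition f0 :: "'a \<Rightarrow> ennreal" where "f0 = (\<lambda>_. ennreal (1 / vol))"

lemma f0: "f0 \<in> borel_measurable lebesgue" "reg BB f0" "mass f0 = ennreal 1"
  using vol BB_pos by (auto simp: f0_def reg_const mass_const ennreal_mult[symmetric])

definition hn :: "nat \<Rightarrow> 'a \<Rightarrow> real" where "hn n x = enn2real ((transfer ^^ n) f0 x)"

text \<open>Outside \<open>K0\<close> the density is set to 0, so that it is also analytic on cells of measure 0.\<close>
definition dens :: "'a \<Rightarrow> real" where "dens x = (if x \<in> K0 then lim (\<lambda>n. hn n x) else 0)"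

lemma hn_eq: "y \<in> K0 \<Longrightarrow> (transfer ^^ n) f0 y = ennreal (hn n y)"
  unfolding hn_def by (rule transfer_pow_finite[OF f0])

lemma hn_nonneg: "0 \<le> hn n y" by (simp add: hn_def)

text \<open>All iterates of \<open>f0\<close> are regular of mass 1. Comparing them with
  \<open>f0\<close> makes \<open>hn\<close> Cauchy at the geometric rate, and comparing
  \<open>f\<close> with \<open>M * f0\<close> adds a second error of the same size.\<close>

lemma kuzmin:
  "\<exists>C \<alpha>. 0 \<le> C \<and> 0 < \<alpha> \<and> \<alpha> < 1 \<and> (\<forall>f M n. \<forall>y\<in>K0.
     f \<in> borel_measurable lebesgue \<longrightarrow> reg BB f \<longrightarrow> mass f = ennreal M \<longrightarrow> 0 \<le> M \<longrightarrow>
     \<bar>enn2real ((transfer ^^ n) f y) - M * dens y\<bar> \<le> C * \<alpha> ^ n * M)"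
proof -
  obtain C \<alpha> where C: "0 \<le> C" and \<alpha>: "0 < \<alpha>" "\<alpha> < 1" and lom: "\<And>f1 f2 M n y. y \<in> K0 \<Longrightarrow>
     f1 \<in> borel_measurable lebesgue \<Longrightarrow> f2 \<in> borel_measurable lebesgue \<Longrightarrow> reg BB f1 \<Longrightarrow> reg BB f2 \<Longrightarrow>
     mass f1 = ennreal M \<Longrightarrow> mass f2 = ennreal M \<Longrightarrow> 0 \<le> M \<Longrightarrow>
     \<bar>enn2real ((transfer ^^ n) f1 y) - enn2real ((transfer ^^ n) f2 y)\<bar> \<le> C * \<alpha> ^ n * M"
    using loss_of_memory by blast
  have lim0: "(\<lambda>n. C * \<alpha> ^ n) \<longlonglongrightarrow> 0"
    using \<alpha> by (intro tendsto_mult_right_zero LIMSEQ_power_zero) auto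
  have hcau: "\<bar>hn n y - hn (n + m) y\<bar> \<le> C * \<alpha> ^ n" if "y \<in> K0" for n m y
  proof -
    have "\<bar>enn2real ((transfer ^^ n) f0 y) - enn2real ((transfer ^^ n) ((transfer ^^ m) f0) y)\<bar> \<le> C * \<alpha> ^ n * 1"
      using f0 mass_transfer_pow[OF f0(1)] that
      by (intro lom) (auto intro: transfer_pow_measurable reg_transfer_pow)
    then show ?thesis by (simp add: hn_def funpow_add)
  qed
  have conv: "(\<lambda>n. hn n y) \<longlonglongrightarrow> dens y" if y: "y \<in> K0" for y
  proof -
    have "Cauchy (\<lambda>n. hn n y)"
    proof (rule CauchyI')
      fix e :: real assume "e > 0"
      then obtain n0 where n0: "\<And>n. n \<ge> n0 \<Longrightarrow> C * \<alpha> ^ n < e"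
        using order_tendstoD(2)[OF lim0] unfolding eventually_sequentially by blast
      show "\<exists>M. \<forall>m\<ge>M. \<forall>n>m. dist (hn m y) (hn n y) < e"
      proof (intro exI[of _ n0] allI impI)
        fix m n assume "n0 \<le> m" "m < n"
        then show "dist (hn m y) (hn n y) < e"
          using hcau[OF y, of m "n - m"] n0[of m] by (simp add: dist_real_def)
      qed
    qed
    then have "convergent (\<lambda>n. hn n y)" by (simp add: Cauchy_convergent)
    then show ?thesis using y by (simp add: dens_def convergent_LIMSEQ_iff)
  qed
  have hd: "\<bar>hn n y - dens y\<bar> \<le> C * \<alpha> ^ n" if y: "y \<in> K0" for n y
  proof -
    have "(\<lambda>m. \<bar>hn n y - hn (m + n) y\<bar>) \<longlonglongrightarrow> \<bar>hn n y - dens y\<bar>"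
      by (intro tendsto_intros LIMSEQ_ignore_initial_segment conv y)
    then show ?thesis
      using hcau[OF y, of n] by (rule_tac LIMSEQ_le_const2) (auto simp: add.commute[of _ n])
  qed
  show ?thesis
  proof (rule exI[of _ "2 * C"], rule exI[of _ \<alpha>], intro conjI allI impI ballI)
    fix f M n y assume f: "f \<in> borel_measurable lebesgue" "reg BB f" "mass f = ennreal M" and M: "0 \<le> M" and y: "y \<in> K0"
    have "\<bar>enn2real ((transfer ^^ n) f y) - enn2real ((transfer ^^ n) (\<lambda>x. ennreal M * f0 x) y)\<bar> \<le> C * \<alpha> ^ n * M"
      using f f0 M y by (intro lom) (auto intro: reg_cmult simp: mass_cmult)
    moreover have "enn2real ((transfer ^^ n) (\<lambda>x. ennreal M * f0 x) y) = M * hn n y"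
      using M by (simp add: transfer_pow_cmult enn2real_mult hn_def)
    moreover have "\<bar>M * hn n y - M * dens y\<bar> \<le> C * \<alpha> ^ n * M"
      using hd[OF y, of n] M by (simp add: right_diff_distrib[symmetric] abs_mult mult_left_mono mult.commute)
    ultimately show "\<bar>enn2real ((transfer ^^ n) f y) - M * dens y\<bar> \<le> 2 * C * \<alpha> ^ n * M" by linarith
  qed (use C \<alpha> in auto)
qed

lemma hn_tendsto: "y \<in> K0 \<Longrightarrow> (\<lambda>n. hn n y) \<longlonglongrightarrow> dens y"
  and hn_uniform: "\<exists>e. e \<longlonglongrightarrow> 0 \<and> (\<forall>n. \<forall>y\<in>K0. \<bar>hn n y - dens y\<bar> \<le> e n) \<and> (\<forall>n. 0 \<le> (e n::real))"
proof -
  obtain C \<alpha> where C: "0 \<le> C" and \<alpha>: "0 < \<alpha>" "\<alpha> < 1" and k: "\<And>f M n y. y \<in> K0 \<Longrightarrow>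
     f \<in> borel_measurable lebesgue \<Longrightarrow> reg BB f \<Longrightarrow> mass f = ennreal M \<Longrightarrow> 0 \<le> M \<Longrightarrow>
     \<bar>enn2real ((transfer ^^ n) f y) - M * dens y\<bar> \<le> C * \<alpha> ^ n * M"
    using kuzmin by blast
  have lim0: "(\<lambda>n. C * \<alpha> ^ n) \<longlonglongrightarrow> 0"
    using \<alpha> by (intro tendsto_mult_right_zero LIMSEQ_power_zero) auto
  have b: "\<bar>hn n y - dens y\<bar> \<le> C * \<alpha> ^ n" if "y \<in> K0" for n y
    using k[OF that f0, of n] by (simp add: hn_def)
  show "\<exists>e. e \<longlonglongrightarrow> 0 \<and> (\<forall>n. \<forall>y\<in>K0. \<bar>hn n y - dens y\<bar> \<le> e n) \<and> (\<forall>n. 0 \<le> (e n::real))"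
    using lim0 b C \<alpha> by (intro exI[of _ "\<lambda>n. C * \<alpha> ^ n"]) auto
  assume y: "y \<in> K0"
  have "(\<lambda>n. hn n y - dens y) \<longlonglongrightarrow> 0"
    using b[OF y] by (intro Lim_null_comparison[OF _ lim0]) auto
  then show "(\<lambda>n. hn n y) \<longlonglongrightarrow> dens y" using LIM_zero_iff by blast
qed

lemma dens_measurable [measurable]: "dens \<in> borel_measurable lebesgue"
proof (rule borel_measurable_LIMSEQ_real)
  show "(\<lambda>n. indicator K0 x * hn n x) \<longlonglongrightarrow> dens x" for x
    using hn_tendsto[of x] by (cases "x \<in> K0") (auto simp: dens_def)
  show "(\<lambda>x. indicator K0 x * hn n x) \<in> borel_measurable lebesgue" for n
    unfolding hn_def using transfer_pow_measurable[OF f0(1)] by measurable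
qed

lemma dens_nonneg: "0 \<le> dens x"
proof (cases "x \<in> K0")
  case True
  show ?thesis by (rule LIMSEQ_le_const[OF hn_tendsto[OF True]]) (simp add: hn_nonneg)
qed (simp add: dens_def)

text \<open>The lower bound of \<open>doeblin_split\<close>, applied to the iterates of
  \<open>f0\<close>, is uniform in the iterate and survives the limit.\<close>

lemma dens_lower: "\<exists>\<eta>>0. \<forall>y\<in>K0. \<eta> \<le> dens y"
proof -
  obtain N \<eta> where \<eta>: "\<eta> > 0" and low: "\<And>f M y. f \<in> borel_measurable lebesgue \<Longrightarrow> reg BB f \<Longrightarrow>
    mass f = ennreal M \<Longrightarrow> 0 \<le> M \<Longrightarrow> y \<in> K0 \<Longrightarrow> ennreal (\<eta> * M) \<le> (transfer ^^ N) f y"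
    using doeblin_split by metis
  have "\<eta> \<le> hn (N + k) y" if y: "y \<in> K0" for y k
  proof -
    have "ennreal (\<eta> * 1) \<le> (transfer ^^ N) ((transfer ^^ k) f0) y"
      using f0 mass_transfer_pow[OF f0(1)] y
      by (intro low) (auto intro: transfer_pow_measurable reg_transfer_pow)
    also have "\<dots> = ennreal (hn (N + k) y)" using hn_eq[OF y, of "N + k"] by (simp add: funpow_add)
    finally show ?thesis using hn_nonneg by simp
  qed
  then have "\<eta> \<le> hn n y" if "y \<in> K0" "n \<ge> N" for y n using that le_Suc_ex by blast
  then have "\<eta> \<le> dens y" if "y \<in> K0" for y using that
    by (intro LIMSEQ_le_const[OF hn_tendsto[OF that]]) blast
  then show ?thesis using \<eta> by blast
qed

lemma reg_dens: "reg BB (\<lambda>x. ennreal (dens x))"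
  unfolding reg_def
proof (intro ballI impI)
  fix x y assume xy: "x \<in> K0" "y \<in> K0" "sim x y"
  have "hn n x \<le> exp (BB * dist x y) * hn n y" for n
  proof -
    have "ennreal (hn n x) \<le> ennreal (exp (BB * dist x y)) * ennreal (hn n y)"
      using reg_transfer_pow[OF f0(2), of n] xy hn_eq unfolding reg_def by metis
    then show ?thesis using hn_nonneg by (simp add: ennreal_mult[symmetric])
  qed
  then have "dens x \<le> exp (BB * dist x y) * dens y"
    using hn_tendsto xy by (intro LIMSEQ_le[OF hn_tendsto[OF xy(1)] tendsto_mult_left[OF hn_tendsto[OF xy(2)]]]) auto
  then show "ennreal (dens x) \<le> ennreal (exp (BB * dist x y)) * ennreal (dens y)"
    using dens_nonneg by (simp add: ennreal_mult[symmetric] ennreal_leI)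
qed

text \<open>Convergence is uniform on a set of finite volume, so the masses differ by at most
  \<open>e n * vol\<close>.\<close>

lemma mass_dens: "mass (\<lambda>x. ennreal (dens x)) = 1"
proof -
  obtain e where e: "e \<longlonglongrightarrow> 0" "\<And>n y. y \<in> K0 \<Longrightarrow> \<bar>hn n y - dens y\<bar> \<le> e n" "\<And>n. 0 \<le> (e n :: real)"
    using hn_uniform by blast
  have cmp: "ennreal (dens x) \<le> ennreal (hn n x) + ennreal (e n)"
    "ennreal (hn n x) \<le> ennreal (dens x) + ennreal (e n)" if "x \<in> K0" for x n
  proof -
    have "dens x \<le> hn n x + e n" "hn n x \<le> dens x + e n" using e(2)[OF that, of n] by linarith+
    then show "ennreal (dens x) \<le> ennreal (hn n x) + ennreal (e n)"
      "ennreal (hn n x) \<le> ennreal (dens x) + ennreal (e n)"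
      using e(3)[of n] hn_nonneg[of n x] dens_nonneg[of x]
      by (simp_all add: ennreal_plus[symmetric] ennreal_leI del: ennreal_plus)
  qed
  have hm: "(\<lambda>x. ennreal (hn n x)) \<in> borel_measurable lebesgue" for n
    unfolding hn_def using transfer_pow_measurable[OF f0(1)] by measurable
  have dm: "(\<lambda>x. ennreal (dens x)) \<in> borel_measurable lebesgue" by measurable
  have m1: "mass (\<lambda>x. ennreal (hn n x)) = 1" for n
    using mass_transfer_pow[OF f0(1), of n] f0(3) mass_cong[of "(transfer ^^ n) f0" "\<lambda>x. ennreal (hn n x)"] hn_eq by simp
  have up: "mass (\<lambda>x. ennreal (dens x)) \<le> ennreal (1 + e n * vol)" for n
  proof -
    have "mass (\<lambda>x. ennreal (dens x)) \<le> mass (\<lambda>x. ennreal (hn n x) + ennreal (e n))"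
      using cmp by (intro mass_mono) auto
    also have "\<dots> = 1 + ennreal (e n) * ennreal vol" using hm m1 by (simp add: mass_add mass_const)
    also have "\<dots> = ennreal (1 + e n * vol)" using e vol by (simp add: ennreal_mult ennreal_plus)
    finally show ?thesis .
  qed
  have low: "1 \<le> mass (\<lambda>x. ennreal (dens x)) + ennreal (e n * vol)" for n
  proof -
    have "1 = mass (\<lambda>x. ennreal (hn n x))" by (simp add: m1)
    also have "\<dots> \<le> mass (\<lambda>x. ennreal (dens x) + ennreal (e n))"
      using cmp by (intro mass_mono) auto
    also have "\<dots> = mass (\<lambda>x. ennreal (dens x)) + ennreal (e n) * ennreal vol" using dm by (simp add: mass_add mass_const)
    finally show ?thesis using e vol by (simp add: ennreal_mult)
  qed
  obtain M where M: "mass (\<lambda>x. ennreal (dens x)) = ennreal M" "M \<ge> 0"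
    using up[of 0] by (cases "mass (\<lambda>x. ennreal (dens x))") (auto simp: top_unique)
  have "M \<le> 1 + e n * vol" for n
  proof -
    have "ennreal M \<le> ennreal (1 + e n * vol)" using up[of n] M(1) by (simp only:)
    moreover have "0 \<le> 1 + e n * vol" using e vol by simp
    ultimately show ?thesis by (simp only: ennreal_le_iff)
  qed
  moreover have "(\<lambda>n. 1 + e n * vol) \<longlonglongrightarrow> 1 + 0 * vol" by (intro tendsto_intros e)
  ultimately have "M \<le> 1" by (intro LIMSEQ_le_const[of "\<lambda>n. 1 + e n * vol"]) auto
  have "1 \<le> M + e n * vol" for n
    using low[of n] M e vol by (simp add: ennreal_plus[symmetric] del: ennreal_plus)
  moreover have "(\<lambda>n. M + e n * vol) \<longlonglongrightarrow> M + 0 * vol" by (intro tendsto_intros e)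
  ultimately have "1 \<le> M" by (intro LIMSEQ_le_const[of "\<lambda>n. M + e n * vol"]) auto
  then show ?thesis using M \<open>M \<le> 1\<close> by simp
qed

text \<open>The uniform error \<open>e n\<close> passes through the infinite sum over digits as
  \<open>e n * D\<close>, where \<open>D\<close> is the image of the constant 1 at \<open>y\<close>,
  finite by regularity.\<close>

lemma transfer_dens: "y \<in> K0 \<Longrightarrow> transfer (\<lambda>x. ennreal (dens x)) y = ennreal (dens y)"
proof -
  assume y: "y \<in> K0"
  obtain e where e: "e \<longlonglongrightarrow> 0" "\<And>n y. y \<in> K0 \<Longrightarrow> \<bar>hn n y - dens y\<bar> \<le> e n" "\<And>n. 0 \<le> (e n :: real)"
    using hn_uniform by blast
  have cmp: "ennreal (dens x) \<le> ennreal (hn n x) + ennreal (e n)"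
    "ennreal (hn n x) \<le> ennreal (dens x) + ennreal (e n)" if "x \<in> K0" for x n
  proof -
    have "dens x \<le> hn n x + e n" "hn n x \<le> dens x + e n" using e(2)[OF that, of n] by linarith+
    then show "ennreal (dens x) \<le> ennreal (hn n x) + ennreal (e n)"
      "ennreal (hn n x) \<le> ennreal (dens x) + ennreal (e n)"
      using e(3)[of n] hn_nonneg[of n x] dens_nonneg[of x]
      by (simp_all add: ennreal_plus[symmetric] ennreal_leI del: ennreal_plus)
  qed
  have one: "(\<lambda>_. 1) \<in> borel_measurable lebesgue" "reg BB (\<lambda>_. 1)" "mass (\<lambda>_. 1) = ennreal vol"
    using BB_pos by (auto simp: reg_const mass_const)
  define D where "D = enn2real (transfer (\<lambda>_. 1) y)"
  have D: "transfer (\<lambda>_. 1) y = ennreal D" "D \<ge> 0"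
    using transfer_pow_finite[OF one y, of 1] by (auto simp: D_def)
  have L: "transfer (\<lambda>x. ennreal (f x) + ennreal (e n)) y = transfer (\<lambda>x. ennreal (f x)) y + ennreal (e n * D)" for f n
    using transfer_cmult[of "ennreal (e n)" "\<lambda>_. 1" y] e D by (simp add: transfer_add ennreal_mult)
  have hL: "transfer (\<lambda>x. ennreal (hn n x)) y = ennreal (hn (Suc n) y)" for n
    using hn_eq[OF y, of "Suc n"] transfer_cong[of "\<lambda>x. ennreal (hn n x)" "(transfer ^^ n) f0"] hn_eq by simp
  have up: "transfer (\<lambda>x. ennreal (dens x)) y \<le> ennreal (hn (Suc n) y + e n * D)" for n
  proof -
    have "transfer (\<lambda>x. ennreal (dens x)) y \<le> transfer (\<lambda>x. ennreal (hn n x) + ennreal (e n)) y"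
      using cmp by (intro transfer_mono) auto
    then show ?thesis unfolding L hL using e D hn_nonneg by (simp add: ennreal_plus)
  qed
  have low: "ennreal (hn (Suc n) y) \<le> transfer (\<lambda>x. ennreal (dens x)) y + ennreal (e n * D)" for n
  proof -
    have "transfer (\<lambda>x. ennreal (hn n x)) y \<le> transfer (\<lambda>x. ennreal (dens x) + ennreal (e n)) y"
      using cmp by (intro transfer_mono) auto
    then show ?thesis unfolding L hL .
  qed
  obtain M where M: "transfer (\<lambda>x. ennreal (dens x)) y = ennreal M" "M \<ge> 0"
    using up[of 0] by (cases "transfer (\<lambda>x. ennreal (dens x)) y") (auto simp: top_unique)
  have lh: "(\<lambda>n. hn (Suc n) y) \<longlonglongrightarrow> dens y" using hn_tendsto[OF y] by (rule LIMSEQ_Suc)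
  have "M \<le> hn (Suc n) y + e n * D" for n
  proof -
    have "ennreal M \<le> ennreal (hn (Suc n) y + e n * D)" using up[of n] M(1) by (simp only:)
    moreover have "0 \<le> hn (Suc n) y + e n * D" using e D hn_nonneg by simp
    ultimately show ?thesis by (simp only: ennreal_le_iff)
  qed
  moreover have "(\<lambda>n. hn (Suc n) y + e n * D) \<longlonglongrightarrow> dens y + 0 * D" by (intro tendsto_intros e lh)
  ultimately have "M \<le> dens y" by (intro LIMSEQ_le_const[of "\<lambda>n. hn (Suc n) y + e n * D"]) auto
  have "hn (Suc n) y \<le> M + e n * D" for n
    using low[of n] M e D hn_nonneg by (simp add: ennreal_plus[symmetric] del: ennreal_plus)
  moreover have "(\<lambda>n. M + e n * D) \<longlonglongrightarrow> M + 0 * D" by (intro tendsto_intros e)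
  ultimately have "dens y \<le> M" by (intro LIMSEQ_le[OF lh, of "\<lambda>n. M + e n * D"]) auto
  then show ?thesis using M \<open>M \<le> dens y\<close> by simp
qed

end

section \<open>Majorised power series\<close>

text \<open>Tannery's theorem: outside a finite set the difference is at most twice the small tail
  of the majorant, and on the finite set convergence is termwise.\<close>

lemma has_sum_dominated_limit:
  fixes g :: "nat \<Rightarrow> 'i \<Rightarrow> real"
  assumes G: "G summable_on I" and dom: "\<And>n i. i \<in> I \<Longrightarrow> \<bar>g n i\<bar> \<le> G i"
    and lim: "\<And>i. i \<in> I \<Longrightarrow> (\<lambda>n. g n i) \<longlonglongrightarrow> h i"
    and hs: "\<And>n. (g n has_sum s n) I" and s: "s \<longlonglongrightarrow> S"
  shows "(h has_sum S) I"
proof -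
  have Gp: "G i \<ge> 0" if "i \<in> I" for i using dom[OF that, of 0] by simp
  have hG: "\<bar>h i\<bar> \<le> G i" if "i \<in> I" for i
    using LIMSEQ_le_const2[OF tendsto_rabs[OF lim[OF that]], of "G i"] dom[OF that] by auto
  have Gabs: "(\<lambda>i. norm (G i)) summable_on I" using G Gp by (subst summable_on_cong[of I _ G]) auto
  have "(\<lambda>i. norm (h i)) summable_on I"
  proof (rule Infinite_Sum.abs_summable_on_comparison_test[OF Gabs])
    show "norm (h i) \<le> norm (G i)" if "i \<in> I" for i using hG[OF that] by simp
  qed
  then have hsum: "h summable_on I" by (rule Infinite_Sum.abs_summable_summable)
  have d2: "\<bar>g n i - h i\<bar> \<le> 2 * G i" if "i \<in> I" for n i using dom[OF that, of n] hG[OF that] by linarith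
  have G2: "(\<lambda>i. 2 * G i) summable_on I" using G by (rule summable_on_cmult_right)
  have dsum: "(\<lambda>i. \<bar>g n i - h i\<bar>) summable_on A" if "A \<subseteq> I" for n A
  proof -
    have "(\<lambda>i. norm (2 * G i)) summable_on I" using G2 Gp by (subst summable_on_cong[of I _ "\<lambda>i. 2 * G i"]) auto
    then have "(\<lambda>i. norm (g n i - h i)) summable_on I"
    proof (rule Infinite_Sum.abs_summable_on_comparison_test)
      show "norm (g n i - h i) \<le> norm (2 * G i)" if "i \<in> I" for i using d2[OF that, of n] Gp[OF that] by simp
    qed
    then have "(\<lambda>i. \<bar>g n i - h i\<bar>) summable_on I" by simp
    then show ?thesis using that by (rule summable_on_subset_banach)
  qed
  have "s \<longlonglongrightarrow> infsum h I"
  proof (rule LIMSEQ_I)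
    fix e :: real assume e: "e > 0"
    have "(G has_sum infsum G I) I" using G by simp
    then have "(sum G \<longlongrightarrow> infsum G I) (finite_subsets_at_top I)" by (simp add: has_sum_def)
    then have "\<forall>\<^sub>F A in finite_subsets_at_top I. dist (sum G A) (infsum G I) < e / 4" using e by (intro tendstoD) auto
    then obtain A where A: "finite A" "A \<subseteq> I" "dist (sum G A) (infsum G I) < e / 4"
      unfolding eventually_finite_subsets_at_top by blast
    have "infsum G (I - A) = infsum G I - sum G A"
      using A G by (subst infsum_Diff) auto
    then have tail: "infsum G (I - A) < e / 4" using A(3) unfolding dist_real_def by linarith
    have "(\<lambda>n. \<Sum>i\<in>A. \<bar>g n i - h i\<bar>) \<longlonglongrightarrow> (\<Sum>i\<in>A. \<bar>h i - h i\<bar>)"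
      using A by (intro tendsto_sum tendsto_rabs tendsto_diff lim tendsto_const) auto
    then have "\<forall>\<^sub>F n in sequentially. (\<Sum>i\<in>A. \<bar>g n i - h i\<bar>) < e / 2" using e by (intro order_tendstoD) auto
    then obtain n0 where n0: "\<And>n. n \<ge> n0 \<Longrightarrow> (\<Sum>i\<in>A. \<bar>g n i - h i\<bar>) < e / 2"
      unfolding eventually_sequentially by blast
    show "\<exists>no. \<forall>n\<ge>no. norm (s n - infsum h I) < e"
    proof (intro exI[of _ n0] allI impI)
      fix n assume n: "n0 \<le> n"
      have "((\<lambda>i. g n i - h i) has_sum (s n - infsum h I)) I"
        using has_sum_add[OF hs[of n] has_sum_cmult_right[OF has_sum_infsum[OF hsum], of "-1"]] by simp
      moreover have "((\<lambda>i. norm (g n i - h i)) has_sum infsum (\<lambda>i. \<bar>g n i - h i\<bar>) I) I"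
        using dsum[of I n] by simp
      ultimately have "norm (s n - infsum h I) \<le> infsum (\<lambda>i. \<bar>g n i - h i\<bar>) I"
        by (rule norm_has_sum_bound[rotated])
      also have "\<dots> = (\<Sum>i\<in>A. \<bar>g n i - h i\<bar>) + infsum (\<lambda>i. \<bar>g n i - h i\<bar>) (I - A)"
        using A dsum[of I n] by (subst infsum_Diff) auto
      also have "infsum (\<lambda>i. \<bar>g n i - h i\<bar>) (I - A) \<le> infsum (\<lambda>i. 2 * G i) (I - A)"
        using dsum[of "I - A" n] d2 summable_on_subset_banach[OF G2, of "I - A"] by (intro infsum_mono) auto
      also have "\<dots> = 2 * infsum G (I - A)"
        by (rule infsum_cmult_right) (use summable_on_subset_banach[OF G, of "I - A"] in auto)
      finally show "norm (s n - infsum h I) < e" using n0[OF n] tail by linarith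
    qed
  qed
  then have "S = infsum h I" using s LIMSEQ_unique by blast
  then show ?thesis using hsum by simp
qed

section \<open>Power series in several variables with uniform coefficient bounds\<close>

definition multi_indices :: "('a::euclidean_space \<Rightarrow> nat) set" where
  "multi_indices = {\<alpha>. \<forall>b. b \<notin> Basis \<longrightarrow> \<alpha> b = 0}"

definition monomial :: "('a::euclidean_space \<Rightarrow> nat) \<Rightarrow> 'a \<Rightarrow> real" where
  "monomial \<alpha> v = (\<Prod>b\<in>Basis. (v \<bullet> b) ^ \<alpha> b)"

definition mdeg :: "('a::euclidean_space \<Rightarrow> nat) \<Rightarrow> nat" where "mdeg \<alpha> = (\<Sum>b\<in>Basis. \<alpha> b)"

lemma power_mdeg: "(q::real) ^ mdeg \<alpha> = (\<Prod>b\<in>Basis. q ^ \<alpha> b)"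
  by (simp add: mdeg_def power_sum)

lemma monomial_bound: "norm v \<le> s \<Longrightarrow> \<bar>monomial \<alpha> v\<bar> \<le> s ^ mdeg \<alpha>"
  unfolding monomial_def power_mdeg abs_prod
  by (intro prod_mono) (auto simp: power_abs intro!: power_mono order_trans[OF Basis_le_norm])

lemma inj_on_restrict_multi_indices:
  "inj_on (\<lambda>\<alpha>. restrict \<alpha> Basis) (multi_indices :: ('a::euclidean_space \<Rightarrow> nat) set)"
proof (rule inj_onI)
  fix \<alpha> \<beta> :: "'a \<Rightarrow> nat"
  assume ab: "\<alpha> \<in> multi_indices" "\<beta> \<in> multi_indices" "restrict \<alpha> Basis = restrict \<beta> Basis"
  show "\<alpha> = \<beta>"
  proof
    fix b
    have "restrict \<alpha> Basis b = restrict \<beta> Basis b" using ab(3) by simp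
    then show "\<alpha> b = \<beta> b" using ab(1,2) by (cases "b \<in> Basis") (simp_all add: multi_indices_def)
  qed
qed

lemma countable_multi_indices: "countable (multi_indices :: ('a::euclidean_space \<Rightarrow> nat) set)"
proof -
  note inj_on_restrict_multi_indices[where 'a='a]
  moreover have "(\<lambda>\<alpha>. restrict \<alpha> Basis) ` (multi_indices :: ('a \<Rightarrow> nat) set) \<subseteq> Basis \<rightarrow>\<^sub>E UNIV" by auto
  moreover have "countable ((Basis :: 'a set) \<rightarrow>\<^sub>E (UNIV :: nat set))" by (intro countable_PiE) auto
  ultimately show ?thesis using countable_image_inj_on countable_subset by metis
qed

text \<open>Any finite set of multi-indices fits into a box, over which the sum factors into
  truncated geometric series, one per coordinate.\<close>

lemma summable_on_power_mdeg:
  assumes q: "0 \<le> q" "(q::real) < 1"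
  shows "(\<lambda>\<alpha>. q ^ mdeg \<alpha>) summable_on (multi_indices :: ('a::euclidean_space \<Rightarrow> nat) set)"
proof (rule nonneg_bdd_above_summable_on)
  show "bdd_above (sum (\<lambda>\<alpha>. q ^ mdeg \<alpha>) ` {F. F \<subseteq> (multi_indices :: ('a \<Rightarrow> nat) set) \<and> finite F})"
  proof (rule bdd_aboveI2)
    fix F :: "('a \<Rightarrow> nat) set" assume "F \<in> {F. F \<subseteq> multi_indices \<and> finite F}"
    then have F: "F \<subseteq> multi_indices" "finite F" by auto
    define n where "n = Max (insert 0 (mdeg ` F))"
    have n: "\<alpha> b \<le> n" if "\<alpha> \<in> F" "b \<in> Basis" for \<alpha> b
    proof -
      have "\<alpha> b \<le> mdeg \<alpha>" unfolding mdeg_def using that by (intro member_le_sum) auto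
      also have "\<dots> \<le> n" unfolding n_def using that F by (intro Max_ge) auto
      finally show ?thesis .
    qed
    have inj: "inj_on (\<lambda>\<alpha>. restrict \<alpha> Basis) F"
      using inj_on_restrict_multi_indices F(1) by (rule inj_on_subset)
    have "(\<Sum>\<alpha>\<in>F. q ^ mdeg \<alpha>) = (\<Sum>\<alpha>\<in>F. \<Prod>b\<in>Basis. q ^ restrict \<alpha> Basis b)"
      by (simp add: power_mdeg)
    also have "\<dots> = (\<Sum>g\<in>(\<lambda>\<alpha>. restrict \<alpha> Basis) ` F. \<Prod>b\<in>Basis. q ^ g b)"
      using inj by (subst sum.reindex) (auto simp: o_def)
    also have "\<dots> \<le> (\<Sum>g\<in>(Basis :: 'a set) \<rightarrow>\<^sub>E {..n}. \<Prod>b\<in>Basis. q ^ g b)"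
    proof (rule sum_mono2)
      show "finite ((Basis :: 'a set) \<rightarrow>\<^sub>E {..n})" by (intro finite_PiE) auto
      show "(\<lambda>\<alpha>. restrict \<alpha> Basis) ` F \<subseteq> Basis \<rightarrow>\<^sub>E {..n}" using n by auto
    qed (use q in \<open>auto intro!: prod_nonneg\<close>)
    also have "\<dots> = (\<Prod>b\<in>(Basis::'a set). \<Sum>k\<le>n. q ^ k)"
      by (rule prod_sum_PiE[symmetric]) auto
    also have "\<dots> \<le> (\<Prod>b\<in>(Basis::'a set). 1 / (1 - q))"
    proof (intro prod_mono conjI)
      show "(\<Sum>k\<le>n. q ^ k) \<le> 1 / (1 - q)"
        using sum_le_suminf[of "\<lambda>k. q ^ k" "{..n}"] q by (simp add: suminf_geometric)
    qed (use q in \<open>auto intro!: sum_nonneg\<close>)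
    finally show "(\<Sum>\<alpha>\<in>F. q ^ mdeg \<alpha>) \<le> (\<Prod>b\<in>(Basis::'a set). 1 / (1 - q))" .
  qed
qed (use q in auto)

text \<open>Power series at \<open>x\<close> whose coefficients are majorised by \<open>f x * S / s ^ mdeg \<alpha>\<close>. As
  the majorant involves \<open>f\<close> only through \<open>f x\<close>, the class is stable under sums and pointwise limits.\<close>
definition majorised :: "real \<Rightarrow> real \<Rightarrow> 'a::euclidean_space \<Rightarrow> ('a \<Rightarrow> real) \<Rightarrow> bool" where
  "majorised s S x f \<longleftrightarrow> 0 \<le> f x \<and> (\<exists>c. (\<forall>\<alpha>. \<bar>c \<alpha>\<bar> \<le> f x * S / s ^ mdeg \<alpha>) \<and>
     (\<forall>y\<in>ball x (s/2). ((\<lambda>\<alpha>. c \<alpha> * monomial \<alpha> (y - x)) has_sum f y) multi_indices))"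

lemma majorised_0: "0 < s \<Longrightarrow> 0 \<le> S \<Longrightarrow> majorised s S x (\<lambda>_. 0)"
  unfolding majorised_def by (intro conjI exI[of _ "\<lambda>_. 0"]) auto

lemma majorised_add:
  assumes "majorised s S x f" "majorised s S x g" shows "majorised s S x (\<lambda>y. f y + g y)"
proof -
  obtain c where c: "0 \<le> f x" "\<And>\<alpha>. \<bar>c \<alpha>\<bar> \<le> f x * S / s ^ mdeg \<alpha>"
    "\<And>y. y \<in> ball x (s/2) \<Longrightarrow> ((\<lambda>\<alpha>. c \<alpha> * monomial \<alpha> (y - x)) has_sum f y) multi_indices"
    using assms(1) unfolding majorised_def by blast
  obtain d where d: "0 \<le> g x" "\<And>\<alpha>. \<bar>d \<alpha>\<bar> \<le> g x * S / s ^ mdeg \<alpha>"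
    "\<And>y. y \<in> ball x (s/2) \<Longrightarrow> ((\<lambda>\<alpha>. d \<alpha> * monomial \<alpha> (y - x)) has_sum g y) multi_indices"
    using assms(2) unfolding majorised_def by blast
  show ?thesis unfolding majorised_def
  proof (intro conjI exI[of _ "\<lambda>\<alpha>. c \<alpha> + d \<alpha>"] allI ballI)
    show "\<bar>c \<alpha> + d \<alpha>\<bar> \<le> (f x + g x) * S / s ^ mdeg \<alpha>" for \<alpha>
      using c(2)[of \<alpha>] d(2)[of \<alpha>] by (simp add: distrib_right add_divide_distrib)
    show "((\<lambda>\<alpha>. (c \<alpha> + d \<alpha>) * monomial \<alpha> (y - x)) has_sum (f y + g y)) multi_indices"
      if "y \<in> ball x (s/2)" for y
      using has_sum_add[OF c(3)[OF that] d(3)[OF that]] by (simp add: distrib_right)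
  qed (use c d in auto)
qed

lemma majorised_scale:
  assumes "majorised s S x f" "0 \<le> k" shows "majorised s S x (\<lambda>y. k * f y)"
proof -
  obtain c where c: "0 \<le> f x" "\<And>\<alpha>. \<bar>c \<alpha>\<bar> \<le> f x * S / s ^ mdeg \<alpha>"
    "\<And>y. y \<in> ball x (s/2) \<Longrightarrow> ((\<lambda>\<alpha>. c \<alpha> * monomial \<alpha> (y - x)) has_sum f y) multi_indices"
    using assms(1) unfolding majorised_def by blast
  show ?thesis unfolding majorised_def
  proof (intro conjI exI[of _ "\<lambda>\<alpha>. k * c \<alpha>"] allI ballI)
    show "\<bar>k * c \<alpha>\<bar> \<le> k * f x * S / s ^ mdeg \<alpha>" for \<alpha>
      using mult_left_mono[OF c(2)[of \<alpha>] assms(2)] assms(2) by (simp add: abs_mult mult.assoc)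
    show "((\<lambda>\<alpha>. k * c \<alpha> * monomial \<alpha> (y - x)) has_sum (k * f y)) multi_indices" if "y \<in> ball x (s/2)" for y
      using has_sum_cmult_right[OF c(3)[OF that], of k] by (simp add: mult.assoc)
  qed (use c assms in auto)
qed

lemma diagonal_convergent_subseq:
  fixes c :: "nat \<Rightarrow> 'i \<Rightarrow> real"
  assumes "countable I" and bd: "\<And>i. i \<in> I \<Longrightarrow> \<exists>B. \<forall>n. \<bar>c n i\<bar> \<le> B"
  obtains r where "strict_mono (r :: nat \<Rightarrow> nat)" "\<And>i. i \<in> I \<Longrightarrow> convergent (\<lambda>n. c (r n) i)"
proof (cases "I = {}")
  case True
  then show ?thesis using that[of id] by (auto simp: strict_mono_def)
next
  case False
  define P where "P k s \<longleftrightarrow> convergent (\<lambda>n. c (s n) (from_nat_into I k))" for k and s :: "nat \<Rightarrow> nat"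
  interpret subseqs P
  proof
    fix n and s :: "nat \<Rightarrow> nat" assume "strict_mono s"
    obtain B where B: "\<forall>m. \<bar>c m (from_nat_into I n)\<bar> \<le> B" using bd[OF from_nat_into[OF False]] by blast
    then have "bounded (range (\<lambda>m. c (s m) (from_nat_into I n)))" by (auto simp: bounded_iff)
    then obtain l r where "strict_mono r" "((\<lambda>m. c (s m) (from_nat_into I n)) \<circ> r) \<longlonglongrightarrow> l"
      using bounded_imp_convergent_subsequence by blast
    then show "\<exists>r'. strict_mono r' \<and> P n (s \<circ> r')"
      unfolding P_def by (intro exI[of _ r]) (auto simp: o_def convergent_def)
  qed
  show ?thesis
  proof (rule that)
    show "strict_mono diagseq" by (rule subseq_diagseq)
    fix i assume i: "i \<in> I"
    obtain k where k: "from_nat_into I k = i" using from_nat_into_surj[OF assms(1) i] by auto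
    have "P k (diagseq \<circ> (+) (Suc k))"
    proof (rule diagseq_holds)
      fix r s :: "nat \<Rightarrow> nat" and n assume "strict_mono r" "P n s"
      then show "P n (s \<circ> r)" unfolding P_def using convergent_subseq_convergent[of "\<lambda>m. c (s m) (from_nat_into I n)" r]
        by (auto simp: o_def)
    qed
    then have "convergent (\<lambda>n. c (diagseq (n + Suc k)) i)" by (simp add: P_def k o_def add.commute)
    then show "convergent (\<lambda>n. c (diagseq n) i)"
      using convergent_ignore_initial_segment[of "\<lambda>n. c (diagseq n) i" "Suc k"] by blast
  qed
qed

text \<open>The coefficients are bounded, so all of them converge along a diagonal subsequence, and
  the majorant follows the values at \<open>x\<close>. On the ball of half the radius the terms are
  dominated by \<open>(1/2) ^ mdeg \<alpha>\<close>, so the series converge to the series of the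
  limit.\<close>

lemma majorised_limit:
  fixes x :: "'a::euclidean_space"
  assumes s: "0 < s" and S: "0 \<le> S" and F: "\<And>n. majorised s S x (F n)"
    and lim: "\<And>y. y \<in> ball x (s/2) \<Longrightarrow> (\<lambda>n. F n y) \<longlonglongrightarrow> f y"
  shows "majorised s S x f"
proof -
  have "\<forall>n. \<exists>c. 0 \<le> F n x \<and> (\<forall>\<alpha>. \<bar>c \<alpha>\<bar> \<le> F n x * S / s ^ mdeg \<alpha>) \<and>
     (\<forall>y\<in>ball x (s/2). ((\<lambda>\<alpha>. c \<alpha> * monomial \<alpha> (y - x)) has_sum F n y) multi_indices)"
    using F by (simp add: majorised_def)
  then obtain c where c0: "\<And>n. 0 \<le> F n x" and c1: "\<And>n \<alpha>. \<bar>c n \<alpha>\<bar> \<le> F n x * S / s ^ mdeg \<alpha>"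
    and c2: "\<And>n y. y \<in> ball x (s/2) \<Longrightarrow> ((\<lambda>\<alpha>. c n \<alpha> * monomial \<alpha> (y - x)) has_sum F n y) multi_indices"
    by metis
  have lx: "(\<lambda>n. F n x) \<longlonglongrightarrow> f x" using lim[of x] s by simp
  then have "Bseq (\<lambda>n. F n x)" using convergent_imp_Bseq convergentI by blast
  then obtain B where "\<And>n. norm (F n x) \<le> B" unfolding Bseq_def by blast
  then have B: "F n x \<le> B" for n using abs_le_D1[of "F n x" B] by simp
  have cB: "\<bar>c n \<alpha>\<bar> \<le> B * S / s ^ mdeg \<alpha>" for n \<alpha>
    using c1[of n \<alpha>] B[of n] s S by (elim order_trans) (intro divide_right_mono mult_right_mono, auto)
  obtain r where r: "strict_mono r" "\<And>\<alpha>. \<alpha> \<in> multi_indices \<Longrightarrow> convergent (\<lambda>n. c (r n) \<alpha>)"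
    using diagonal_convergent_subseq[OF countable_multi_indices, of c] cB by blast
  define d where "d \<alpha> = (if \<alpha> \<in> multi_indices then lim (\<lambda>n. c (r n) \<alpha>) else 0)" for \<alpha>
  have d: "(\<lambda>n. c (r n) \<alpha>) \<longlonglongrightarrow> d \<alpha>" if "\<alpha> \<in> multi_indices" for \<alpha>
    using r(2)[OF that] that by (simp add: d_def convergent_LIMSEQ_iff)
  have lr: "(\<lambda>n. F (r n) y) \<longlonglongrightarrow> f y" if "y \<in> ball x (s/2)" for y
    using LIMSEQ_subseq_LIMSEQ[OF lim[OF that] r(1)] by (simp add: o_def)
  have fx: "0 \<le> f x" using lx c0 by (intro LIMSEQ_le_const[OF lx]) auto
  show ?thesis unfolding majorised_def
  proof (intro conjI exI[of _ d] allI ballI)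
    show "\<bar>d \<alpha>\<bar> \<le> f x * S / s ^ mdeg \<alpha>" for \<alpha>
    proof (cases "\<alpha> \<in> multi_indices")
      case True
      show ?thesis
      proof (rule LIMSEQ_le[OF tendsto_rabs[OF d[OF True]]])
        show "(\<lambda>n. F (r n) x * S / s ^ mdeg \<alpha>) \<longlonglongrightarrow> f x * S / s ^ mdeg \<alpha>"
          using s by (intro tendsto_intros lr) auto
      qed (use c1 in auto)
    qed (use fx S s in \<open>simp add: d_def\<close>)
    fix y assume y: "y \<in> ball x (s/2)"
    show "((\<lambda>\<alpha>. d \<alpha> * monomial \<alpha> (y - x)) has_sum f y) multi_indices"
    proof (rule has_sum_dominated_limit[where g="\<lambda>n \<alpha>. c (r n) \<alpha> * monomial \<alpha> (y - x)"])
      have "(\<lambda>\<alpha>. (1/2 :: real) ^ mdeg \<alpha>) summable_on (multi_indices :: ('a \<Rightarrow> nat) set)"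
        by (rule summable_on_power_mdeg) auto
      then show "(\<lambda>\<alpha>. B * S * (1/2) ^ mdeg \<alpha>) summable_on (multi_indices :: ('a \<Rightarrow> nat) set)"
        by (rule summable_on_cmult_right)
      show "\<bar>c (r n) \<alpha> * monomial \<alpha> (y - x)\<bar> \<le> B * S * (1/2) ^ mdeg \<alpha>" for n \<alpha>
      proof -
        have "\<bar>monomial \<alpha> (y - x)\<bar> \<le> (s/2) ^ mdeg \<alpha>"
          using y by (intro monomial_bound) (auto simp: dist_norm norm_minus_commute)
        then have "\<bar>c (r n) \<alpha> * monomial \<alpha> (y - x)\<bar> \<le> (B * S / s ^ mdeg \<alpha>) * (s/2) ^ mdeg \<alpha>"
          unfolding abs_mult using cB s order_trans[OF abs_ge_zero cB[of "r n" \<alpha>]] by (intro mult_mono) auto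
        also have "\<dots> = B * S * (1/2) ^ mdeg \<alpha>" using s by (simp add: power_divide)
        finally show ?thesis .
      qed
    qed (use d c2[OF y] lr[OF y] in \<open>auto intro!: tendsto_intros\<close>)
  qed (use fx in auto)
qed

text \<open>Expanding over words instead of exponents avoids multinomial coefficients.\<close>

lemma power_sum_lists:
  fixes a :: "'j \<Rightarrow> real"
  assumes "finite J"
  shows "(\<Sum>j\<in>J. a j) ^ n = (\<Sum>l | set l \<subseteq> J \<and> length l = n. prod_list (map a l))"
proof (induction n)
  case (Suc n)
  have eq: "{l. set l \<subseteq> J \<and> length l = Suc n} = (\<lambda>(j, l). j # l) ` (J \<times> {l. set l \<subseteq> J \<and> length l = n})"
    by (auto simp: length_Suc_conv image_iff)
  have "(\<Sum>j\<in>J. a j) ^ Suc n = (\<Sum>j\<in>J. a j) * (\<Sum>l | set l \<subseteq> J \<and> length l = n. prod_list (map a l))"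
    by (simp add: Suc)
  also have "\<dots> = (\<Sum>(j, l)\<in>J \<times> {l. set l \<subseteq> J \<and> length l = n}. a j * prod_list (map a l))"
    by (simp add: sum_product sum.cartesian_product)
  also have "\<dots> = (\<Sum>l | set l \<subseteq> J \<and> length l = Suc n. prod_list (map a l))"
    unfolding eq by (subst sum.reindex) (auto simp: inj_on_def o_def case_prod_unfold)
  finally show ?case .
qed (simp add: Collect_conv_if)

text \<open>If the weights of the letters add up to at most 1/2, the binomial series remains
  absolutely convergent after its powers are expanded into words, so its terms may be regrouped
  freely. Grouping by length recovers the binomial series.\<close>

lemma has_sum_binomial_lists:
  fixes A :: "'j \<Rightarrow> real"
  assumes J: "finite J" and A: "\<And>j. j \<in> J \<Longrightarrow> \<bar>k j\<bar> \<le> A j" "(\<Sum>j\<in>J. A j) \<le> 1/2"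
  shows "(\<lambda>l. \<bar>(a gchoose length l) * prod_list (map k l)\<bar>) summable_on {l. set l \<subseteq> J}"
    and "infsum (\<lambda>l. \<bar>(a gchoose length l) * prod_list (map k l)\<bar>) {l. set l \<subseteq> J} \<le> (\<Sum>n. \<bar>a gchoose n\<bar> * (1/2) ^ n)"
    and "((\<lambda>l. (a gchoose length l) * prod_list (map k l)) has_sum (1 + (\<Sum>j\<in>J. k j)) powr a) {l. set l \<subseteq> J}"
proof -
  let ?F = "\<lambda>l. (a gchoose length l) * prod_list (map k l)"
  let ?S = "\<Sum>n. \<bar>a gchoose n\<bar> * (1/2) ^ n"
  have Ap: "A j \<ge> 0" if "j \<in> J" for j using A(1)[OF that] by linarith
  have sm: "summable (\<lambda>n. \<bar>a gchoose n\<bar> * (1/2) ^ n)"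
  proof -
    \<comment> \<open>Convergence at 3/4, still inside the unit disc, gives absolute convergence at
      1/2.\<close>
    have "summable (\<lambda>n. (a gchoose n) * (3/4) ^ n)"
      using gen_binomial_real[of "3/4" a] by (auto simp: sums_iff)
    then have "summable (\<lambda>n. norm ((a gchoose n) * (1/2) ^ n))" by (rule powser_insidea) auto
    then show ?thesis by (simp add: abs_mult power_abs)
  qed
  have finL: "finite {l. set l \<subseteq> J \<and> length l = n}" for n using finite_lists_length_eq[OF J] .
  have absk: "\<bar>prod_list (map k l)\<bar> \<le> prod_list (map A l) \<and> 0 \<le> prod_list (map A l)" if "set l \<subseteq> J" for l
    using that by (induction l) (auto simp: abs_mult A Ap intro!: mult_mono)
  have bd: "sum (\<lambda>l. \<bar>?F l\<bar>) X \<le> ?S" if X: "X \<subseteq> {l. set l \<subseteq> J}" "finite X" for X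
  proof -
    define n where "n = Max (insert 0 (length ` X))"
    have n: "length l \<le> n" if "l \<in> X" for l unfolding n_def using that X by (intro Max_ge) auto
    have "sum (\<lambda>l. \<bar>?F l\<bar>) X \<le> sum (\<lambda>l. \<bar>?F l\<bar>) (\<Union>m\<in>{..n}. {l. set l \<subseteq> J \<and> length l = m})"
      using X n finL by (intro sum_mono2) auto
    also have "\<dots> = (\<Sum>m\<le>n. \<Sum>l | set l \<subseteq> J \<and> length l = m. \<bar>?F l\<bar>)"
      using finL by (intro sum.UNION_disjoint) auto
    also have "\<dots> \<le> (\<Sum>m\<le>n. \<bar>a gchoose m\<bar> * (1/2) ^ m)"
    proof (intro sum_mono)
      fix m
      have "(\<Sum>l | set l \<subseteq> J \<and> length l = m. \<bar>?F l\<bar>) \<le> (\<Sum>l | set l \<subseteq> J \<and> length l = m. \<bar>a gchoose m\<bar> * prod_list (map A l))"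
        using absk by (intro sum_mono) (auto simp: abs_mult intro!: mult_left_mono)
      also have "\<dots> = \<bar>a gchoose m\<bar> * (\<Sum>j\<in>J. A j) ^ m" by (simp add: power_sum_lists[OF J] sum_distrib_left)
      also have "\<dots> \<le> \<bar>a gchoose m\<bar> * (1/2) ^ m"
        using A Ap by (intro mult_left_mono power_mono sum_nonneg) auto
      finally show "(\<Sum>l | set l \<subseteq> J \<and> length l = m. \<bar>?F l\<bar>) \<le> \<bar>a gchoose m\<bar> * (1/2) ^ m" .
    qed
    also have "\<dots> \<le> ?S" using sm by (intro sum_le_suminf) auto
    finally show ?thesis .
  qed
  show abs: "(\<lambda>l. \<bar>?F l\<bar>) summable_on {l. set l \<subseteq> J}"
    using bd by (intro nonneg_bdd_above_summable_on) (auto intro!: bdd_aboveI2[where M="?S"])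
  show "infsum (\<lambda>l. \<bar>?F l\<bar>) {l. set l \<subseteq> J} \<le> ?S"
    using abs bd by (intro infsum_le_finite_sums) auto
  have "(\<lambda>l. norm (?F l)) summable_on {l. set l \<subseteq> J}" using abs by (simp only: real_norm_def)
  then have "?F summable_on {l. set l \<subseteq> J}" by (rule Infinite_Sum.abs_summable_summable)
  then obtain t where t: "(?F has_sum t) {l. set l \<subseteq> J}" by (auto simp: summable_on_def)
  have img: "snd ` (Sigma UNIV (\<lambda>n. {l. set l \<subseteq> J \<and> length l = n})) = {l. set l \<subseteq> J}" by force
  have inj: "inj_on snd (Sigma UNIV (\<lambda>n. {l. set l \<subseteq> J \<and> length l = n}))" by (auto simp: inj_on_def)
  have "((\<lambda>p. ?F (snd p)) has_sum t) (Sigma UNIV (\<lambda>n. {l. set l \<subseteq> J \<and> length l = n}))"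
    using has_sum_reindex[OF inj, of ?F t] t by (simp add: img o_def)
  then have "((\<lambda>n. (a gchoose n) * (\<Sum>j\<in>J. k j) ^ n) has_sum t) UNIV"
  proof (rule has_sum_Sigma[OF isUCont_plus])
    fix n
    show "((\<lambda>l. ?F (snd (n, l))) has_sum (a gchoose n) * (\<Sum>j\<in>J. k j) ^ n) {l. set l \<subseteq> J \<and> length l = n}"
      using finL by (intro has_sum_finiteI) (auto simp: power_sum_lists[OF J] sum_distrib_left)
  qed
  then have "(\<lambda>n. (a gchoose n) * (\<Sum>j\<in>J. k j) ^ n) sums t" by (rule has_sum_imp_sums)
  moreover have "\<bar>\<Sum>j\<in>J. k j\<bar> < 1"
  proof -
    have "\<bar>\<Sum>j\<in>J. k j\<bar> \<le> (\<Sum>j\<in>J. A j)" using A by (intro order_trans[OF sum_abs] sum_mono) auto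
    then show ?thesis using A by simp
  qed
  then have "(\<lambda>n. (a gchoose n) * (\<Sum>j\<in>J. k j) ^ n) sums (1 + (\<Sum>j\<in>J. k j)) powr a" by (rule gen_binomial_real)
  ultimately have "t = (1 + (\<Sum>j\<in>J. k j)) powr a" using sums_unique2 by blast
  then show "(?F has_sum (1 + (\<Sum>j\<in>J. k j)) powr a) {l. set l \<subseteq> J}" using t by simp
qed

text \<open>Each word in the linear and quadratic terms yields one monomial; collecting words of
  equal exponent gives the coefficients. The absolute sum over all words at radius \<open>s\<close>
  bounds every coefficient, as in Cauchy's estimate, and \<open>small\<close> makes the letters
  weigh at most 1/2.\<close>

lemma power_series_of_quadratic_powr:
  fixes b :: "'a::euclidean_space"
  assumes s: "0 < s" and t: "norm b \<le> t" "0 \<le> c" "c \<le> t\<^sup>2"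
    and small: "real DIM('a) * (2 * t * s + t\<^sup>2 * s\<^sup>2) \<le> 1/2"
  shows "\<exists>e. (\<forall>\<alpha>. \<bar>e \<alpha>\<bar> \<le> (\<Sum>n. \<bar>a gchoose n\<bar> * (1/2) ^ n) / s ^ mdeg \<alpha>) \<and>
    (\<forall>v. norm v \<le> s \<longrightarrow> ((\<lambda>\<alpha>. e \<alpha> * monomial \<alpha> v) has_sum (1 + 2 * (b \<bullet> v) + c * (v \<bullet> v)) powr a) multi_indices)"
proof -
  let ?S = "\<Sum>n. \<bar>a gchoose n\<bar> * (1/2) ^ n"
  \<comment> \<open>The letter \<open>(i, 1)\<close> is the linear term in the coordinate
    \<open>i\<close> and \<open>(i, 2)\<close> the quadratic one; the second component is the
    degree.\<close>
  define J where "J = (Basis :: 'a set) \<times> {1, 2::nat}"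
  define k where "k j = (if snd j = 1 then 2 * (b \<bullet> fst j) else c)" for j :: "'a \<times> nat"
  define ex where "ex l = (\<lambda>i. sum_list (map (\<lambda>j. if fst j = i then snd j else 0) l))" for l :: "('a \<times> nat) list"
  define coef where "coef l = (a gchoose length l) * prod_list (map k l)" for l
  have J: "finite J" by (simp add: J_def)
  have Jsum: "(\<Sum>j\<in>J. f j) = (\<Sum>i\<in>Basis. f (i, 1) + f (i, 2))" for f :: "'a \<times> nat \<Rightarrow> real"
    using sum.cartesian_product[of "\<lambda>i e. f (i, e)" "{1, 2::nat}" "Basis :: 'a set"] by (simp add: J_def)
  have exMI: "ex l \<in> multi_indices" if "set l \<subseteq> J" for l
    using that by (induction l) (auto simp: ex_def multi_indices_def J_def)
  have mon1: "(\<Prod>i\<in>Basis. (v \<bullet> i) ^ (if fst j = i then snd j else 0)) = (v \<bullet> fst j) ^ snd j" if "j \<in> J" for j v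
  proof -
    have "(\<Prod>i\<in>Basis. (v \<bullet> i) ^ (if fst j = i then snd j else 0)) = (\<Prod>i\<in>Basis. if i = fst j then (v \<bullet> fst j) ^ snd j else 1)"
      by (intro prod.cong) auto
    also have "\<dots> = (v \<bullet> fst j) ^ snd j" using that by (auto simp: J_def)
    finally show ?thesis .
  qed
  have mono: "monomial (ex l) v = prod_list (map (\<lambda>j. (v \<bullet> fst j) ^ snd j) l)" if "set l \<subseteq> J" for l v
    using that
  proof (induction l)
    case (Cons j l)
    have "monomial (ex (j # l)) v = (\<Prod>i\<in>Basis. (v \<bullet> i) ^ (if fst j = i then snd j else 0)) * monomial (ex l) v"
      by (simp add: monomial_def ex_def power_add prod.distrib)
    then show ?case using Cons mon1 by simp
  qed (simp add: monomial_def ex_def)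
  have deg: "s ^ mdeg (ex l) = prod_list (map (\<lambda>j. s ^ snd j) l)" if "set l \<subseteq> J" for l
    using that
  proof (induction l)
    case (Cons j l)
    have "(\<Sum>i\<in>Basis. if fst j = i then snd j else 0) = snd j" using Cons.prems by (auto simp: J_def)
    then have "mdeg (ex (j # l)) = snd j + mdeg (ex l)" by (simp add: mdeg_def ex_def sum.distrib)
    then show ?case using Cons by (simp add: power_add)
  qed (simp add: mdeg_def ex_def)
  have pl: "prod_list (map (\<lambda>j. f j * g j) l) = prod_list (map f l) * prod_list (map g l)" for f g :: "'a \<times> nat \<Rightarrow> real" and l
    by (induction l) auto
  define A where "A j = \<bar>k j\<bar> * s ^ snd j" for j
  have Asum: "(\<Sum>j\<in>J. A j) \<le> 1/2"
  proof -
    have "(\<Sum>j\<in>J. A j) = (\<Sum>i\<in>Basis. \<bar>2 * (b \<bullet> i)\<bar> * s + \<bar>c\<bar> * s\<^sup>2)"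
      by (simp add: Jsum A_def k_def)
    also have "\<dots> \<le> (\<Sum>i\<in>(Basis::'a set). 2 * t * s + t\<^sup>2 * s\<^sup>2)"
    proof (intro sum_mono add_mono mult_right_mono)
      fix i :: 'a assume "i \<in> Basis"
      then have "\<bar>b \<bullet> i\<bar> \<le> t" using t by (meson Basis_le_norm order_trans)
      then show "\<bar>2 * (b \<bullet> i)\<bar> \<le> 2 * t" by (simp add: abs_mult)
    qed (use s t in auto)
    also have "\<dots> = real DIM('a) * (2 * t * s + t\<^sup>2 * s\<^sup>2)" by simp
    finally show ?thesis using small by simp
  qed
  note W = has_sum_binomial_lists[OF J, of "\<lambda>j. k j * s ^ snd j" A a]
  have Wk: "\<bar>k j * s ^ snd j\<bar> \<le> A j" for j using s by (simp add: A_def abs_mult)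
  have cs: "(a gchoose length l) * prod_list (map (\<lambda>j. k j * s ^ snd j) l) = coef l * s ^ mdeg (ex l)" if "set l \<subseteq> J" for l
    using that by (simp add: coef_def pl deg)
  have W1: "(\<lambda>l. \<bar>coef l * s ^ mdeg (ex l)\<bar>) summable_on {l. set l \<subseteq> J}"
    using W(1)[OF Wk Asum] by (rule summable_on_cong[THEN iffD1, rotated]) (simp add: cs)
  have W2: "infsum (\<lambda>l. \<bar>coef l * s ^ mdeg (ex l)\<bar>) {l. set l \<subseteq> J} \<le> ?S"
  proof -
    have "infsum (\<lambda>l. \<bar>coef l * s ^ mdeg (ex l)\<bar>) {l. set l \<subseteq> J} =
      infsum (\<lambda>l. \<bar>(a gchoose length l) * prod_list (map (\<lambda>j. k j * s ^ snd j) l)\<bar>) {l. set l \<subseteq> J}"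
      by (intro infsum_cong) (simp add: cs)
    then show ?thesis using W(2)[OF Wk Asum] by simp
  qed
  define fib where "fib \<alpha> = {l. set l \<subseteq> J \<and> ex l = \<alpha>}" for \<alpha>
  define e where "e \<alpha> = infsum coef (fib \<alpha>)" for \<alpha>
  have fibs: "(\<lambda>l. \<bar>coef l * s ^ mdeg (ex l)\<bar>) summable_on fib \<alpha>" for \<alpha>
    using W1 by (rule summable_on_subset_banach) (auto simp: fib_def)
  have cabs: "(\<lambda>l. \<bar>coef l\<bar>) summable_on fib \<alpha>" for \<alpha>
  proof -
    have "(\<lambda>l. \<bar>coef l * s ^ mdeg (ex l)\<bar> * (1 / s ^ mdeg \<alpha>)) summable_on fib \<alpha>"
      using fibs by (rule summable_on_cmult_left)
    then show ?thesis by (rule summable_on_cong[THEN iffD1, rotated]) (use s in \<open>auto simp: fib_def abs_mult\<close>)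
  qed
  have csum: "coef summable_on fib \<alpha>" for \<alpha> 
  proof (rule Infinite_Sum.abs_summable_summable)
    show "(\<lambda>l. norm (coef l)) summable_on fib \<alpha>" using cabs by (simp only: real_norm_def)
  qed
  show ?thesis
  proof (intro exI[of _ e] conjI allI impI)
    fix \<alpha>
    have "\<bar>e \<alpha>\<bar> \<le> infsum (\<lambda>l. \<bar>coef l\<bar>) (fib \<alpha>)"
      unfolding e_def using norm_infsum_bound[of coef "fib \<alpha>"] cabs by simp
    also have "\<dots> = infsum (\<lambda>l. \<bar>coef l * s ^ mdeg (ex l)\<bar> * (1 / s ^ mdeg \<alpha>)) (fib \<alpha>)"
      using s by (intro infsum_cong) (auto simp: fib_def abs_mult)
    also have "\<dots> = infsum (\<lambda>l. \<bar>coef l * s ^ mdeg (ex l)\<bar>) (fib \<alpha>) * (1 / s ^ mdeg \<alpha>)"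
      using fibs by (intro infsum_cmult_left) auto
    also have "\<dots> \<le> ?S * (1 / s ^ mdeg \<alpha>)"
    proof (intro mult_right_mono)
      have "infsum (\<lambda>l. \<bar>coef l * s ^ mdeg (ex l)\<bar>) (fib \<alpha>) \<le> infsum (\<lambda>l. \<bar>coef l * s ^ mdeg (ex l)\<bar>) {l. set l \<subseteq> J}"
        using fibs W1 by (intro infsum_mono2) (auto simp: fib_def)
      then show "infsum (\<lambda>l. \<bar>coef l * s ^ mdeg (ex l)\<bar>) (fib \<alpha>) \<le> ?S" using W2 by simp
    qed (use s in auto)
    finally show "\<bar>e \<alpha>\<bar> \<le> ?S / s ^ mdeg \<alpha>" by simp
  next
    fix v :: 'a assume v: "norm v \<le> s"
    have Vk: "\<bar>k j * (v \<bullet> fst j) ^ snd j\<bar> \<le> A j" if "j \<in> J" for j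
    proof -
      have "\<bar>v \<bullet> fst j\<bar> \<le> s" using that v by (auto simp: J_def intro: order_trans[OF Basis_le_norm])
      then have "\<bar>(v \<bullet> fst j) ^ snd j\<bar> \<le> s ^ snd j" by (simp add: power_abs power_mono)
      then show ?thesis unfolding A_def abs_mult by (intro mult_left_mono) auto
    qed
    have z: "(\<Sum>j\<in>J. k j * (v \<bullet> fst j) ^ snd j) = 2 * (b \<bullet> v) + c * (v \<bullet> v)"
    proof -
      have "(\<Sum>j\<in>J. k j * (v \<bullet> fst j) ^ snd j) = (\<Sum>i\<in>Basis. 2 * (b \<bullet> i) * (v \<bullet> i) + c * (v \<bullet> i)\<^sup>2)"
        by (simp add: Jsum k_def)
      also have "\<dots> = 2 * (\<Sum>i\<in>Basis. (b \<bullet> i) * (v \<bullet> i)) + c * (\<Sum>i\<in>Basis. (v \<bullet> i) * (v \<bullet> i))"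
        by (simp add: sum.distrib sum_distrib_left mult.assoc power2_eq_square)
      also have "\<dots> = 2 * (b \<bullet> v) + c * (v \<bullet> v)" by (simp add: euclidean_inner[symmetric])
      finally show ?thesis .
    qed
    have "((\<lambda>l. (a gchoose length l) * prod_list (map (\<lambda>j. k j * (v \<bullet> fst j) ^ snd j) l))
        has_sum (1 + (\<Sum>j\<in>J. k j * (v \<bullet> fst j) ^ snd j)) powr a) {l. set l \<subseteq> J}"
      by (rule has_sum_binomial_lists(3)[OF J Vk Asum])
    then have "((\<lambda>l. (a gchoose length l) * prod_list (map (\<lambda>j. k j * (v \<bullet> fst j) ^ snd j) l))
        has_sum (1 + 2 * (b \<bullet> v) + c * (v \<bullet> v)) powr a) {l. set l \<subseteq> J}" unfolding z by (simp add: add.assoc)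
    then have H: "((\<lambda>l. coef l * monomial (ex l) v) has_sum (1 + 2 * (b \<bullet> v) + c * (v \<bullet> v)) powr a) {l. set l \<subseteq> J}"
      by (rule has_sum_cong[THEN iffD1, rotated]) (simp add: coef_def pl mono)
    have img: "snd ` (Sigma multi_indices fib) = {l. set l \<subseteq> J}"
      using exMI by (auto simp: fib_def image_iff)
    have inj: "inj_on snd (Sigma multi_indices fib)" by (auto simp: inj_on_def fib_def)
    have "((\<lambda>p. coef (snd p) * monomial (ex (snd p)) v) has_sum (1 + 2 * (b \<bullet> v) + c * (v \<bullet> v)) powr a) (Sigma multi_indices fib)"
      using has_sum_reindex[OF inj, of "\<lambda>l. coef l * monomial (ex l) v"] H by (simp add: img o_def)
    then show "((\<lambda>\<alpha>. e \<alpha> * monomial \<alpha> v) has_sum (1 + 2 * (b \<bullet> v) + c * (v \<bullet> v)) powr a) multi_indices"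
    proof (rule has_sum_Sigma[OF isUCont_plus])
      fix \<alpha> :: "'a \<Rightarrow> nat"
      have "((\<lambda>l. coef l * monomial \<alpha> v) has_sum e \<alpha> * monomial \<alpha> v) (fib \<alpha>)"
        unfolding e_def using csum by (intro has_sum_cmult_left) auto
      then show "((\<lambda>l. coef (snd (\<alpha>, l)) * monomial (ex (snd (\<alpha>, l))) v) has_sum e \<alpha> * monomial \<alpha> v) (fib \<alpha>)"
        by (rule has_sum_cong[THEN iffD1, rotated]) (simp add: fib_def)
    qed
  qed
qed


section \<open>Analyticity of the density\<close>

definition quad :: "real \<Rightarrow> 'a::euclidean_space \<Rightarrow> real \<Rightarrow> 'a \<Rightarrow> real" where
  "quad \<alpha> \<beta> \<gamma> y = \<alpha> * (y \<bullet> y) + 2 * (\<beta> \<bullet> y) + \<gamma>"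

context cf_lattice
begin

text \<open>The fixed point of \<open>t \<mapsto> \<rho> * (1 + t * \<rho>)\<close>. A branch
  transforms the bound on the square root of \<open>\<alpha> / D\<close> by this map, so the bound
  \<open>tt\<close> reproduces itself.\<close>

definition tt :: real where "tt = \<rho> / (1 - \<rho>\<^sup>2)"

lemma tt: "0 \<le> tt" "\<rho> * (1 + tt * \<rho>) = tt"
  using rho rho_sq by (auto simp: tt_def field_simps power2_eq_square)

text \<open>The Jacobian of an inverse branch of an iterate of the map is \<open>1 / D ^ DIM('a)\<close> for a
  positive semidefinite quadratic polynomial \<open>D\<close>; the last condition keeps its pole uniformly away from \<open>P\<close>.\<close>
definition good :: "'a set \<Rightarrow> real \<Rightarrow> 'a \<Rightarrow> real \<Rightarrow> bool" where
  "good P \<alpha> \<beta> \<gamma> \<longleftrightarrow> 0 \<le> \<alpha> \<and> \<beta> \<bullet> \<beta> \<le> \<alpha> * \<gamma> \<and>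
     (\<forall>y\<in>P. 0 < quad \<alpha> \<beta> \<gamma> y \<and> \<alpha> \<le> tt\<^sup>2 * quad \<alpha> \<beta> \<gamma> y)"

text \<open>The closure under pointwise limits serves twice: for the infinite sum over digits, and
  for the passage from the iterates to the density. Analyticity and stability under branches then
  follow by rule induction.\<close>

inductive gen :: "'a set \<Rightarrow> ('a \<Rightarrow> real) \<Rightarrow> bool" for P where
  gen_base: "good P \<alpha> \<beta> \<gamma> \<Longrightarrow> gen P (\<lambda>y. 1 / quad \<alpha> \<beta> \<gamma> y ^ DIM('a))"
| gen_zero: "gen P (\<lambda>_. 0)"
| gen_add: "gen P f \<Longrightarrow> gen P g \<Longrightarrow> gen P (\<lambda>y. f y + g y)"
| gen_scale: "0 \<le> k \<Longrightarrow> gen P f \<Longrightarrow> gen P (\<lambda>y. k * f y)"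
| gen_limit: "(\<And>n. gen P (F n)) \<Longrightarrow> (\<And>y. y \<in> P \<Longrightarrow> (\<lambda>n. F n y) \<longlonglongrightarrow> f y) \<Longrightarrow> gen P f"

lemma gen_cong: "gen P f \<Longrightarrow> (\<And>y. y \<in> P \<Longrightarrow> f y = g y) \<Longrightarrow> gen P g"
  by (rule gen_limit[of P "\<lambda>_. f"]) auto

text \<open>The squared norm on the left is
  \<open>\<alpha> * quad \<alpha> \<beta> \<gamma> x\<close> minus the nonnegative number
  \<open>\<alpha> * \<gamma> - \<beta> \<bullet> \<beta>\<close>.\<close>

lemma good_center:
  assumes "good P \<alpha> \<beta> \<gamma>" "x \<in> P"
  shows "norm (\<alpha> *\<^sub>R x + \<beta>) \<le> tt * quad \<alpha> \<beta> \<gamma> x"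
proof -
  let ?D = "quad \<alpha> \<beta> \<gamma> x"
  have g: "0 \<le> \<alpha>" "\<beta> \<bullet> \<beta> \<le> \<alpha> * \<gamma>" "0 < ?D" "\<alpha> \<le> tt\<^sup>2 * ?D" using assms by (auto simp: good_def)
  have "(norm (\<alpha> *\<^sub>R x + \<beta>))\<^sup>2 = \<alpha> * (\<alpha> * (x \<bullet> x) + 2 * (\<beta> \<bullet> x)) + \<beta> \<bullet> \<beta>"
    by (simp add: power2_norm_eq_inner inner_add_left inner_add_right inner_commute algebra_simps)
  also have "\<dots> \<le> \<alpha> * ?D" using g(2) by (simp add: quad_def algebra_simps)
  also have "\<dots> \<le> (tt\<^sup>2 * ?D) * ?D" using g by (intro mult_right_mono) auto
  also have "\<dots> = (tt * ?D)\<^sup>2" by (simp add: power2_eq_square)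
  finally show ?thesis by (rule power2_le_imp_le) (use tt(1) g in auto)
qed

lemma good_const: "good P 0 0 1"
  by (simp add: good_def quad_def)

text \<open>Clearing the denominator of the inversion exchanges \<open>\<alpha>\<close> and
  \<open>\<gamma>\<close>, and the translation follows. With \<open>x = \<iota> (y + a)\<close> and
  \<open>D\<close> the old value at \<open>x\<close>, expansion about \<open>x\<close> gives
  \<open>\<gamma> \<le> D * (1 + tt * norm x)\<^sup>2\<close>, while the new value at
  \<open>y\<close> is \<open>D / (norm x)\<^sup>2\<close>; the quotient is at most
  \<open>tt\<^sup>2\<close> by the choice of \<open>tt\<close>.\<close>

lemma good_branch:
  assumes g: "good P' \<alpha> \<beta> \<gamma>" and P: "\<And>y. y \<in> P \<Longrightarrow> y + a \<noteq> 0 \<and> \<iota> (y + a) \<in> P' \<and> norm (\<iota> (y + a)) \<le> \<rho>"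
    and ne: "P \<noteq> {}"
  shows "\<exists>\<alpha>' \<beta>' \<gamma>'. good P \<alpha>' \<beta>' \<gamma>' \<and>
    (\<forall>y\<in>P. quad \<alpha>' \<beta>' \<gamma>' y = quad \<alpha> \<beta> \<gamma> (\<iota> (y + a)) * (norm (y + a))\<^sup>2)"
proof -
  define \<beta>' where "\<beta>' = \<gamma> *\<^sub>R a + orth \<beta>"
  define \<gamma>' where "\<gamma>' = \<alpha> + 2 * (\<beta> \<bullet> orth a) + \<gamma> * (a \<bullet> a)"
  have g0: "0 \<le> \<alpha>" "\<beta> \<bullet> \<beta> \<le> \<alpha> * \<gamma>" using g by (auto simp: good_def)
  have eq: "quad \<gamma> \<beta>' \<gamma>' y = quad \<alpha> \<beta> \<gamma> (\<iota> (y + a)) * (norm (y + a))\<^sup>2" if y: "y + a \<noteq> 0" for y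
  proof -
    let ?w = "y + a"
    have i1: "\<iota> ?w \<bullet> \<iota> ?w = 1 / (norm ?w)\<^sup>2"
      using norm_inv[of ?w] by (simp add: power2_norm_eq_inner[symmetric] power_divide)
    have i2: "\<beta> \<bullet> \<iota> ?w = (\<beta> \<bullet> orth ?w) / (norm ?w)\<^sup>2"
      using inv_inner[of ?w \<beta>] orth_inner_swap[of ?w \<beta>] by (simp add: inner_commute)
    have q: "quad \<alpha> \<beta> \<gamma> (\<iota> ?w) * (norm ?w)\<^sup>2 = \<alpha> + 2 * (\<beta> \<bullet> orth ?w) + \<gamma> * (norm ?w)\<^sup>2"
      unfolding quad_def i1 i2 using y by (simp add: distrib_right)
    moreover have "\<beta> \<bullet> orth ?w = orth \<beta> \<bullet> y + \<beta> \<bullet> orth a"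
      using linear_orth by (simp add: linear_add inner_add_right orth_inner_swap)
    moreover have "(norm ?w)\<^sup>2 = y \<bullet> y + 2 * (a \<bullet> y) + a \<bullet> a"
      by (simp add: power2_norm_eq_inner inner_add_left inner_add_right inner_commute)
    ultimately have "quad \<gamma> \<beta>' \<gamma>' y = \<alpha> + 2 * (\<beta> \<bullet> orth ?w) + \<gamma> * (norm ?w)\<^sup>2"
      by (simp only:) (simp add: quad_def \<beta>'_def \<gamma>'_def inner_add_left algebra_simps)
    then show ?thesis using q by simp
  qed
  obtain y0 where y0: "y0 \<in> P" using ne by blast
  have \<gamma>: "0 \<le> \<gamma>"
  proof (cases "\<alpha> = 0")
    case True
    then have "\<beta> \<bullet> \<beta> = 0" using g0(2) inner_ge_zero[of \<beta>] by auto
    then have "\<beta> = 0" by simp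
    then show ?thesis using g P[OF y0] True by (force simp: good_def quad_def)
  next
    case False
    then show ?thesis using g0 order_trans[OF inner_ge_zero g0(2)] by (simp add: zero_le_mult_iff)
  qed
  have disc: "\<beta>' \<bullet> \<beta>' \<le> \<gamma> * \<gamma>'"
  proof -
    have "a \<bullet> orth \<beta> = \<beta> \<bullet> orth a" using orth_inner_swap[of a \<beta>] by (simp add: inner_commute)
    then have "\<beta>' \<bullet> \<beta>' = \<gamma> * (\<gamma> * (a \<bullet> a) + 2 * (\<beta> \<bullet> orth a)) + \<beta> \<bullet> \<beta>"
      by (simp add: \<beta>'_def inner_add_left inner_add_right orth_inner inner_commute algebra_simps)
    then show ?thesis using g0 by (simp add: \<gamma>'_def algebra_simps)
  qed
  have "0 < quad \<gamma> \<beta>' \<gamma>' y \<and> \<gamma> \<le> tt\<^sup>2 * quad \<gamma> \<beta>' \<gamma>' y" if y: "y \<in> P" for y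
  proof -
    let ?x = "\<iota> (y + a)"
    let ?D = "quad \<alpha> \<beta> \<gamma> ?x"
    have w: "y + a \<noteq> 0" "?x \<in> P'" "norm ?x \<le> \<rho>" using P[OF y] by auto
    have D: "0 < ?D" "\<alpha> \<le> tt\<^sup>2 * ?D" using g w by (auto simp: good_def)
    have pos: "0 < quad \<gamma> \<beta>' \<gamma>' y" using eq[OF w(1)] D w by simp
    have "\<gamma> = ?D - 2 * ((\<alpha> *\<^sub>R ?x + \<beta>) \<bullet> ?x) + \<alpha> * (?x \<bullet> ?x)"
      by (simp add: quad_def inner_add_left algebra_simps)
    also have "\<dots> \<le> ?D + 2 * (tt * ?D * norm ?x) + tt\<^sup>2 * ?D * (?x \<bullet> ?x)"
    proof -
      have "\<bar>(\<alpha> *\<^sub>R ?x + \<beta>) \<bullet> ?x\<bar> \<le> norm (\<alpha> *\<^sub>R ?x + \<beta>) * norm ?x" by (rule Cauchy_Schwarz_ineq2)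
      also have "\<dots> \<le> tt * ?D * norm ?x" using good_center[OF g w(2)] by (intro mult_right_mono) auto
      finally have "- ((\<alpha> *\<^sub>R ?x + \<beta>) \<bullet> ?x) \<le> tt * ?D * norm ?x" by linarith
      moreover have "\<alpha> * (?x \<bullet> ?x) \<le> tt\<^sup>2 * ?D * (?x \<bullet> ?x)" using D by (intro mult_right_mono) auto
      ultimately show ?thesis by linarith
    qed
    also have "\<dots> = ?D * (1 + tt * norm ?x)\<^sup>2"
      by (simp add: power2_norm_eq_inner[symmetric] power2_eq_square algebra_simps)
    also have "\<dots> = ?D * (norm (y + a))\<^sup>2 * (norm ?x * (1 + tt * norm ?x))\<^sup>2"
      using w(1) by (simp add: norm_inv power_mult_distrib power_divide)
    also have "\<dots> \<le> ?D * (norm (y + a))\<^sup>2 * tt\<^sup>2"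
    proof (intro mult_left_mono power_mono)
      have "norm ?x * (1 + tt * norm ?x) \<le> \<rho> * (1 + tt * \<rho>)"
        using w tt(1) rho by (intro mult_mono add_left_mono mult_left_mono) auto
      then show "norm ?x * (1 + tt * norm ?x) \<le> tt" by (simp only: tt(2))
    qed (use D tt(1) in auto)
    also have "\<dots> = tt\<^sup>2 * quad \<gamma> \<beta>' \<gamma>' y" using eq[OF w(1)] by simp
    finally show ?thesis using pos by simp
  qed
  then have "good P \<gamma> \<beta>' \<gamma>'" using \<gamma> disc by (simp add: good_def)
  moreover have "\<forall>y\<in>P. quad \<gamma> \<beta>' \<gamma>' y = quad \<alpha> \<beta> \<gamma> (\<iota> (y + a)) * (norm (y + a))\<^sup>2" using eq P by blast
  ultimately show ?thesis by blast
qed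

lemma gen_branch:
  assumes "gen P' f" and P: "\<And>y. y \<in> P \<Longrightarrow> y + a \<noteq> 0 \<and> \<iota> (y + a) \<in> P' \<and> norm (\<iota> (y + a)) \<le> \<rho>"
    and ne: "P \<noteq> {}"
  shows "gen P (\<lambda>y. f (\<iota> (y + a)) * (1 / norm (y + a) ^ (2 * DIM('a))))"
  using assms(1)
proof induction
  case (gen_base \<alpha> \<beta> \<gamma>)
  obtain \<alpha>' \<beta>' \<gamma>' where g: "good P \<alpha>' \<beta>' \<gamma>'"
    "\<And>y. y \<in> P \<Longrightarrow> quad \<alpha>' \<beta>' \<gamma>' y = quad \<alpha> \<beta> \<gamma> (\<iota> (y + a)) * (norm (y + a))\<^sup>2"
    using good_branch[OF gen_base P ne] by blast
  show ?case
    by (rule gen_cong[OF gen.gen_base[OF g(1)]]) (simp add: g(2) power_mult_distrib power_mult)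
next
  case gen_zero
  show ?case using gen.gen_zero by simp
next
  case (gen_add f g)
  show ?case using gen.gen_add[OF gen_add.IH] by (simp only: distrib_right)
next
  case (gen_scale k f)
  show ?case using gen.gen_scale[OF gen_scale(1) gen_scale.IH] by (simp only: mult.assoc)
next
  case (gen_limit F f)
  show ?case
  proof (rule gen.gen_limit[OF gen_limit.IH])
    fix y assume "y \<in> P"
    then have "\<iota> (y + a) \<in> P'" using P by blast
    then show "(\<lambda>n. F n (\<iota> (y + a)) * (1 / norm (y + a) ^ (2 * DIM('a)))) \<longlonglongrightarrow>
        f (\<iota> (y + a)) * (1 / norm (y + a) ^ (2 * DIM('a)))"
      using gen_limit by (intro tendsto_mult tendsto_const) auto
  qed
qed

text \<open>After division by its value at \<open>x\<close> every admissible polynomial reads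
  \<open>1 + 2 * (b \<bullet> v) + c * (v \<bullet> v)\<close> with \<open>norm b \<le> tt\<close>
  and \<open>c \<le> tt\<^sup>2\<close>. One radius and one constant therefore serve for all of
  them.\<close>

lemma gen_majorised:
  assumes "gen P f" and x: "x \<in> P" and s: "0 < s" "ball x s \<subseteq> P"
    and small: "real DIM('a) * (2 * tt * s + tt\<^sup>2 * s\<^sup>2) \<le> 1/2"
    and S: "S = (\<Sum>n. \<bar>(- real DIM('a)) gchoose n\<bar> * (1/2) ^ n)" "0 \<le> S"
  shows "majorised s S x f"
  using assms(1)
proof induction
  case (gen_base \<alpha> \<beta> \<gamma>)
  let ?D = "quad \<alpha> \<beta> \<gamma>"
  have D: "0 < ?D x" "\<alpha> \<le> tt\<^sup>2 * ?D x" "0 \<le> \<alpha>" using gen_base x by (auto simp: good_def)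
  define b where "b = (\<alpha> *\<^sub>R x + \<beta>) /\<^sub>R ?D x"
  define c where "c = \<alpha> / ?D x"
  have "norm b = norm (\<alpha> *\<^sub>R x + \<beta>) / ?D x" using D by (simp add: b_def divide_inverse mult.commute)
  also have "\<dots> \<le> tt" using good_center[OF gen_base x] D by (simp add: pos_divide_le_eq)
  finally have b: "norm b \<le> tt" .
  have c: "0 \<le> c" "c \<le> tt\<^sup>2" using D by (auto simp: c_def pos_divide_le_eq)
  obtain e where e: "\<And>\<alpha>. \<bar>e \<alpha>\<bar> \<le> S / s ^ mdeg \<alpha>"
    "\<And>v. norm v \<le> s \<Longrightarrow> ((\<lambda>\<alpha>. e \<alpha> * monomial \<alpha> v) has_sum (1 + 2 * (b \<bullet> v) + c * (v \<bullet> v)) powr (- real DIM('a))) multi_indices"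
    using power_series_of_quadratic_powr[OF s(1) b c small, of "- real DIM('a)"] S(1) by blast
  let ?q = "1 / ?D x ^ DIM('a)"
  have q: "0 \<le> ?q" using D by simp
  show ?case unfolding majorised_def
  proof (intro conjI exI[of _ "\<lambda>\<alpha>. ?q * e \<alpha>"] allI ballI)
    show "\<bar>?q * e \<alpha>\<bar> \<le> ?q * S / s ^ mdeg \<alpha>" for \<alpha>
      using mult_left_mono[OF e(1)[of \<alpha>] q] q by (simp add: abs_mult)
    fix y assume y: "y \<in> ball x (s/2)"
    let ?v = "y - x"
    have "y \<in> P" using y s by auto
    then have Dy: "0 < ?D y" using gen_base by (auto simp: good_def)
    have "?D y = ?D x + 2 * ((\<alpha> *\<^sub>R x + \<beta>) \<bullet> ?v) + \<alpha> * (?v \<bullet> ?v)"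
      by (simp add: quad_def inner_add_left inner_diff_left inner_diff_right inner_commute algebra_simps)
    also have "\<dots> = ?D x * (1 + 2 * (b \<bullet> ?v) + c * (?v \<bullet> ?v))"
    proof -
      have "?D x * (b \<bullet> ?v) = (\<alpha> *\<^sub>R x + \<beta>) \<bullet> ?v" unfolding b_def inner_scaleR_left using D by simp
      moreover have "?D x * c = \<alpha>" using D by (simp add: c_def)
      moreover have "?D x * (1 + 2 * (b \<bullet> ?v) + c * (?v \<bullet> ?v)) = ?D x + 2 * (?D x * (b \<bullet> ?v)) + (?D x * c) * (?v \<bullet> ?v)"
        by (simp add: distrib_left mult_ac)
      ultimately show ?thesis by simp
    qed
    finally have Deq: "?D y = ?D x * (1 + 2 * (b \<bullet> ?v) + c * (?v \<bullet> ?v))" .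
    then have pos: "0 < 1 + 2 * (b \<bullet> ?v) + c * (?v \<bullet> ?v)" using Dy D by (simp add: zero_less_mult_iff)
    have "norm ?v \<le> s" using y s(1) by (simp add: dist_norm norm_minus_commute)
    then have "((\<lambda>\<alpha>. ?q * (e \<alpha> * monomial \<alpha> ?v)) has_sum
        ?q * (1 + 2 * (b \<bullet> ?v) + c * (?v \<bullet> ?v)) powr (- real DIM('a))) multi_indices"
      by (intro has_sum_cmult_right e(2))
    moreover have "?q * (1 + 2 * (b \<bullet> ?v) + c * (?v \<bullet> ?v)) powr (- real DIM('a)) = 1 / ?D y ^ DIM('a)"
      unfolding Deq using pos by (simp add: powr_minus powr_realpow power_mult_distrib divide_inverse)
    ultimately show "((\<lambda>\<alpha>. ?q * e \<alpha> * monomial \<alpha> ?v) has_sum 1 / ?D y ^ DIM('a)) multi_indices"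
      by (simp only: mult.assoc)
  qed (use q in auto)
next
  case gen_zero
  show ?case using s S by (intro majorised_0)
next
  case (gen_add f g)
  then show ?case by (intro majorised_add)
next
  case (gen_scale k f)
  then show ?case by (intro majorised_scale)
next
  case (gen_limit F f)
  show ?case
  proof (rule majorised_limit[OF s(1) S(2) gen_limit.IH])
    fix y assume "y \<in> ball x (s/2)"
    then have "y \<in> P" using s by auto
    then show "(\<lambda>n. F n y) \<longlonglongrightarrow> f y" by (rule gen_limit(2))
  qed
qed

lemma gen_analytic:
  assumes "gen P f" "open P" shows "real_analytic_on f P"
  unfolding real_analytic_on_def
proof
  fix x assume x: "x \<in> P"
  obtain e where e: "e > 0" "ball x e \<subseteq> P" using assms(2) x openE by blast
  define S where "S = (\<Sum>n. \<bar>(- real DIM('a)) gchoose n\<bar> * (1/2) ^ n)"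
  \<comment> \<open>With the empty alphabet the binomial lemma bounds a nonnegative sum by
    \<open>S\<close>.\<close>
  have S: "0 \<le> S"
  proof -
    let ?F = "\<lambda>l. \<bar>((- real DIM('a)) gchoose length l) * prod_list (map (\<lambda>_::nat. 0) l)\<bar>"
    have "infsum ?F {l. set l \<subseteq> {}} \<le> S" unfolding S_def by (rule has_sum_binomial_lists(2)[of _ _ "\<lambda>_. 0"]) auto
    moreover have "0 \<le> infsum ?F {l. set l \<subseteq> {}}" by (rule infsum_nonneg) simp
    ultimately show ?thesis by linarith
  qed
  \<comment> \<open>With \<open>u = tt * s\<close> this gives
    \<open>real DIM('a) * u \<le> 1/8\<close>, so the sum in \<open>small\<close> is at most 1/4 +
    1/64.\<close>
  define s where "s = min e (1 / (8 * real DIM('a) * (tt + 1)\<^sup>2))"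
  have d1: "real DIM('a) \<ge> 1" using DIM_positive[where 'a='a] by linarith
  have t1: "(tt + 1)\<^sup>2 > 0" using tt(1) by (intro zero_less_power) linarith
  have s: "0 < s" "ball x s \<subseteq> P" using e t1 d1 by (auto simp: s_def)
  have small: "real DIM('a) * (2 * tt * s + tt\<^sup>2 * s\<^sup>2) \<le> 1/2"
  proof -
    define u where "u = tt * s"
    have u0: "0 \<le> u" using tt(1) s by (simp add: u_def)
    have "s \<le> 1 / (8 * real DIM('a) * (tt + 1)\<^sup>2)" by (simp add: s_def)
    then have "real DIM('a) * s * (tt + 1)\<^sup>2 \<le> 1 / 8" using d1 t1 by (simp add: pos_le_divide_eq mult_ac)
    moreover have "real DIM('a) * s * tt \<le> real DIM('a) * s * (tt + 1)\<^sup>2"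
      using tt(1) s d1 by (intro mult_left_mono) (auto simp: power2_eq_square algebra_simps)
    ultimately have du: "real DIM('a) * u \<le> 1 / 8" by (simp add: u_def mult_ac)
    moreover have "1 * u \<le> real DIM('a) * u" using d1 u0 by (intro mult_right_mono)
    ultimately have "u \<le> 1 / 8" by linarith
    then have "(real DIM('a) * u) * u \<le> 1 / 8 * (1 / 8)" using du u0 d1 by (intro mult_mono) auto
    moreover have "real DIM('a) * (2 * tt * s + tt\<^sup>2 * s\<^sup>2) = 2 * (real DIM('a) * u) + (real DIM('a) * u) * u"
      by (simp add: u_def power2_eq_square algebra_simps)
    ultimately show ?thesis using du by linarith
  qed
  have "majorised s S x f" by (rule gen_majorised[OF assms(1) x s small S_def S])
  then obtain c where "\<forall>y\<in>ball x (s/2). ((\<lambda>\<alpha>. c \<alpha> * monomial \<alpha> (y - x)) has_sum f y) multi_indices"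
    unfolding majorised_def by blast
  then show "\<exists>r>0. \<exists>c. \<forall>y\<in>ball x r. ((\<lambda>\<alpha>. c \<alpha> * (\<Prod>b\<in>Basis. ((y - x) \<bullet> b) ^ \<alpha> b)) has_sum f y) {\<alpha>. \<forall>b. b \<notin> Basis \<longrightarrow> \<alpha> b = 0}"
    using s(1) unfolding monomial_def multi_indices_def by (intro exI[of _ "s/2"] conjI exI[of _ c]) auto
qed

lemma infinite_Z: "infinite Z"
proof -
  obtain u where u: "u \<in> units" using units_ne by blast
  have "u \<noteq> 0" using unitsD(2)[OF u] by auto
  then have "inj (\<lambda>n::nat. real n *\<^sub>R u)" by (auto simp: inj_on_def)
  then have "infinite (range (\<lambda>n::nat. real n *\<^sub>R u))" by (rule range_inj_infinite)
  moreover have "range (\<lambda>n::nat. real n *\<^sub>R u) \<subseteq> Z" using Z_scaleR_nat[OF unitsD(1)[OF u]] by auto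
  ultimately show ?thesis using finite_subset by blast
qed

text \<open>On a cell a digit is either never admissible, and its branch vanishes, or it sends the
  cell into a single cell, and the branch stays in the class. The sum over an enumeration of the
  digits is the limit of its partial sums.\<close>

lemma gen_transfer:
  assumes f: "\<And>x. x \<in> K0 \<Longrightarrow> gen (cell x) (\<lambda>y. enn2real (f y))"
    and fin: "\<And>y. y \<in> K0 \<Longrightarrow> transfer f y < \<infinity>" and x: "x \<in> K0"
  shows "gen (cell x) (\<lambda>y. enn2real (transfer f y))"
proof -
  define a where "a = from_nat_into Z"
  have a: "bij_betw a UNIV Z" unfolding a_def using countable_Z infinite_Z by (rule bij_betw_from_nat_into)
  then have aZ: "a n \<in> Z" for n by (auto simp: bij_betw_def)
  have tr: "transfer f y = (\<Sum>n. branch (a n) f y)" for y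
    unfolding transfer_def using nn_integral_bij_count_space[OF a, of "\<lambda>a. branch a f y"]
    by (simp add: nn_integral_count_space_nat)
  have br: "gen (cell x) (\<lambda>y. enn2real (branch (a n) f y))" for n
  proof (cases "\<iota> (x + a n) \<in> K0")
    case True
    have P: "y + a n \<noteq> 0 \<and> \<iota> (y + a n) \<in> cell (\<iota> (x + a n)) \<and> norm (\<iota> (y + a n)) \<le> \<rho>" if "y \<in> cell x" for y
    proof -
      have y: "y \<in> K0" "sim x y" using that by (auto simp: cell_def)
      have "\<iota> (x + a n) \<in> K" using True K0_subset_K by auto
      then show ?thesis using branch_sim[OF x y aZ] K0_add_ne_0[OF y(1) aZ] norm_K0 by (auto simp: cell_def)
    qed
    have "gen (cell x) (\<lambda>y. enn2real (f (\<iota> (y + a n))) * (1 / norm (y + a n) ^ (2 * DIM('a))))"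
      using in_cell[OF x] by (intro gen_branch[OF f[OF True] P]) auto
    then show ?thesis
    proof (rule gen_cong)
      fix y assume y: "y \<in> cell x"
      then have "y \<in> K0" "\<iota> (y + a n) \<in> K0" using P[OF y] cell_subset by auto
      then show "enn2real (f (\<iota> (y + a n))) * (1 / norm (y + a n) ^ (2 * DIM('a))) = enn2real (branch (a n) f y)"
        by (simp add: branch_def enn2real_mult jac_def)
    qed
  next
    case False
    have "branch (a n) f y = 0" if "y \<in> cell x" for y
    proof -
      have y: "y \<in> K0" "sim x y" using that by (auto simp: cell_def)
      then have "\<iota> (y + a n) \<notin> K0" using branch_sim(1)[OF y(1) x sim_sym[OF y(2)] aZ] False K0_subset_K by blast
      then show ?thesis by (simp add: branch_def)
    qed
    then show ?thesis by (intro gen_cong[OF gen_zero]) simp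
  qed
  have part: "gen (cell x) (\<lambda>y. \<Sum>n<N. enn2real (branch (a n) f y))" for N
  proof (induction N)
    case 0
    show ?case using gen_zero by simp
  next
    case (Suc N)
    show ?case using gen_add[OF Suc br[of N]] by simp
  qed
  show ?thesis
  proof (rule gen_limit[OF part])
    fix y assume "y \<in> cell x"
    then have y: "y \<in> K0" using cell_subset by auto
    have "(\<lambda>n. branch (a n) f y) sums transfer f y" unfolding tr by (rule summable_sums) simp
    then have "(\<lambda>N. \<Sum>n<N. branch (a n) f y) \<longlonglongrightarrow> transfer f y" by (simp add: sums_def)
    then have "(\<lambda>N. enn2real (\<Sum>n<N. branch (a n) f y)) \<longlonglongrightarrow> enn2real (transfer f y)"
      using fin[OF y] by (intro tendsto_enn2real) auto
    moreover have "enn2real (\<Sum>n<N. branch (a n) f y) = (\<Sum>n<N. enn2real (branch (a n) f y))" for N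
    proof (induction N)
      case (Suc N)
      have "(\<Sum>n<N. branch (a n) f y) \<le> transfer f y" unfolding tr by (rule sum_le_suminf) auto
      moreover have "branch (a N) f y \<le> transfer f y" unfolding transfer_def by (rule nn_integral_ge_point[OF aZ])
      ultimately have "(\<Sum>n<N. branch (a n) f y) < top" "branch (a N) f y < top"
        using fin[OF y] le_less_trans[of _ "transfer f y" top] by (simp_all only: infinity_ennreal_def)
      then show ?case using Suc by (simp add: enn2real_plus)
    qed simp
    ultimately show "(\<lambda>N. \<Sum>n<N. enn2real (branch (a n) f y)) \<longlonglongrightarrow> enn2real (transfer f y)" by simp
  qed
qed

lemma gen_hn: "x \<in> K0 \<Longrightarrow> gen (cell x) (hn n)"
proof -
  have fin: "(transfer ^^ n) f0 y < \<infinity>" if "y \<in> K0" for n y using hn_eq[OF that, of n] by simp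
  have "gen (cell x) (\<lambda>y. enn2real ((transfer ^^ n) f0 y))" if "x \<in> K0" for x
    using that
  proof (induction n arbitrary: x)
    case 0
    have "gen (cell x) (\<lambda>y. (1 / vol) * (1 / quad 0 0 1 y ^ DIM('a)))"
      using vol by (intro gen_scale gen_base good_const) auto
    then show ?case using vol by (simp add: quad_def f0_def)
  next
    case (Suc n)
    show ?case using gen_transfer[OF Suc.IH _ Suc.prems] fin[of _ "Suc n"] by simp
  qed
  then show "x \<in> K0 \<Longrightarrow> gen (cell x) (hn n)" by (simp add: hn_def[abs_def])
qed

lemma dens_analytic: "x \<in> K0 \<Longrightarrow> real_analytic_on dens (cell x)"
proof -
  assume x: "x \<in> K0"
  have "gen (cell x) dens"
    using hn_tendsto cell_subset by (intro gen_limit[of "cell x" hn dens] gen_hn[OF x]) auto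
  then show ?thesis using open_cell'[OF x] by (rule gen_analytic)
qed

end

section \<open>Cylinders and the invariant measure\<close>

lemma borel_measurable_lebesgue_AE_cong:
  fixes f g :: "'a::euclidean_space \<Rightarrow> real"
  assumes f: "f \<in> borel_measurable lebesgue" and ae: "AE x in lebesgue. f x = g x"
  shows "g \<in> borel_measurable lebesgue"
proof (rule measurableI)
  fix A :: "real set" assume A: "A \<in> sets borel"
  have m: "f -` A \<inter> space lebesgue \<in> sets lebesgue" using f A by (rule measurable_sets)
  have e: "AE x in lebesgue. x \<in> f -` A \<inter> space lebesgue \<longleftrightarrow> x \<in> g -` A \<inter> space lebesgue"
    using ae by eventually_elim auto
  show "g -` A \<inter> space lebesgue \<in> sets lebesgue" by (rule completion.in_sets_AE[OF e m]) simp
qed auto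

context cf_lattice
begin

section \<open>Cylinders, digits and images of cylinders\<close>

abbreviation cyl :: "'a list \<Rightarrow> 'a set" where "cyl \<equiv> cylinder K \<iota>"

lemma cyl_subset: "cyl s \<subseteq> K"
  by (cases s) auto

lemma cyl_Cons: "a \<in> Z \<Longrightarrow> cyl (a # s) = {x \<in> K. nearest Z K (\<iota> x) = a \<and> T x \<in> cyl s}"
proof -
  assume a: "a \<in> Z"
  show ?thesis
  proof (intro set_eqI iffI)
    fix x assume "x \<in> cyl (a # s)"
    then obtain y where y: "x \<in> K" "y \<in> cyl s" "x = \<iota> (y + a)" by auto
    then have ix: "\<iota> x = y + a" by simp
    have "y \<in> K" using y cyl_subset by auto
    then have "nearest Z K (\<iota> x) = a" unfolding ix using a by (intro nearest_eqI) auto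
    moreover from this have "T x = y" unfolding T_eq red_def ix by simp
    ultimately show "x \<in> {x \<in> K. nearest Z K (\<iota> x) = a \<and> T x \<in> cyl s}" using y by simp
  next
    fix x assume x: "x \<in> {x \<in> K. nearest Z K (\<iota> x) = a \<and> T x \<in> cyl s}"
    then have "x = \<iota> (T x + a)" by (auto simp: T_eq red_def)
    then show "x \<in> cyl (a # s)" using x by auto
  qed
qed

lemma sets_cyl [measurable]: "cyl s \<in> sets lebesgue"
proof (induction s)
  case (Cons a s)
  have "(\<lambda>y. y + a) ` cyl s = (+) a ` cyl s" by (auto simp: add.commute)
  then have "(\<lambda>y. y + a) ` cyl s \<in> sets lebesgue" using Cons lebesgue_sets_translation by metis
  then have "\<iota> ` ((\<lambda>y. y + a) ` cyl s) \<in> sets lebesgue" by (rule sets_lebesgue_inv_image)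
  then show ?case by (simp add: sets.Int)
qed simp

fun digits :: "nat \<Rightarrow> 'a \<Rightarrow> 'a list" where
  "digits 0 x = []"
| "digits (Suc n) x = nearest Z K (\<iota> x) # digits n (T x)"

lemma length_digits [simp]: "length (digits n x) = n"
  by (induction n arbitrary: x) auto

lemma set_digits: "set (digits n x) \<subseteq> Z"
  by (induction n arbitrary: x) (auto simp: nearest)

lemma in_cyl_iff: "set s \<subseteq> Z \<Longrightarrow> x \<in> cyl s \<longleftrightarrow> x \<in> K \<and> digits (length s) x = s"
proof (induction s arbitrary: x)
  case (Cons a s)
  then show ?case using cyl_Cons[of a s] T_in_K by auto
qed simp

lemma in_cyl_digits: "x \<in> K \<Longrightarrow> x \<in> cyl (digits n x)"
  using in_cyl_iff[OF set_digits] by simp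

lemma take_digits: "take n (digits (Suc n) x) = digits n x"
  by (induction n arbitrary: x) auto

text \<open>Points with equal first digit satisfy
  \<open>dist x y = norm x * norm y * dist (T x) (T y)\<close> away from 0, which gains a factor
  \<open>\<rho>\<^sup>2\<close> per digit; 2 bounds the diameter of \<open>K\<close>.\<close>

lemma dist_cyl: "set s \<subseteq> Z \<Longrightarrow> x \<in> cyl s \<Longrightarrow> y \<in> cyl s \<Longrightarrow> dist x y \<le> 2 * (\<rho>\<^sup>2) ^ length s"
proof (induction s arbitrary: x y)
  case Nil
  then show ?case using norm_K[of x] norm_K[of y] rho norm_triangle_ineq4[of x y] by (simp add: dist_norm)
next
  case (Cons a s)
  have x: "x \<in> K" "nearest Z K (\<iota> x) = a" "T x \<in> cyl s" using Cons.prems cyl_Cons[of a s] by auto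
  have y: "y \<in> K" "nearest Z K (\<iota> y) = a" "T y \<in> cyl s" using Cons.prems cyl_Cons[of a s] by auto
  \<comment> \<open>The point 0 escapes the distance formula. In \<open>K\<close> the digit 0 occurs
    only there, since a nonzero point has an image of norm at least \<open>1 / \<rho>\<close>, which
    lies outside \<open>K\<close>.\<close>
  have a0: "v = 0" if "v \<in> K" "nearest Z K (\<iota> v) = 0" for v
  proof (rule ccontr)
    assume "v \<noteq> 0"
    have "\<iota> v \<in> K" using nearest(2)[of "\<iota> v"] that by simp
    then have "1 / norm v \<le> \<rho>" using norm_K norm_inv by metis
    then have "1 \<le> \<rho> * norm v" using \<open>v \<noteq> 0\<close> by (simp add: field_simps)
    also have "\<dots> \<le> \<rho> * \<rho>" using norm_K[OF that(1)] rho by (intro mult_left_mono) auto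
    finally show False using rho_sq by (simp add: power2_eq_square)
  qed
  show ?case
  proof (cases "x = 0 \<or> y = 0")
    case True
    then have "a = 0" using x y nearest_eqI[of 0 0] zero_in_K by auto
    then have "x = 0" "y = 0" using a0 x y by auto
    then show ?thesis by simp
  next
    case False
    have "dist (T x) (T y) = dist (\<iota> x) (\<iota> y)" using x y by (simp add: T_eq red_def dist_norm)
    also have "\<dots> = dist x y / (norm x * norm y)" using False by (intro dist_inv) auto
    finally have "dist x y = norm x * norm y * dist (T x) (T y)" using False by (simp add: field_simps)
    also have "\<dots> \<le> (\<rho> * \<rho>) * (2 * (\<rho>\<^sup>2) ^ length s)"
      using norm_K x y rho Cons.IH[of "T x" "T y"] Cons.prems by (intro mult_mono) auto
    finally show ?thesis by (simp add: power2_eq_square mult_ac)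
  qed
qed

text \<open>Only generic points are tested; on the null set outside \<open>K0\<close> the set is
  arbitrary.\<close>

definition cellular :: "'a set \<Rightarrow> bool" where
  "cellular W \<longleftrightarrow> (\<forall>y\<in>K0. \<forall>y'\<in>K0. sim y y' \<longrightarrow> y \<in> W \<longrightarrow> y' \<in> W)"

text \<open>The set \<open>W\<close> makes the induction possible: it records the constraints
  imposed by digits already removed, and \<open>branch_sim\<close> keeps it compatible with the
  cells. The whole cylinder is the case where \<open>W\<close> is everything.\<close>

lemma cellular_image:
  "set s \<subseteq> Z \<Longrightarrow> cellular W \<Longrightarrow> cellular ((T ^^ length s) ` (cyl s \<inter> W))"
proof (induction s arbitrary: W)
  case Nil
  have "(T ^^ length []) ` (cyl [] \<inter> W) = K \<inter> W" by simp
  moreover have "cellular (K \<inter> W)" using Nil K0_subset_K unfolding cellular_def by blast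
  ultimately show ?case by metis
next
  case (Cons a s)
  define Wa where "Wa = {y \<in> K. \<iota> (y + a) \<in> K \<inter> W}"
  have a: "a \<in> Z" using Cons.prems by simp
  have "T ` (cyl (a # s) \<inter> W) = cyl s \<inter> Wa"
  proof (intro set_eqI iffI)
    fix y assume "y \<in> T ` (cyl (a # s) \<inter> W)"
    then obtain x where x: "y = T x" "x \<in> K" "nearest Z K (\<iota> x) = a" "T x \<in> cyl s" "x \<in> W"
      using cyl_Cons[OF a] by auto
    then have "\<iota> (y + a) = x" by (simp add: T_eq red_def)
    then show "y \<in> cyl s \<inter> Wa" using x T_in_K by (simp add: Wa_def)
  next
    fix y assume y: "y \<in> cyl s \<inter> Wa"
    then have "nearest Z K (y + a) = a" using a by (intro nearest_eqI) (auto simp: Wa_def)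
    then have "T (\<iota> (y + a)) = y" by (simp add: T_eq red_def)
    moreover have "\<iota> (y + a) \<in> cyl (a # s) \<inter> W" using y by (auto simp: Wa_def)
    ultimately show "y \<in> T ` (cyl (a # s) \<inter> W)" by (metis imageI)
  qed
  then have "(T ^^ length (a # s)) ` (cyl (a # s) \<inter> W) = (T ^^ length s) ` (cyl s \<inter> Wa)"
    by (simp only: length_Cons funpow_Suc_right image_comp[symmetric])
  moreover have "cellular Wa"
    unfolding cellular_def
  proof (intro ballI impI)
    fix y y' assume y: "y \<in> K0" "y' \<in> K0" "sim y y'" "y \<in> Wa"
    then have yK: "\<iota> (y + a) \<in> K" "\<iota> (y + a) \<in> W" by (auto simp: Wa_def)
    note b = branch_sim[OF y(1-3) a yK(1)]
    have "\<iota> (y' + a) \<in> W" using Cons.prems(2) branch_in_K0[OF y(1) a yK(1)] b yK unfolding cellular_def by blast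
    then show "y' \<in> Wa" using b y K0_subset_K by (auto simp: Wa_def)
  qed
  ultimately show ?case using Cons by simp
qed

lemma cellular_eq_Union: "cellular W \<Longrightarrow> W \<inter> K0 = \<Union> (cell ` (W \<inter> K0))"
  using in_cell cell_subset unfolding cellular_def cell_def by blast

section \<open>The invariant measure and uniform mixing\<close>

definition Mu :: "'a measure" where
  "Mu = density (restrict_space lebesgue K) (\<lambda>x. ennreal (dens x))"

lemma space_Mu [simp]: "space Mu = K" and sets_Mu: "sets Mu = sets (restrict_space lebesgue K)"
  by (auto simp: Mu_def space_restrict_space)

lemma sets_Mu_iff: "E \<in> sets Mu \<longleftrightarrow> E \<subseteq> K \<and> E \<in> sets lebesgue"
  unfolding sets_Mu by (rule sets_restrict_space_iff) (use sets_K in simp)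

lemma emeasure_Mu:
  assumes "E \<in> sets Mu" shows "emeasure Mu E = (\<integral>\<^sup>+x\<in>E. ennreal (dens x) \<partial>lebesgue)"
proof -
  have E: "E \<subseteq> K" "E \<in> sets lebesgue" using assms sets_Mu_iff by auto
  have dm: "(\<lambda>x. ennreal (dens x)) \<in> borel_measurable (restrict_space lebesgue K)"
    by (intro measurable_restrict_space1) measurable
  have "emeasure Mu E = (\<integral>\<^sup>+x\<in>E. ennreal (dens x) \<partial>restrict_space lebesgue K)"
    unfolding Mu_def using dm assms by (intro emeasure_density) (auto simp: sets_Mu)
  also have "\<dots> = (\<integral>\<^sup>+x\<in>K. ennreal (dens x) * indicator E x \<partial>lebesgue)"
    by (intro nn_integral_restrict_space) (use sets_K in simp)
  also have "\<dots> = (\<integral>\<^sup>+x\<in>E. ennreal (dens x) \<partial>lebesgue)"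
    using E by (intro nn_integral_cong) (auto split: split_indicator)
  finally show ?thesis .
qed

lemma emeasure_Mu_K0:
  assumes "E \<in> sets Mu"
  shows "emeasure Mu E = (\<integral>\<^sup>+x\<in>K0. ennreal (dens x) * indicator E x \<partial>lebesgue)"
  unfolding emeasure_Mu[OF assms] using sets_Mu_iff assms
  by (intro nn_integral_cong) (auto simp: dens_def split: split_indicator)

lemma prob_space_Mu: "prob_space Mu"
proof
  have "K \<in> sets Mu" using sets_Mu_iff sets_K by auto
  then show "emeasure Mu (space Mu) = 1"
    using emeasure_Mu[of K] nn_integral_K_eq_K0 mass_dens by (simp add: mass_def)
qed

sublocale P: prob_space Mu by (rule prob_space_Mu)

lemma null_Mu_iff: "E \<in> sets Mu \<Longrightarrow> emeasure Mu E = 0 \<longleftrightarrow> E \<in> null_sets lebesgue"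
proof
  assume E: "E \<in> sets Mu"
  have EK: "E \<subseteq> K" "E \<in> sets lebesgue" using E sets_Mu_iff by auto
  show "E \<in> null_sets lebesgue" if z: "emeasure Mu E = 0"
  proof -
    obtain \<eta> where \<eta>: "\<eta> > 0" "\<And>y. y \<in> K0 \<Longrightarrow> \<eta> \<le> dens y" using dens_lower by blast
    have "ennreal \<eta> * emeasure lebesgue (E \<inter> K0) = (\<integral>\<^sup>+x. ennreal \<eta> * indicator (E \<inter> K0) x \<partial>lebesgue)"
      using EK by (simp add: nn_integral_cmult_indicator sets.Int)
    also have "\<dots> \<le> emeasure Mu E" unfolding emeasure_Mu[OF E]
      using \<eta> by (intro nn_integral_mono) (auto split: split_indicator intro!: ennreal_leI)
    finally have "emeasure lebesgue (E \<inter> K0) = 0" using z \<eta> by (simp add: ennreal_eq_0_iff)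
    then have "E \<inter> K0 \<in> null_sets lebesgue" using EK by (auto simp: null_sets_def sets.Int)
    then have "negligible (E \<inter> K0)" by (simp add: negligible_iff_null_sets)
    then have "negligible ((E \<inter> K0) \<union> (K - K0))" using negligible_K_diff_K0 by (rule negligible_Un)
    then have "negligible E" by (rule negligible_subset) (use EK in auto)
    then show ?thesis by (simp add: negligible_iff_null_sets)
  qed
  show "emeasure Mu E = 0" if "E \<in> null_sets lebesgue"
    unfolding emeasure_Mu[OF E] using that AE_not_in[OF that]
    by (subst nn_integral_0_iff_AE) (auto split: split_indicator elim: eventually_mono)
qed

lemma measurable_T_Mu [measurable]: "T \<in> measurable Mu Mu"
proof -
  have "T \<in> measurable (restrict_space lebesgue K) (restrict_space lebesgue K)"
    using T_in_K by (intro measurable_restrict_space2 measurable_restrict_space1 measurable_T) auto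
  then show ?thesis by (simp add: measurable_def sets_Mu space_restrict_space)
qed

lemma T_pow_measurable [measurable]: "(T ^^ n) \<in> measurable lebesgue lebesgue"
  by (rule measurable_compose_n) (rule measurable_T)

lemma sets_Mu_preimage: "E \<in> sets Mu \<Longrightarrow> (T ^^ n) -` E \<inter> K \<in> sets Mu"
  unfolding sets_Mu_iff using measurable_sets[OF T_pow_measurable, of E n] sets_K by (auto simp: sets.Int)

lemma emeasure_Mu_cyl:
  assumes "C \<in> sets Mu" "E \<in> sets Mu"
  shows "emeasure Mu (C \<inter> ((T ^^ n) -` E \<inter> K)) =
    (\<integral>\<^sup>+y\<in>K0. (transfer ^^ n) (\<lambda>x. indicator C x * ennreal (dens x)) y * indicator E y \<partial>lebesgue)"
proof -
  have m [measurable]: "C \<in> sets lebesgue" "E \<in> sets lebesgue" using assms sets_Mu_iff by auto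
  have "C \<inter> ((T ^^ n) -` E \<inter> K) \<in> sets Mu" using sets_Mu_preimage[OF assms(2)] assms by auto
  then have "emeasure Mu (C \<inter> ((T ^^ n) -` E \<inter> K)) = (\<integral>\<^sup>+x\<in>C \<inter> ((T ^^ n) -` E \<inter> K). ennreal (dens x) \<partial>lebesgue)"
    by (rule emeasure_Mu)
  also have "\<dots> = (\<integral>\<^sup>+x\<in>K. (indicator C x * ennreal (dens x)) * indicator E ((T ^^ n) x) \<partial>lebesgue)"
    by (intro nn_integral_cong) (auto split: split_indicator)
  also have "\<dots> = (\<integral>\<^sup>+y\<in>K0. (transfer ^^ n) (\<lambda>x. indicator C x * ennreal (dens x)) y * indicator E y \<partial>lebesgue)"
    by (intro transfer_pow_duality) measurable
  finally show ?thesis .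
qed

lemma transfer_pow_dens: "y \<in> K0 \<Longrightarrow> (transfer ^^ n) (\<lambda>x. ennreal (dens x)) y = ennreal (dens y)"
proof (induction n arbitrary: y)
  case (Suc n)
  have "transfer ((transfer ^^ n) (\<lambda>x. ennreal (dens x))) = transfer (\<lambda>x. ennreal (dens x))"
    using Suc.IH by (rule transfer_cong)
  then show ?case using transfer_dens[OF Suc.prems] by simp
qed simp

lemma Mu_invariant_pow: "E \<in> sets Mu \<Longrightarrow> emeasure Mu ((T ^^ n) -` E \<inter> K) = emeasure Mu E"
proof -
  assume E: "E \<in> sets Mu"
  have K: "K \<in> sets Mu" using sets_Mu_iff sets_K by auto
  have "emeasure Mu ((T ^^ n) -` E \<inter> K) = emeasure Mu (K \<inter> ((T ^^ n) -` E \<inter> K))" by (simp add: Int_absorb1)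
  also have "\<dots> = (\<integral>\<^sup>+y\<in>K0. (transfer ^^ n) (\<lambda>x. indicator K x * ennreal (dens x)) y * indicator E y \<partial>lebesgue)"
    by (rule emeasure_Mu_cyl[OF K E])
  also have "\<dots> = (\<integral>\<^sup>+y\<in>K0. ennreal (dens y) * indicator E y \<partial>lebesgue)"
  proof (intro nn_integral_cong)
    fix y
    have "(transfer ^^ n) (\<lambda>x. indicator K x * ennreal (dens x)) y = ennreal (dens y)" if y: "y \<in> K0"
    proof -
      have *: "indicator K x * ennreal (dens x) = ennreal (dens x)" if "x \<in> K0" for x
        using that K0_subset_K by (simp add: subset_iff)
      have "(transfer ^^ n) (\<lambda>x. indicator K x * ennreal (dens x)) y = (transfer ^^ n) (\<lambda>x. ennreal (dens x)) y"
        by (rule transfer_pow_cong[OF * y])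
      then show ?thesis using transfer_pow_dens[OF y] by simp
    qed
    then show "(transfer ^^ n) (\<lambda>x. indicator K x * ennreal (dens x)) y * indicator E y * indicator K0 y =
      ennreal (dens y) * indicator E y * indicator K0 y" by (auto split: split_indicator)
  qed
  also have "\<dots> = emeasure Mu E" by (rule emeasure_Mu_K0[OF E, symmetric])
  finally show ?thesis .
qed

text \<open>The indicator of a cylinder is in general not regular. Along the word, however, each
  step uses only one branch, which preserves the constant \<open>BB\<close>, and after all its
  digits are consumed no trace of the boundary of the cylinder is left.\<close>

lemma reg_transfer_cyl:
  "set s \<subseteq> Z \<Longrightarrow> reg BB f \<Longrightarrow> reg BB ((transfer ^^ length s) (\<lambda>x. indicator (cyl s) x * f x))"
proof (induction s arbitrary: f)
  case Nil
  have "indicator K x * f x = f x" if "x \<in> K0" for x using that K0_subset_K by auto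
  then show ?case using Nil by (auto simp: reg_def)
next
  case (Cons a s)
  have a: "a \<in> Z" and s: "set s \<subseteq> Z" using Cons.prems by auto
  let ?F = "\<lambda>x. indicator (cyl (a # s)) x * f x"
  have tr: "transfer ?F y = indicator (cyl s) y * branch a f y" if y: "y \<in> K0" for y
  proof -
    have near: "nearest Z K (y + b) = b" if "b \<in> Z" for b
      using that y K0_subset_K by (intro nearest_eqI) auto
    have mem: "\<iota> (y + b) \<in> cyl (a # s) \<longleftrightarrow> \<iota> (y + b) \<in> K \<and> b = a \<and> y \<in> cyl s" if "b \<in> Z" for b
      using near[OF that] cyl_Cons[OF a] by (auto simp: T_eq red_def)
    have "transfer ?F y = branch a ?F y"
      unfolding transfer_def
      using mem by (intro nn_integral_count_space_single a) (auto simp: branch_def split: split_indicator)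
    also have "\<dots> = indicator (cyl s) y * branch a f y"
      using mem[OF a] K0_subset_K by (auto simp: branch_def split: split_indicator)
    finally show ?thesis .
  qed
  have "reg BB ((transfer ^^ length s) (\<lambda>y. indicator (cyl s) y * branch a f y))"
    using Cons.IH[OF s reg_branch_BB[OF Cons.prems(2) a]] .
  moreover have "(transfer ^^ length s) (transfer ?F) y = (transfer ^^ length s) (\<lambda>y. indicator (cyl s) y * branch a f y) y"
    if "y \<in> K0" for y using tr that by (intro transfer_pow_cong) auto
  ultimately show ?case by (simp add: reg_def funpow_Suc_right del: funpow.simps cylinder.simps)
qed

lemma cyl_in_sets: "cyl s \<in> sets Mu"
  using cyl_subset sets_cyl sets_Mu_iff by auto

text \<open>After \<open>length s\<close> steps the density restricted to the cylinder has become a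
  regular function of mass \<open>M\<close>, the measure of the cylinder, to which
  \<open>kuzmin\<close> applies for the remaining \<open>m\<close> steps. The lower bound of the
  density turns the absolute error into a relative one.\<close>

lemma mixing:
  "\<exists>C \<alpha>. 0 \<le> C \<and> 0 < \<alpha> \<and> \<alpha> < 1 \<and> (\<forall>s E m. set s \<subseteq> Z \<longrightarrow> E \<in> sets Mu \<longrightarrow>
     \<bar>measure Mu (cyl s \<inter> ((T ^^ (length s + m)) -` E \<inter> K)) - measure Mu (cyl s) * measure Mu E\<bar>
      \<le> C * \<alpha> ^ m * (measure Mu (cyl s) * measure Mu E))"
proof -
  obtain C \<alpha> where C: "0 \<le> C" and \<alpha>: "0 < \<alpha>" "\<alpha> < 1" and k: "\<And>f M n y. y \<in> K0 \<Longrightarrow>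
     f \<in> borel_measurable lebesgue \<Longrightarrow> reg BB f \<Longrightarrow> mass f = ennreal M \<Longrightarrow> 0 \<le> M \<Longrightarrow>
     \<bar>enn2real ((transfer ^^ n) f y) - M * dens y\<bar> \<le> C * \<alpha> ^ n * M"
    using kuzmin by blast
  obtain \<eta> where \<eta>: "\<eta> > 0" "\<And>y. y \<in> K0 \<Longrightarrow> \<eta> \<le> dens y" using dens_lower by blast
  show ?thesis
  proof (rule exI[of _ "C / \<eta>"], rule exI[of _ \<alpha>], intro conjI allI impI)
    fix s E m assume s: "set s \<subseteq> Z" and E: "E \<in> sets Mu"
    have mE [measurable]: "E \<in> sets lebesgue" using E sets_Mu_iff by auto
    define n where "n = length s"
    define F where "F = (\<lambda>x. indicator (cyl s) x * ennreal (dens x))"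
    define g where "g = (transfer ^^ n) F"
    define M where "M = measure Mu (cyl s)"
    define \<epsilon> where "\<epsilon> = C / \<eta> * \<alpha> ^ m"
    have \<epsilon>: "0 \<le> \<epsilon>" using C \<eta> \<alpha> by (simp add: \<epsilon>_def)
    have M0: "0 \<le> M" by (simp add: M_def)
    have Fm [measurable]: "F \<in> borel_measurable lebesgue" unfolding F_def by measurable
    have gm [measurable]: "g \<in> borel_measurable lebesgue" unfolding g_def by (rule transfer_pow_measurable[OF Fm])
    have regg: "reg BB g" unfolding g_def F_def n_def by (rule reg_transfer_cyl[OF s reg_dens])
    have "mass g = mass F" unfolding g_def by (rule mass_transfer_pow[OF Fm])
    also have "\<dots> = emeasure Mu (cyl s)"
      unfolding emeasure_Mu_K0[OF cyl_in_sets] mass_def F_def by (simp add: mult.commute)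
    finally have massg: "mass g = ennreal M" by (simp add: M_def P.emeasure_eq_measure)
    have pw: "(transfer ^^ (n + m)) F = (transfer ^^ m) g"
      unfolding g_def by (simp only: add.commute[of n m] funpow_add comp_apply)
    have gy: "(transfer ^^ m) g y = ennreal (enn2real ((transfer ^^ m) g y))" if "y \<in> K0" for y
      by (rule transfer_pow_finite[OF gm regg massg that])
    have bd: "\<bar>enn2real ((transfer ^^ m) g y) - M * dens y\<bar> \<le> \<epsilon> * M * dens y" if y: "y \<in> K0" for y
    proof -
      have "C * \<alpha> ^ m * M * 1 \<le> C * \<alpha> ^ m * M * (dens y / \<eta>)"
        using \<eta> y C \<alpha> M0 by (intro mult_left_mono) auto
      then show ?thesis using k[OF y gm regg massg M0, of m] by (simp add: \<epsilon>_def mult_ac)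
    qed
    let ?A = "cyl s \<inter> ((T ^^ (n + m)) -` E \<inter> K)"
    have A: "emeasure Mu ?A = (\<integral>\<^sup>+y\<in>K0. (transfer ^^ m) g y * indicator E y \<partial>lebesgue)"
      unfolding emeasure_Mu_cyl[OF cyl_in_sets E] pw[symmetric] F_def by simp
    have mm: "(\<lambda>y. (transfer ^^ m) g y) \<in> borel_measurable lebesgue" by (rule transfer_pow_measurable[OF gm])
    have cE: "(\<integral>\<^sup>+y\<in>K0. ennreal (c * dens y) * indicator E y \<partial>lebesgue) = ennreal (c * measure Mu E)" if "0 \<le> c" for c
    proof -
      have "(\<integral>\<^sup>+y\<in>K0. ennreal (c * dens y) * indicator E y \<partial>lebesgue) =
          (\<integral>\<^sup>+y. ennreal c * (ennreal (dens y) * indicator E y * indicator K0 y) \<partial>lebesgue)"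
        using that dens_nonneg by (intro nn_integral_cong) (simp add: ennreal_mult mult_ac)
      also have "\<dots> = ennreal c * emeasure Mu E"
        unfolding emeasure_Mu_K0[OF E] by (intro nn_integral_cmult) measurable
      finally show ?thesis using that by (simp add: P.emeasure_eq_measure ennreal_mult)
    qed
    have "emeasure Mu ?A \<le> (\<integral>\<^sup>+y\<in>K0. ennreal ((1 + \<epsilon>) * M * dens y) * indicator E y \<partial>lebesgue)"
      unfolding A
    proof (intro nn_integral_mono)
      fix y
      have "(transfer ^^ m) g y \<le> ennreal ((1 + \<epsilon>) * M * dens y)" if "y \<in> K0"
        using bd[OF that] by (subst gy[OF that]) (auto intro!: ennreal_leI simp: algebra_simps)
      then show "(transfer ^^ m) g y * indicator E y * indicator K0 y \<le> ennreal ((1 + \<epsilon>) * M * dens y) * indicator E y * indicator K0 y"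
        by (auto split: split_indicator)
    qed
    also have "\<dots> = ennreal ((1 + \<epsilon>) * M * measure Mu E)" using \<epsilon> M0 by (intro cE) auto
    finally have up: "measure Mu ?A \<le> (1 + \<epsilon>) * M * measure Mu E"
      using \<epsilon> M0 by (simp add: P.emeasure_eq_measure)
    have "ennreal (M * measure Mu E) = (\<integral>\<^sup>+y\<in>K0. ennreal (M * dens y) * indicator E y \<partial>lebesgue)"
      using M0 by (intro cE[symmetric])
    also have "\<dots> \<le> (\<integral>\<^sup>+y. (transfer ^^ m) g y * indicator E y * indicator K0 y +
        ennreal (\<epsilon> * M * dens y) * indicator E y * indicator K0 y \<partial>lebesgue)"
    proof (intro nn_integral_mono)
      fix y
      have "ennreal (M * dens y) \<le> (transfer ^^ m) g y + ennreal (\<epsilon> * M * dens y)" if "y \<in> K0"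
      proof -
        have "M * dens y \<le> enn2real ((transfer ^^ m) g y) + \<epsilon> * M * dens y" using bd[OF that] by linarith
        moreover have "0 \<le> \<epsilon> * M * dens y" using \<epsilon> M0 dens_nonneg by simp
        ultimately show ?thesis
          by (subst gy[OF that]) (simp add: ennreal_plus[symmetric] ennreal_leI del: ennreal_plus)
      qed
      then show "ennreal (M * dens y) * indicator E y * indicator K0 y \<le> (transfer ^^ m) g y * indicator E y * indicator K0 y +
        ennreal (\<epsilon> * M * dens y) * indicator E y * indicator K0 y"
        by (auto split: split_indicator)
    qed
    also have "\<dots> = emeasure Mu ?A + ennreal (\<epsilon> * M * measure Mu E)"
      using mm \<epsilon> M0 by (subst nn_integral_add) (auto simp: A cE)
    also have "\<dots> = ennreal (measure Mu ?A + \<epsilon> * M * measure Mu E)"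
      using \<epsilon> M0 by (simp add: P.emeasure_eq_measure)
    finally have low: "M * measure Mu E \<le> measure Mu ?A + \<epsilon> * M * measure Mu E"
      using \<epsilon> M0 by (subst (asm) ennreal_le_iff) auto
    have "\<bar>measure Mu ?A - M * measure Mu E\<bar> \<le> \<epsilon> * (M * measure Mu E)"
      using up low by (simp add: abs_le_iff algebra_simps)
    then show "\<bar>measure Mu (cyl s \<inter> ((T ^^ (length s + m)) -` E \<inter> K)) - measure Mu (cyl s) * measure Mu E\<bar>
      \<le> C / \<eta> * \<alpha> ^ m * (measure Mu (cyl s) * measure Mu E)" by (simp only: n_def M_def \<epsilon>_def)
  qed (use C \<alpha> \<eta> in auto)
qed

end

section \<open>Exactness and the Kuzmin theorem\<close>

context cf_lattice
begin

lemma dens_bounded: "\<exists>D. 0 \<le> D \<and> (\<forall>x. dens x \<le> D)"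
proof -
  have "dens y \<le> enn2real Csup" if y: "y \<in> K0" for y
  proof -
    have "ennreal (dens y) \<le> Csup * mass (\<lambda>x. ennreal (dens x))"
      using reg_le_mass[OF _ reg_dens y] by measurable
    then have "ennreal (dens y) \<le> Csup" by (simp add: mass_dens)
    then have "enn2real (ennreal (dens y)) \<le> enn2real Csup" using Csup_finite by (intro enn2real_mono) auto
    then show ?thesis using dens_nonneg by simp
  qed
  then show ?thesis by (intro exI[of _ "enn2real Csup"]) (auto simp: dens_def)
qed

text \<open>For every \<open>m\<close> the tail event is a preimage under
  \<open>length s + m\<close> steps of a set of the same measure, so the mixing error can be made
  arbitrarily small.\<close>

lemma tail_indep_cyl:
  assumes tail: "\<forall>n. \<exists>B\<in>sets Mu. E = (T ^^ n) -` B \<inter> K" and s: "set s \<subseteq> Z"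
  shows "measure Mu (cyl s \<inter> E) = measure Mu (cyl s) * measure Mu E"
proof -
  obtain C \<alpha> where C: "0 \<le> C" and \<alpha>: "0 < \<alpha>" "\<alpha> < 1" and mix: "\<And>s E m. set s \<subseteq> Z \<Longrightarrow> E \<in> sets Mu \<Longrightarrow>
     \<bar>measure Mu (cyl s \<inter> ((T ^^ (length s + m)) -` E \<inter> K)) - measure Mu (cyl s) * measure Mu E\<bar>
      \<le> C * \<alpha> ^ m * (measure Mu (cyl s) * measure Mu E)"
    using mixing by blast
  have "\<bar>measure Mu (cyl s \<inter> E) - measure Mu (cyl s) * measure Mu E\<bar> \<le> C * \<alpha> ^ m * (measure Mu (cyl s) * measure Mu E)" for m
  proof -
    obtain B where B: "B \<in> sets Mu" "E = (T ^^ (length s + m)) -` B \<inter> K" using tail by blast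
    have "measure Mu E = measure Mu B" unfolding measure_def B(2) Mu_invariant_pow[OF B(1)] ..
    then show ?thesis using mix[OF s B(1), of m] B(2) by simp
  qed
  moreover have "(\<lambda>m. C * \<alpha> ^ m * (measure Mu (cyl s) * measure Mu E)) \<longlonglongrightarrow> C * 0 * (measure Mu (cyl s) * measure Mu E)"
    using \<alpha> by (intro tendsto_intros LIMSEQ_power_zero) auto
  ultimately have "\<bar>measure Mu (cyl s \<inter> E) - measure Mu (cyl s) * measure Mu E\<bar> \<le> 0"
    by (intro LIMSEQ_le_const[of "\<lambda>m. C * \<alpha> ^ m * (measure Mu (cyl s) * measure Mu E)"]) auto
  then show ?thesis by simp
qed

text \<open>Cylinders shrink uniformly with their length. Hence an open set is, within
  \<open>K\<close>, the increasing union over \<open>n\<close> of the disjoint cylinders of length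
  \<open>n\<close> that it contains.\<close>

lemma tail_indep_open:
  assumes tail: "\<forall>n. \<exists>B\<in>sets Mu. E = (T ^^ n) -` B \<inter> K" and G: "open G"
  shows "measure Mu (G \<inter> K \<inter> E) = measure Mu (G \<inter> K) * measure Mu E"
proof -
  obtain B where "B \<in> sets Mu" "E = (T ^^ 0) -` B \<inter> K" using tail by blast
  then have E: "E \<in> sets Mu" using sets_Mu_preimage[of B 0] by simp
  define S where "S n = {s. set s \<subseteq> Z \<and> length s = n \<and> cyl s \<subseteq> G}" for n
  define H where "H n = (\<Union>s\<in>S n. cyl s)" for n
  have cS: "countable (S n)" for n
    by (rule countable_subset[OF _ countable_lists[OF countable_Z]]) (auto simp: S_def)
  have Hm: "H n \<in> sets Mu" for n unfolding H_def using cS cyl_in_sets by (intro sets.countable_UN') auto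
  have disj: "disjoint_family_on cyl (S n)" for n
    unfolding disjoint_family_on_def
  proof (intro ballI impI)
    fix s t assume st: "s \<in> S n" "t \<in> S n" "s \<noteq> t"
    show "cyl s \<inter> cyl t = {}"
    proof (rule ccontr)
      assume "cyl s \<inter> cyl t \<noteq> {}"
      then obtain x where "x \<in> cyl s" "x \<in> cyl t" by blast
      then have "digits n x = s" "digits n x = t" using st in_cyl_iff by (auto simp: S_def)
      then show False using st by simp
    qed
  qed
  have Heq: "emeasure Mu (H n \<inter> E) = emeasure Mu (H n) * emeasure Mu E" for n
  proof -
    have "emeasure Mu (H n \<inter> E) = emeasure Mu (\<Union>s\<in>S n. cyl s \<inter> E)" by (simp add: H_def)
    also have "\<dots> = (\<integral>\<^sup>+s. emeasure Mu (cyl s \<inter> E) \<partial>count_space (S n))"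
    proof (rule emeasure_UN_countable)
      show "disjoint_family_on (\<lambda>s. cyl s \<inter> E) (S n)" using disj[of n] unfolding disjoint_family_on_def by blast
    qed (use cS E cyl_in_sets in auto)
    also have "\<dots> = (\<integral>\<^sup>+s. emeasure Mu (cyl s) * emeasure Mu E \<partial>count_space (S n))"
    proof (rule nn_integral_cong)
      fix s assume "s \<in> space (count_space (S n))"
      then have "set s \<subseteq> Z" by (simp add: S_def)
      from tail_indep_cyl[OF tail this] show "emeasure Mu (cyl s \<inter> E) = emeasure Mu (cyl s) * emeasure Mu E"
        by (simp add: P.emeasure_eq_measure ennreal_mult)
    qed
    also have "\<dots> = (\<integral>\<^sup>+s. emeasure Mu (cyl s) \<partial>count_space (S n)) * emeasure Mu E"
      by (intro nn_integral_multc) auto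
    also have "(\<integral>\<^sup>+s. emeasure Mu (cyl s) \<partial>count_space (S n)) = emeasure Mu (H n)"
      unfolding H_def using cS cyl_in_sets disj[of n] by (intro emeasure_UN_countable[symmetric]) auto
    finally show ?thesis .
  qed
  have inc: "incseq H"
  proof (rule incseq_SucI)
    fix n show "H n \<subseteq> H (Suc n)"
    proof
      fix x assume "x \<in> H n"
      then obtain s where s: "s \<in> S n" "x \<in> cyl s" by (auto simp: H_def)
      then have xK: "x \<in> K" and ds: "digits n x = s" using in_cyl_iff[of s x] by (auto simp: S_def)
      have "cyl (digits (Suc n) x) \<subseteq> cyl s"
      proof
        fix y assume "y \<in> cyl (digits (Suc n) x)"
        then have y: "y \<in> K" "digits (Suc n) y = digits (Suc n) x"
          using in_cyl_iff[OF set_digits, of y "Suc n" x] by auto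
        then have "digits n y = digits n x" by (metis take_digits)
        then show "y \<in> cyl s" using y ds s in_cyl_iff[of s y] by (simp add: S_def)
      qed
      moreover have "cyl s \<subseteq> G" using s(1) by (simp add: S_def)
      ultimately have "cyl (digits (Suc n) x) \<subseteq> G" by (rule order_trans)
      then have "digits (Suc n) x \<in> S (Suc n)"
        unfolding S_def using set_digits[of "Suc n" x] by (simp del: digits.simps)
      then show "x \<in> H (Suc n)" using in_cyl_digits[OF xK] unfolding H_def by blast
    qed
  qed
  have un: "(\<Union>n. H n) = G \<inter> K"
  proof (intro set_eqI iffI)
    fix x assume "x \<in> (\<Union>n. H n)"
    then show "x \<in> G \<inter> K" using cyl_subset by (auto simp: H_def S_def)
  next
    fix x assume x: "x \<in> G \<inter> K"
    then obtain e where e: "e > 0" "ball x e \<subseteq> G" using G openE by blast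
    have "(\<lambda>n. 2 * (\<rho>\<^sup>2) ^ n) \<longlonglongrightarrow> 2 * 0" using rho_sq by (intro tendsto_intros LIMSEQ_power_zero) auto
    then have "\<forall>\<^sub>F n in sequentially. 2 * (\<rho>\<^sup>2) ^ n < e" using e by (intro order_tendstoD) auto
    then obtain n where n: "2 * (\<rho>\<^sup>2) ^ n < e" unfolding eventually_sequentially by blast
    have xc: "x \<in> cyl (digits n x)" using x in_cyl_digits by blast
    have "cyl (digits n x) \<subseteq> G"
    proof
      fix y assume "y \<in> cyl (digits n x)"
      then have "dist x y \<le> 2 * (\<rho>\<^sup>2) ^ n" using dist_cyl[OF set_digits xc] by simp
      then show "y \<in> G" using n e by auto
    qed
    then have "digits n x \<in> S n" using set_digits by (simp add: S_def)
    then show "x \<in> (\<Union>n. H n)" using xc by (auto simp: H_def)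
  qed
  have "(\<lambda>n. emeasure Mu (H n \<inter> E)) \<longlonglongrightarrow> emeasure Mu (\<Union>n. H n \<inter> E)"
    using Hm E inc by (intro Lim_emeasure_incseq) (auto simp: incseq_def)
  moreover have "(\<Union>n. H n \<inter> E) = G \<inter> K \<inter> E" using un by auto
  moreover have "(\<lambda>n. emeasure Mu E * emeasure Mu (H n)) \<longlonglongrightarrow> emeasure Mu E * emeasure Mu (\<Union>n. H n)"
    using Hm inc by (intro ennreal_tendsto_cmult Lim_emeasure_incseq) (auto simp: P.emeasure_eq_measure)
  then have "(\<lambda>n. emeasure Mu (H n) * emeasure Mu E) \<longlonglongrightarrow> emeasure Mu (\<Union>n. H n) * emeasure Mu E"
    by (simp only: mult.commute)
  ultimately have "emeasure Mu (G \<inter> K \<inter> E) = emeasure Mu (G \<inter> K) * emeasure Mu E"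
    using LIMSEQ_unique unfolding Heq un by metis
  then show ?thesis by (simp add: P.emeasure_eq_measure ennreal_mult[symmetric])
qed

text \<open>Approximate the tail event from outside by open sets. It is independent of them, hence
  in the limit independent of itself, and its measure equals its own square.\<close>

lemma exact_Mu: "exact_endomorphism Mu T"
  unfolding exact_endomorphism_def
proof (intro conjI allI impI)
  show "T \<in> measurable Mu Mu" by (rule measurable_T_Mu)
  fix E assume "\<forall>n. \<exists>B\<in>sets Mu. E = (T ^^ n) -` B \<inter> space Mu"
  then have tail: "\<forall>n. \<exists>B\<in>sets Mu. E = (T ^^ n) -` B \<inter> K" by simp
  obtain B where "B \<in> sets Mu" "E = (T ^^ 0) -` B \<inter> K" using tail by blast
  then have E: "E \<in> sets Mu" using sets_Mu_preimage[of B 0] by simp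
  then have EK: "E \<subseteq> K" "E \<in> sets lebesgue" using sets_Mu_iff by auto
  obtain D where D: "0 \<le> D" "\<And>x. dens x \<le> D" using dens_bounded by blast
  let ?p = "measure Mu E"
  have "\<bar>?p - ?p * ?p\<bar> \<le> 0 + e" if e: "e > 0" for e
  proof -
    define d where "d = e / (D + 1)"
    have d: "d > 0" "D * d \<le> e"
    proof -
      show "d > 0" using e D by (simp add: d_def)
      have "D * e \<le> (D + 1) * e" using e by (intro mult_right_mono) auto
      then show "D * d \<le> e" using D by (simp add: d_def pos_divide_le_eq mult.commute)
    qed
    obtain G where G: "open G" "E \<subseteq> G" "G - E \<in> lmeasurable" "emeasure lebesgue (G - E) < ennreal d"
      using sets_lebesgue_outer_open[OF EK(2) d(1)] by blast
    have GK: "G \<inter> K \<in> sets Mu" using G sets_K sets_Mu_iff by (auto intro!: sets.Int)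
    have GKE: "G \<inter> K - E \<in> sets Mu" using GK E by auto
    have "emeasure Mu (G \<inter> K - E) = (\<integral>\<^sup>+x\<in>G \<inter> K - E. ennreal (dens x) \<partial>lebesgue)" by (rule emeasure_Mu[OF GKE])
    also have "\<dots> \<le> (\<integral>\<^sup>+x. ennreal D * indicator (G - E) x \<partial>lebesgue)"
      using D by (intro nn_integral_mono) (auto split: split_indicator intro!: ennreal_leI)
    also have "\<dots> = ennreal D * emeasure lebesgue (G - E)" using G by (intro nn_integral_cmult_indicator) auto
    also have "\<dots> \<le> ennreal D * ennreal d" using G by (intro mult_left_mono) auto
    also have "\<dots> \<le> ennreal e" using D d by (simp add: ennreal_mult[symmetric] ennreal_leI)
    finally have "measure Mu (G \<inter> K - E) \<le> e" using e by (simp add: P.emeasure_eq_measure)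
    moreover have "measure Mu (G \<inter> K - E) = measure Mu (G \<inter> K) - ?p"
      using GK E G EK by (intro P.finite_measure_Diff) auto
    moreover have "?p \<le> measure Mu (G \<inter> K)" using GK G EK by (intro P.finite_measure_mono) auto
    ultimately have q: "?p \<le> measure Mu (G \<inter> K)" "measure Mu (G \<inter> K) \<le> ?p + e" by auto
    have "G \<inter> K \<inter> E = E" using G EK by auto
    then have peq: "?p = measure Mu (G \<inter> K) * ?p" using tail_indep_open[OF tail G(1)] by simp
    have "?p * ?p \<le> measure Mu (G \<inter> K) * ?p" using q by (intro mult_right_mono) auto
    moreover have "measure Mu (G \<inter> K) * ?p \<le> (?p + e) * ?p" using q by (intro mult_right_mono) auto
    moreover have "e * ?p \<le> e * 1" using e P.prob_le_1 by (intro mult_left_mono) auto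
    ultimately show ?thesis using peq by (auto simp: algebra_simps abs_le_iff)
  qed
  then have "\<bar>?p - ?p * ?p\<bar> \<le> 0" by (rule field_le_epsilon)
  then have "?p * (1 - ?p) = 0" by (simp add: algebra_simps)
  then show "?p = 0 \<or> ?p = 1" by auto
qed

section \<open>The transfer relation determines its values almost everywhere\<close>

lemma AE_eq_of_set_integrals_eq:
  fixes g u :: "'a \<Rightarrow> real"
  assumes g: "set_integrable lebesgue K g" and u: "set_integrable lebesgue K u"
    and eq: "\<And>E. E \<in> sets lebesgue \<Longrightarrow> E \<subseteq> K \<Longrightarrow> (LINT x:E|lebesgue. g x) = (LINT x:E|lebesgue. u x)"
  shows "AE x in lebesgue. x \<in> K \<longrightarrow> g x = u x"
proof -
  have le: "AE x in lebesgue. x \<in> K \<longrightarrow> p x \<le> q x"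
    if p: "set_integrable lebesgue K p" and q: "set_integrable lebesgue K q"
      and pq: "\<And>E. E \<in> sets lebesgue \<Longrightarrow> E \<subseteq> K \<Longrightarrow> (LINT x:E|lebesgue. p x) = (LINT x:E|lebesgue. q x)" for p q :: "'a \<Rightarrow> real"
  proof -
    have [measurable]: "(\<lambda>x. indicator K x *\<^sub>R p x) \<in> borel_measurable lebesgue" "(\<lambda>x. indicator K x *\<^sub>R q x) \<in> borel_measurable lebesgue"
      using p q unfolding set_integrable_def by auto
    define A where "A = {x \<in> K. q x < p x}"
    have "A = {x \<in> space lebesgue. indicator K x *\<^sub>R q x < indicator K x *\<^sub>R p x}"
      by (auto simp: A_def split: split_indicator)
    also have "\<dots> \<in> sets lebesgue" by measurable
    finally have A: "A \<in> sets lebesgue" "A \<subseteq> K" by (auto simp: A_def)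
    have pA: "set_integrable lebesgue A p" "set_integrable lebesgue A q"
      using set_integrable_subset[OF p A] set_integrable_subset[OF q A] by auto
    have "(LINT x:A|lebesgue. p x - q x) = 0"
      using set_integral_diff(2)[OF pA] pq[OF A] by simp
    moreover have "set_integrable lebesgue A (\<lambda>x. p x - q x)" using set_integral_diff(1)[OF pA] .
    ultimately have "AE x in lebesgue. indicator A x *\<^sub>R (p x - q x) = 0"
      unfolding set_integrable_def set_lebesgue_integral_def
      by (subst (asm) integral_nonneg_eq_0_iff_AE) (auto simp: A_def split: split_indicator)
    then show ?thesis by eventually_elim (auto simp: A_def split: split_indicator_asm)
  qed
  have 1: "AE x in lebesgue. x \<in> K \<longrightarrow> g x \<le> u x" using le[OF g u] eq by blast
  have 2: "AE x in lebesgue. x \<in> K \<longrightarrow> u x \<le> g x" using le[OF u g] eq by (metis (no_types))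
  from 1 2 show ?thesis by eventually_elim auto
qed

lemma set_integral_real_transfer:
  assumes F: "F \<in> borel_measurable lebesgue" and fin: "\<And>y. y \<in> K0 \<Longrightarrow> F y < \<infinity>" and E: "E \<in> sets lebesgue" "E \<subseteq> K"
  shows "(LINT x:E|lebesgue. enn2real (F x)) = enn2real (\<integral>\<^sup>+x\<in>K0. F x * indicator E x \<partial>lebesgue)"
proof -
  have [measurable]: "E \<in> sets lebesgue" "F \<in> borel_measurable lebesgue" using E F by auto
  have "(LINT x:E|lebesgue. enn2real (F x)) = enn2real (\<integral>\<^sup>+x. ennreal (indicator E x *\<^sub>R enn2real (F x)) \<partial>lebesgue)"
    unfolding set_lebesgue_integral_def by (intro integral_eq_nn_integral) auto
  also have "(\<integral>\<^sup>+x. ennreal (indicator E x *\<^sub>R enn2real (F x)) \<partial>lebesgue) = (\<integral>\<^sup>+x\<in>K0. F x * indicator E x \<partial>lebesgue)"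
    using E fin by (intro nn_integral_cong_AE eventually_mono[OF AE_K_K0]) (auto split: split_indicator)
  finally show ?thesis .
qed

text \<open>The relation fixes only integrals over measurable sets. By duality the explicit operator
  has the same integrals, so every function in the relation agrees with it almost
  everywhere.\<close>

lemma transfer_iter_eq:
  fixes f :: "'a \<Rightarrow> real"
  assumes F: "F = (\<lambda>x. ennreal (if x \<in> K0 then f x else 0))" and Fm: "F \<in> borel_measurable lebesgue"
    and fb: "\<And>x. x \<in> K0 \<Longrightarrow> 0 \<le> f x \<and> f x \<le> b"
    and it: "transfer_iter K T n f g"
  shows "AE x in lebesgue. x \<in> K \<longrightarrow> g x = enn2real ((transfer ^^ n) F x)"
  using it
proof (induction n arbitrary: g)
  case 0
  then have "AE x in lebesgue. x \<in> K \<longrightarrow> g x = f x" by simp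
  then show ?case using AE_K_K0 by eventually_elim (use fb in \<open>auto simp: F\<close>)
next
  case (Suc n)
  have b0: "0 \<le> b" using fb K0_nonempty by force
  have cb: "(\<lambda>_. ennreal b) \<in> borel_measurable lebesgue" "reg BB (\<lambda>_. ennreal b)" "mass (\<lambda>_. ennreal b) = ennreal (b * vol)"
    using BB_pos b0 vol by (auto simp: reg_const mass_const ennreal_mult)
  have fin: "(transfer ^^ m) F y < \<infinity>" if y: "y \<in> K0" for m y
  proof -
    have "(transfer ^^ m) F y \<le> (transfer ^^ m) (\<lambda>_. ennreal b) y"
      using fb y by (intro transfer_pow_mono) (auto simp: F intro!: ennreal_leI)
    also have "\<dots> < \<infinity>" by (subst transfer_pow_finite[OF cb y]) simp
    finally show ?thesis .
  qed
  have massF: "mass F < \<infinity>"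
  proof -
    have "mass F \<le> mass (\<lambda>_. ennreal b)" using fb by (intro mass_mono) (auto simp: F intro!: ennreal_leI)
    also have "\<dots> < \<infinity>" by (simp add: cb(3))
    finally show ?thesis .
  qed
  note tm = transfer_pow_measurable[OF Fm]
  obtain g' where g': "transfer_iter K T n f g'" "transfer_of K T g' g" using Suc.prems by auto
  have gi: "set_integrable lebesgue K g" using g'(2) by (simp add: transfer_of_def)
  have g'i: "set_integrable lebesgue K g'" using g'(1) by (cases n) (auto simp: transfer_of_def)
  have IH: "AE x in lebesgue. x \<in> K \<longrightarrow> g' x = enn2real ((transfer ^^ n) F x)" by (rule Suc.IH[OF g'(1)])
  show ?case
  proof (rule AE_eq_of_set_integrals_eq[OF gi])
    show "set_integrable lebesgue K (\<lambda>x. enn2real ((transfer ^^ Suc n) F x))"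
      unfolding set_integrable_def
    proof (rule integrableI_nonneg)
      show "(\<lambda>x. indicator K x *\<^sub>R enn2real ((transfer ^^ Suc n) F x)) \<in> borel_measurable lebesgue"
        using tm[of "Suc n"] by measurable
      have "(\<integral>\<^sup>+x. ennreal (indicator K x *\<^sub>R enn2real ((transfer ^^ Suc n) F x)) \<partial>lebesgue) = mass ((transfer ^^ Suc n) F)"
        unfolding mass_def using fin[of _ "Suc n"]
        by (intro nn_integral_cong_AE eventually_mono[OF AE_K_K0]) (auto split: split_indicator simp del: funpow.simps)
      then show "(\<integral>\<^sup>+x. ennreal (indicator K x *\<^sub>R enn2real ((transfer ^^ Suc n) F x)) \<partial>lebesgue) < \<infinity>"
        using massF mass_transfer_pow[OF Fm, of "Suc n"] by simp
    qed auto
    fix E :: "'a set" assume E: "E \<in> sets lebesgue" "E \<subseteq> K"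
    have TE: "T -` E \<inter> K \<in> sets lebesgue" "T -` E \<inter> K \<subseteq> K"
      using measurable_sets[OF measurable_T E(1)] sets_K by (auto simp: sets.Int)
    have "(LINT x:E|lebesgue. g x) = (LINT x:(T -` E \<inter> K)|lebesgue. g' x)"
      using g'(2) E by (simp add: transfer_of_def)
    also have "\<dots> = (LINT x:(T -` E \<inter> K)|lebesgue. enn2real ((transfer ^^ n) F x))"
      unfolding set_lebesgue_integral_def
    proof (rule integral_cong_AE)
      show "(\<lambda>x. indicator (T -` E \<inter> K) x *\<^sub>R g' x) \<in> borel_measurable lebesgue"
        using set_integrable_subset[OF g'i TE] unfolding set_integrable_def by auto
      show "(\<lambda>x. indicator (T -` E \<inter> K) x *\<^sub>R enn2real ((transfer ^^ n) F x)) \<in> borel_measurable lebesgue"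
        using tm[of n] TE(1) by measurable
      show "AE x in lebesgue. indicator (T -` E \<inter> K) x *\<^sub>R g' x = indicator (T -` E \<inter> K) x *\<^sub>R enn2real ((transfer ^^ n) F x)"
        using IH by eventually_elim (auto split: split_indicator)
    qed
    also have "\<dots> = enn2real (\<integral>\<^sup>+x\<in>K0. (transfer ^^ n) F x * indicator (T -` E \<inter> K) x \<partial>lebesgue)"
      using tm[of n] fin[of _ n] TE by (intro set_integral_real_transfer) auto
    also have "(\<integral>\<^sup>+x\<in>K0. (transfer ^^ n) F x * indicator (T -` E \<inter> K) x \<partial>lebesgue) =
        (\<integral>\<^sup>+x\<in>K. (transfer ^^ n) F x * indicator E (T x) \<partial>lebesgue)"
      by (intro nn_integral_cong_AE eventually_mono[OF AE_K_K0]) (auto split: split_indicator)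
    also have "\<dots> = (\<integral>\<^sup>+y\<in>K0. transfer ((transfer ^^ n) F) y * indicator E y \<partial>lebesgue)"
      using E by (intro transfer_duality[OF tm]) auto
    also have "\<dots> = (\<integral>\<^sup>+y\<in>K0. (transfer ^^ Suc n) F y * indicator E y \<partial>lebesgue)" by simp
    also have "enn2real \<dots> = (LINT x:E|lebesgue. enn2real ((transfer ^^ Suc n) F x))"
      using tm[of "Suc n"] fin[of _ "Suc n"] E by (intro set_integral_real_transfer[symmetric]) (auto simp del: funpow.simps)
    finally show "(LINT x:E|lebesgue. g x) = (LINT x:E|lebesgue. enn2real ((transfer ^^ Suc n) F x))" .
  qed
qed

lemma kuzmin_transfer_iter:
  "\<exists>\<alpha>. 0 < \<alpha> \<and> \<alpha> < 1 \<and> (\<forall>f::'a \<Rightarrow> real. (\<exists>c>0. \<forall>x\<in>K. c \<le> f x \<and> f x \<le> 1 / c) \<longrightarrow>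
     (\<forall>x\<in>K0. \<exists>L. \<forall>y\<in>cell x. \<forall>z\<in>cell x. \<bar>f y - f z\<bar> \<le> L * dist y z) \<longrightarrow>
     (\<exists>Cst\<ge>0. \<forall>n g. transfer_iter K T n f g \<longrightarrow>
        (AE x in lebesgue. x \<in> K \<longrightarrow> \<bar>g x - (LINT y:K|lebesgue. f y) * dens x\<bar> \<le> Cst * \<alpha> ^ n)))"
proof -
  obtain C \<alpha> where C: "0 \<le> C" and \<alpha>: "0 < \<alpha>" "\<alpha> < 1" and k: "\<And>f M n y. y \<in> K0 \<Longrightarrow>
     f \<in> borel_measurable lebesgue \<Longrightarrow> reg BB f \<Longrightarrow> mass f = ennreal M \<Longrightarrow> 0 \<le> M \<Longrightarrow>
     \<bar>enn2real ((transfer ^^ n) f y) - M * dens y\<bar> \<le> C * \<alpha> ^ n * M"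
    using kuzmin by blast
  show ?thesis
  proof (rule exI[of _ \<alpha>], intro conjI allI impI)
    fix f :: "'a \<Rightarrow> real"
    assume "\<exists>c>0. \<forall>x\<in>K. c \<le> f x \<and> f x \<le> 1 / c"
      and lip: "\<forall>x\<in>K0. \<exists>L. \<forall>y\<in>cell x. \<forall>z\<in>cell x. \<bar>f y - f z\<bar> \<le> L * dist y z"
    then obtain c where c: "c > 0" "\<And>x. x \<in> K \<Longrightarrow> c \<le> f x \<and> f x \<le> 1 / c" by blast
    have f0: "0 \<le> f x" if "x \<in> K" for x using c(2)[OF that] c(1) by linarith
    have "\<forall>P\<in>cell ` K0. \<exists>L. \<forall>y\<in>P. \<forall>z\<in>P. \<bar>f y - f z\<bar> \<le> L * dist y z" using lip by blast
    then obtain Lc where Lc: "\<And>P y z. P \<in> cell ` K0 \<Longrightarrow> y \<in> P \<Longrightarrow> z \<in> P \<Longrightarrow> \<bar>f y - f z\<bar> \<le> Lc P * dist y z" by metis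
    define L where "L = Max (insert 0 (Lc ` cell ` K0))"
    have finL: "finite (insert 0 (Lc ` cell ` K0))" using finite_cells by simp
    have L0: "0 \<le> L" unfolding L_def using finL by (intro Max_ge) auto
    have L: "\<bar>f y - f z\<bar> \<le> L * dist y z" if "y \<in> K0" "z \<in> K0" "sim y z" for y z
    proof -
      have "\<bar>f y - f z\<bar> \<le> Lc (cell y) * dist y z" using that by (intro Lc) (auto simp: cell_def)
      also have "Lc (cell y) \<le> L" unfolding L_def using finL that by (intro Max_ge) auto
      finally show ?thesis by (simp add: mult_right_mono)
    qed
    \<comment> \<open>Adding the constant \<open>M\<close> makes \<open>f\<close> regular with the constant \<open>BB\<close>, which does not depend on \<open>f\<close>.\<close>
    define M where "M = L / BB"
    have M: "0 \<le> M" "M * BB = L" using L0 BB_pos by (auto simp: M_def)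
    \<comment> \<open>Measurability of \<open>f\<close> is derived from continuity on the open set
      \<open>K0\<close>; what remains of \<open>K\<close> is null.\<close>
    have cont: "continuous_on K0 f"
      unfolding continuous_on_iff
    proof (intro ballI allI impI)
      fix x and e :: real assume x: "x \<in> K0" and e: "0 < e"
      obtain r where r: "r > 0" "ball x r \<subseteq> cell x" using open_cell'[OF x] in_cell[OF x] openE by blast
      define d where "d = min r (e / (L + 1))"
      have d: "d > 0" using r e L0 by (simp add: d_def)
      have "dist (f y) (f x) < e" if y: "y \<in> K0" "dist y x < d" for y
      proof -
        have "y \<in> cell x" using y r by (auto simp: d_def dist_commute)
        then have "\<bar>f x - f y\<bar> \<le> L * dist x y" using L x by (auto simp: cell_def)
        also have "\<dots> \<le> L * (e / (L + 1))" using y L0 by (intro mult_left_mono) (auto simp: d_def dist_commute)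
        also have "\<dots> < e" using e L0 by (simp add: field_simps)
        finally show ?thesis by (simp add: dist_real_def abs_minus_commute)
      qed
      then show "\<exists>d>0. \<forall>x'\<in>K0. dist x' x < d \<longrightarrow> dist (f x') (f x) < e" using d by blast
    qed
    have "(\<lambda>x. indicator K0 x *\<^sub>R f x) \<in> borel_measurable borel"
      using open_K0 cont by (intro borel_measurable_continuous_on_indicator) auto
    then have if1: "(\<lambda>x. indicator K0 x *\<^sub>R f x) \<in> borel_measurable lebesgue" by (intro measurable_completion) simp
    define F where "F = (\<lambda>x. ennreal (if x \<in> K0 then f x else 0))"
    have "F = (\<lambda>x. ennreal (indicator K0 x *\<^sub>R f x))" by (auto simp: F_def fun_eq_iff)
    then have Fm: "F \<in> borel_measurable lebesgue" using if1 by simp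
    define F1 where "F1 = (\<lambda>x. F x + ennreal M)"
    have F1m: "F1 \<in> borel_measurable lebesgue" unfolding F1_def using Fm by measurable
    have regF1: "reg BB F1"
      unfolding reg_def
    proof (intro ballI impI)
      fix x y assume xy: "x \<in> K0" "y \<in> K0" "sim x y"
      have fy: "0 \<le> f y" "0 \<le> f x" using f0 K0_subset_K xy by auto
      have "f x + M \<le> f y + M + M * (BB * dist x y)" using L[OF xy] M by (simp add: mult.assoc[symmetric])
      also have "\<dots> \<le> f y + M + (f y + M) * (BB * dist x y)"
        using fy BB_pos by (intro add_left_mono mult_right_mono) auto
      also have "\<dots> = (f y + M) * (1 + BB * dist x y)" by (simp add: algebra_simps)
      also have "\<dots> \<le> (f y + M) * exp (BB * dist x y)" using fy M by (intro mult_left_mono) auto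
      finally have "f x + M \<le> exp (BB * dist x y) * (f y + M)" by (simp add: mult.commute)
      then have "ennreal (f x + M) \<le> ennreal (exp (BB * dist x y)) * ennreal (f y + M)"
        using fy M by (simp add: ennreal_mult[symmetric] ennreal_leI del: ennreal_plus)
      then show "F1 x \<le> ennreal (exp (BB * dist x y)) * F1 y"
        using xy fy M by (simp add: F1_def F_def)
    qed
    define I where "I = (LINT y:K|lebesgue. f y)"
    have I: "mass F = ennreal I" "0 \<le> I"
    proof -
      have aeK: "AE x in lebesgue. indicator K0 x *\<^sub>R f x = indicator K x *\<^sub>R f x"
        using AE_K_K0 by eventually_elim (auto split: split_indicator)
      have ifK: "(\<lambda>x. indicator K x *\<^sub>R f x) \<in> borel_measurable lebesgue"
        by (rule borel_measurable_lebesgue_AE_cong[OF if1 aeK])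
      have "I = (LINT x|lebesgue. indicator K0 x *\<^sub>R f x)"
        unfolding I_def set_lebesgue_integral_def using aeK by (intro integral_cong_AE ifK if1) auto
      also have "\<dots> = enn2real (\<integral>\<^sup>+x. ennreal (indicator K0 x *\<^sub>R f x) \<partial>lebesgue)"
        using f0 K0_subset_K by (intro integral_eq_nn_integral if1) (auto split: split_indicator)
      also have "(\<integral>\<^sup>+x. ennreal (indicator K0 x *\<^sub>R f x) \<partial>lebesgue) = mass F"
        unfolding mass_def by (intro nn_integral_cong) (auto simp: F_def split: split_indicator)
      finally have IF: "I = enn2real (mass F)" .
      have "mass F \<le> mass (\<lambda>_. ennreal (1 / c))"
        using c K0_subset_K by (intro mass_mono) (auto simp: F_def intro!: ennreal_leI)
      also have "\<dots> < top" by (simp add: mass_const ennreal_mult_less_top)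
      finally show "mass F = ennreal I" using IF by simp
      show "0 \<le> I" using IF by simp
    qed
    define M2 where "M2 = M * vol"
    have M2: "0 \<le> M2" "mass (\<lambda>_. ennreal M) = ennreal M2"
      using M vol by (auto simp: M2_def mass_const ennreal_mult)
    have massF1: "mass F1 = ennreal (I + M2)"
      unfolding F1_def using mass_add[OF Fm, of "\<lambda>_. ennreal M"] I M2 by simp
    have cM: "(\<lambda>_. ennreal M) \<in> borel_measurable lebesgue" "reg BB (\<lambda>_. ennreal M)"
      using BB_pos by (auto simp: reg_const)
    have bound: "\<bar>enn2real ((transfer ^^ n) F y) - I * dens y\<bar> \<le> C * (I + 2 * M2) * \<alpha> ^ n" if y: "y \<in> K0" for n y
    proof -
      have eq: "(transfer ^^ n) F1 y = (transfer ^^ n) F y + (transfer ^^ n) (\<lambda>_. ennreal M) y"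
        unfolding F1_def by (simp add: transfer_pow_add)
      have f1: "(transfer ^^ n) F1 y < top" by (subst transfer_pow_finite[OF F1m regF1 massF1 y]) simp
      have "enn2real ((transfer ^^ n) F1 y) = enn2real ((transfer ^^ n) F y) + enn2real ((transfer ^^ n) (\<lambda>_. ennreal M) y)"
        using f1 unfolding eq by (intro enn2real_plus) (auto simp: less_top)
      moreover have "\<bar>enn2real ((transfer ^^ n) F1 y) - (I + M2) * dens y\<bar> \<le> C * \<alpha> ^ n * (I + M2)"
        using I M2 by (intro k[OF y F1m regF1 massF1]) auto
      moreover have "\<bar>enn2real ((transfer ^^ n) (\<lambda>_. ennreal M) y) - M2 * dens y\<bar> \<le> C * \<alpha> ^ n * M2"
        by (rule k[OF y cM M2(2,1)])
      ultimately have "\<bar>enn2real ((transfer ^^ n) F y) - I * dens y\<bar> \<le> C * \<alpha> ^ n * (I + M2) + C * \<alpha> ^ n * M2"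
        by (simp add: distrib_right abs_le_iff)
      then show ?thesis by (simp add: algebra_simps)
    qed
    show "\<exists>Cst\<ge>0. \<forall>n g. transfer_iter K T n f g \<longrightarrow>
        (AE x in lebesgue. x \<in> K \<longrightarrow> \<bar>g x - (LINT y:K|lebesgue. f y) * dens x\<bar> \<le> Cst * \<alpha> ^ n)"
    proof (intro exI[of _ "C * (I + 2 * M2)"] conjI allI impI)
      show "0 \<le> C * (I + 2 * M2)" using C I M2 by simp
      fix n g assume it: "transfer_iter K T n f g"
      have "AE x in lebesgue. x \<in> K \<longrightarrow> g x = enn2real ((transfer ^^ n) F x)"
        using f0 c(2) K0_subset_K by (intro transfer_iter_eq[OF F_def Fm _ it, of "1 / c"]) auto
      then show "AE x in lebesgue. x \<in> K \<longrightarrow> \<bar>g x - (LINT y:K|lebesgue. f y) * dens x\<bar> \<le> C * (I + 2 * M2) * \<alpha> ^ n"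
        using AE_K_K0
      proof eventually_elim
        case (elim x)
        then show ?case using bound[of x n] by (auto simp: I_def)
      qed
    qed
  qed (use \<alpha> in auto)
qed

lemma real_analytic_on_zero: "real_analytic_on (\<lambda>_. 0) G"
  unfolding real_analytic_on_def by (intro ballI exI[of _ 1] conjI exI[of _ "\<lambda>_. 0"]) auto

end


theorem mainTheorem2:
  fixes \<iota> :: "'a::euclidean_space \<Rightarrow> 'a" and Z K :: "'a set"
  assumes inv: "inversion \<iota>"
    and lat: "lattice Z"
    and dir: "dirichlet_region Z K"
    and integ: "integral_lattice Z"
    and unit: "unit_generated Z"
    and ne: "norm_euclidean K"
    and nice: "nicely_invertible Z \<iota>"
    and remote: "three_remote Z K \<or> seven_remote Z K"
  shows "\<exists>(U :: nat \<Rightarrow> 'a set) (J :: nat).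
     (\<forall>j\<in>{1..J}. U j \<subseteq> K \<and> U j \<in> sets lebesgue) \<and>
     (\<forall>s. set s \<subseteq> Z \<longrightarrow> cylinder K \<iota> s \<noteq> {} \<longrightarrow>
        (\<exists>j\<in>{1..J}.
           ((cfmap Z K \<iota> ^^ length s) ` cylinder K \<iota> s - U j) \<union>
           (U j - (cfmap Z K \<iota> ^^ length s) ` cylinder K \<iota> s) \<in> null_sets lebesgue)) \<and>
     (\<exists>(\<mu> :: 'a measure) (h :: 'a \<Rightarrow> real).
        \<comment> \<open>(2) invariant probability measure equivalent to Lebesgue, exact, cf-mixing\<close>
        prob_space \<mu> \<and> space \<mu> = K \<and> sets \<mu> = sets (restrict_space lebesgue K) \<and>
        (\<forall>E\<in>sets \<mu>. emeasure \<mu> E = 0 \<longleftrightarrow> E \<in> null_sets lebesgue) \<and>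
        cfmap Z K \<iota> \<in> measurable \<mu> \<mu> \<and>
        (\<forall>E\<in>sets \<mu>. emeasure \<mu> (cfmap Z K \<iota> -` E \<inter> K) = emeasure \<mu> E) \<and>
        exact_endomorphism \<mu> (cfmap Z K \<iota>) \<and>
        (\<exists>B. \<forall>m\<ge>1. \<forall>s E. set s \<subseteq> Z \<longrightarrow> measure \<mu> (cylinder K \<iota> s) > 0 \<longrightarrow>
            E \<in> sets borel \<longrightarrow> E \<subseteq> K \<longrightarrow> measure \<mu> E > 0 \<longrightarrow>
            \<bar>measure \<mu> (cylinder K \<iota> s \<inter> ((cfmap Z K \<iota> ^^ (length s + m)) -` E \<inter> K))
              - measure \<mu> (cylinder K \<iota> s) * measure \<mu> E\<bar>
            / (measure \<mu> (cylinder K \<iota> s) * measure \<mu> E) \<le> B) \<and>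
        (\<forall>\<epsilon>>0. \<exists>M. \<forall>m\<ge>M. \<forall>s E. set s \<subseteq> Z \<longrightarrow> measure \<mu> (cylinder K \<iota> s) > 0 \<longrightarrow>
            E \<in> sets borel \<longrightarrow> E \<subseteq> K \<longrightarrow> measure \<mu> E > 0 \<longrightarrow>
            \<bar>measure \<mu> (cylinder K \<iota> s \<inter> ((cfmap Z K \<iota> ^^ (length s + m)) -` E \<inter> K))
              - measure \<mu> (cylinder K \<iota> s) * measure \<mu> E\<bar>
            / (measure \<mu> (cylinder K \<iota> s) * measure \<mu> E) \<le> \<epsilon>) \<and>
        \<comment> \<open>h is a version of d\<mu>/d\<lambda>\<close>
        h \<in> borel_measurable lebesgue \<and> (\<forall>x. h x \<ge> 0) \<and>
        (\<forall>E\<in>sets \<mu>. emeasure \<mu> E = (\<integral>\<^sup>+x\<in>E. ennreal (h x) \<partial>lebesgue)) \<and>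
        \<comment> \<open>(3) piecewise analytic density\<close>
        (\<forall>P\<in>cells K U J. \<exists>G g. open G \<and> P \<subseteq> G \<and> real_analytic_on g G \<and>
            (\<forall>x\<in>P. h x = g x)) \<and>
        \<comment> \<open>(4) Kuzmin-type theorem\<close>
        (\<exists>\<alpha>::real. 0 < \<alpha> \<and> \<alpha> < 1 \<and>
          (\<forall>f :: 'a \<Rightarrow> real.
             (\<exists>c>0. \<forall>x\<in>K. c \<le> f x \<and> f x \<le> 1 / c) \<longrightarrow>
             (\<forall>P\<in>cells K U J. \<exists>L. \<forall>x\<in>P. \<forall>y\<in>P. \<bar>f x - f y\<bar> \<le> L * dist x y) \<longrightarrow>
             (\<exists>Cst. \<forall>n g. transfer_iter K (cfmap Z K \<iota>) n f g \<longrightarrow>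
                (AE x in lebesgue. x \<in> K \<longrightarrow>
                   \<bar>g x - (LINT y:K|lebesgue. f y) * h x\<bar> \<le>
                   Cst * (\<alpha> powr sqrt (real n)
                     + (SUP s\<in>{s. set s \<subseteq> Z \<and> length s = nat \<lfloor>sqrt (real n)\<rfloor>}.
                          diameter (cylinder K \<iota> s))
                     + infsum (\<lambda>s. measure lebesgue (cylinder K \<iota> s))
                         {s. set s \<subseteq> Z \<and> length s = nat \<lfloor>sqrt (real n)\<rfloor> \<and>
                             \<not> (\<exists>P\<in>cells K U J. cylinder K \<iota> s \<subseteq> P)}))))))"
proof -
  interpret cf_lattice \<iota> Z K
    by (intro cf_lattice.intro inversion_map.intro cf_lattice_axioms.intro assms)
  \<comment> \<open>All unions of cells, including the empty union and the single cells. Having the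
    single cells in the list forces the atoms that meet \<open>K0\<close> to be exactly the
    cells.\<close>
  define \<U> where "\<U> = Union ` Pow (cell ` K0)"
  have "finite \<U>" unfolding \<U>_def using finite_cells by simp
  then obtain U where U: "bij_betw U {1..card \<U>} \<U>" using ex_bij_betw_nat_finite_1 by blast
  define J where "J = card \<U>"
  have UJ: "U ` {1..J} = \<U>" using U by (simp add: J_def bij_betw_def)
  have U_ex: "\<exists>j\<in>{1..J}. U j = \<Union> S" if "S \<subseteq> cell ` K0" for S
  proof -
    have "\<Union> S \<in> U ` {1..J}" unfolding UJ \<U>_def using that by blast
    then show ?thesis by auto
  qed
  have U_form: "\<exists>S\<subseteq>cell ` K0. U j = \<Union> S" if "j \<in> {1..J}" for j
  proof -
    have "U j \<in> \<U>" using UJ that by blast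
    then show ?thesis unfolding \<U>_def by blast
  qed
  have U_step: "v \<in> U j" if j: "j \<in> {1..J}" and w: "w \<in> U j" and v: "v \<in> cell w" for v w j
  proof -
    obtain S where S: "S \<subseteq> cell ` K0" "U j = \<Union> S" using U_form[OF j] by blast
    obtain Q where Q: "Q \<in> S" "w \<in> Q" using w unfolding S(2) by (rule UnionE)
    obtain z where z: "Q = cell z" using subsetD[OF S(1) Q(1)] by (rule imageE)
    have "v \<in> Q" using v cell_eq[of w z] Q(2) z by simp
    then show ?thesis unfolding S(2) using Q(1) by (rule UnionI[rotated])
  qed
  have U_cellular: "y \<in> U j \<longleftrightarrow> x \<in> U j" if "j \<in> {1..J}" "x \<in> K0" "y \<in> cell x" for x y j
  proof -
    have "x \<in> cell y" using in_cell[OF that(2)] cell_eq[OF that(3)] by simp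
    then show ?thesis using U_step[OF that(1), of x y] U_step[OF that(1), of y x] that(3) by auto
  qed
  \<comment> \<open>The cell of \<open>x\<close> is one of the sets \<open>U j\<close>, and an atom
    containing \<open>x\<close> cannot leave it.\<close>
  have cells_sub: "\<exists>x\<in>K0. P \<subseteq> cell x" if P: "P \<in> cells K U J" and x: "x \<in> P" "x \<in> K0" for P x
  proof -
    obtain S where S: "P = K \<inter> (\<Inter>j\<in>{1..J}. if j \<in> S then U j else K - U j)" using P unfolding cells_def by blast
    obtain j where j: "j \<in> {1..J}" "U j = \<Union> {cell x}" using U_ex[of "{cell x}"] x(2) by blast
    have xU: "x \<in> U j" using in_cell[OF x(2)] j by simp
    have "x \<in> (if j \<in> S then U j else K - U j)" using x(1) j(1) unfolding S by blast
    then have "j \<in> S" using xU by (auto split: if_splits)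
    then have "P \<subseteq> U j" unfolding S using j(1) by auto
    then show ?thesis using x(2) j(2) by auto
  qed
  have cell_sub: "\<exists>P\<in>cells K U J. cell x \<subseteq> P" if x: "x \<in> K0" for x
  proof -
    define S where "S = {j \<in> {1..J}. x \<in> U j}"
    define P where "P = K \<inter> (\<Inter>j\<in>{1..J}. if j \<in> S then U j else K - U j)"
    have sub: "cell x \<subseteq> P"
    proof
      fix y assume y: "y \<in> cell x"
      have yK: "y \<in> K" using y cell_subset K0_subset_K by blast
      have "y \<in> (if j \<in> S then U j else K - U j)" if "j \<in> {1..J}" for j
        using U_cellular[OF that x y] that yK by (simp add: S_def)
      then show "y \<in> P" using yK unfolding P_def by blast
    qed
    have "P \<noteq> {}" using sub in_cell[OF x] by blast
    moreover have "S \<subseteq> {1..J}" by (auto simp: S_def)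
    ultimately have "P \<in> cells K U J" unfolding cells_def P_def by blast
    then show ?thesis using sub by blast
  qed
  have U_meas: "U j \<subseteq> K \<and> U j \<in> sets lebesgue" if j: "j \<in> {1..J}" for j
  proof -
    obtain S where S: "S \<subseteq> cell ` K0" "U j = \<Union> S" using U_form[OF j] by blast
    have cells: "open Q \<and> Q \<subseteq> K" if Q: "Q \<in> S" for Q
    proof -
      obtain z where "z \<in> K0" "Q = cell z" using subsetD[OF S(1) Q] by auto
      then show ?thesis using open_cell'[of z] cell_subset[of z] K0_subset_K by auto
    qed
    then have "open (U j)" "U j \<subseteq> K" unfolding S(2) by auto
    then show ?thesis by simp
  qed
  have finite_range: "\<exists>j\<in>{1..J}. ((T ^^ length s) ` cyl s - U j) \<union> (U j - (T ^^ length s) ` cyl s) \<in> null_sets lebesgue"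
    if s: "set s \<subseteq> Z" for s
  proof -
    define V where "V = (T ^^ length s) ` cyl s"
    have "cellular V" using cellular_image[OF s, of UNIV] by (simp add: V_def cellular_def)
    then have V: "V \<inter> K0 = \<Union> (cell ` (V \<inter> K0))" by (rule cellular_eq_Union)
    obtain j where j: "j \<in> {1..J}" "U j = \<Union> (cell ` (V \<inter> K0))" using U_ex[of "cell ` (V \<inter> K0)"] by blast
    have "(T ^^ n) x \<in> K" if "x \<in> K" for n x using that T_in_K by (cases n) auto
    then have "V \<subseteq> K" unfolding V_def using cyl_subset by blast
    moreover have "U j = V \<inter> K0" using j(2) V by simp
    ultimately have "(V - U j) \<union> (U j - V) \<subseteq> K - K0" by auto
    then have "negligible ((V - U j) \<union> (U j - V))" using negligible_K_diff_K0 negligible_subset by blast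
    then show ?thesis using j(1) unfolding V_def by (auto simp: negligible_iff_null_sets)
  qed
  obtain C \<alpha> where C: "0 \<le> C" and \<alpha>: "0 < \<alpha>" "\<alpha> < 1" and mix: "\<And>s E m. set s \<subseteq> Z \<Longrightarrow> E \<in> sets Mu \<Longrightarrow>
     \<bar>measure Mu (cyl s \<inter> ((T ^^ (length s + m)) -` E \<inter> K)) - measure Mu (cyl s) * measure Mu E\<bar>
      \<le> C * \<alpha> ^ m * (measure Mu (cyl s) * measure Mu E)"
    using mixing by blast
  have ratio: "\<bar>measure Mu (cyl s \<inter> ((T ^^ (length s + m)) -` E \<inter> K)) - measure Mu (cyl s) * measure Mu E\<bar>
      / (measure Mu (cyl s) * measure Mu E) \<le> C * \<alpha> ^ m"
    if "set s \<subseteq> Z" "0 < measure Mu (cyl s)" "E \<in> sets borel" "E \<subseteq> K" "0 < measure Mu E" for s E m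
  proof -
    have "E \<in> sets Mu" using that by (simp add: sets_Mu_iff)
    then show ?thesis using mix[OF that(1)] that by (simp add: pos_divide_le_eq)
  qed
  have lim0: "(\<lambda>m. C * \<alpha> ^ m) \<longlonglongrightarrow> 0" using \<alpha> by (intro tendsto_mult_right_zero LIMSEQ_power_zero) auto
  obtain \<kappa> where \<kappa>: "0 < \<kappa>" "\<kappa> < 1" and kuz: "\<And>f::'a \<Rightarrow> real. \<exists>c>0. \<forall>x\<in>K. c \<le> f x \<and> f x \<le> 1 / c \<Longrightarrow>
     \<forall>x\<in>K0. \<exists>L. \<forall>y\<in>cell x. \<forall>z\<in>cell x. \<bar>f y - f z\<bar> \<le> L * dist y z \<Longrightarrow>
     \<exists>Cst\<ge>0. \<forall>n g. transfer_iter K T n f g \<longrightarrow>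
        (AE x in lebesgue. x \<in> K \<longrightarrow> \<bar>g x - (LINT y:K|lebesgue. f y) * dens x\<bar> \<le> Cst * \<kappa> ^ n)"
    using kuzmin_transfer_iter by blast
  show ?thesis
  proof (rule exI[of _ U], rule exI[of _ J], rule conjI[OF _ conjI], goal_cases)
    case 1
    show ?case using U_meas by blast
  next
    case 2
    show ?case using finite_range by blast
  next
    case 3
    show ?case
    proof (rule exI[of _ Mu], rule exI[of _ dens], intro conjI, goal_cases)
      case 1 show ?case by (rule prob_space_Mu)
    next
      case 2 show ?case by simp
    next
      case 3 show ?case by (rule sets_Mu)
    next
      case 4 show ?case using null_Mu_iff by blast
    next
      case 5 show ?case by (rule measurable_T_Mu)
    next
      case 6 show ?case using Mu_invariant_pow[of _ 1] by simp
    next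
      case 7 show ?case by (rule exact_Mu)
    next
      case 8 show ?case
      proof (intro exI[of _ C] allI impI)
        fix m :: nat and s E
        assume "set s \<subseteq> Z" "0 < measure Mu (cyl s)" "E \<in> sets borel" "E \<subseteq> K" "0 < measure Mu E"
        from ratio[OF this, of m] have "\<bar>measure Mu (cyl s \<inter> ((T ^^ (length s + m)) -` E \<inter> K)) - measure Mu (cyl s) * measure Mu E\<bar>
          / (measure Mu (cyl s) * measure Mu E) \<le> C * \<alpha> ^ m" .
        also have "\<dots> \<le> C * 1" using C \<alpha> by (intro mult_left_mono power_le_one) auto
        finally show "\<bar>measure Mu (cyl s \<inter> ((T ^^ (length s + m)) -` E \<inter> K)) - measure Mu (cyl s) * measure Mu E\<bar>
          / (measure Mu (cyl s) * measure Mu E) \<le> C" by simp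
      qed
    next
      case 9 show ?case
      proof (intro allI impI)
        fix \<epsilon> :: real assume "0 < \<epsilon>"
        then obtain m0 where m0: "\<And>m. m \<ge> m0 \<Longrightarrow> C * \<alpha> ^ m < \<epsilon>"
          using order_tendstoD(2)[OF lim0] unfolding eventually_sequentially by blast
        show "\<exists>M. \<forall>m\<ge>M. \<forall>s E. set s \<subseteq> Z \<longrightarrow> 0 < measure Mu (cyl s) \<longrightarrow>
            E \<in> sets borel \<longrightarrow> E \<subseteq> K \<longrightarrow> 0 < measure Mu E \<longrightarrow>
            \<bar>measure Mu (cyl s \<inter> ((T ^^ (length s + m)) -` E \<inter> K)) - measure Mu (cyl s) * measure Mu E\<bar>
            / (measure Mu (cyl s) * measure Mu E) \<le> \<epsilon>"
          using ratio m0 by (intro exI[of _ m0] allI impI) (rule order_trans, assumption, force)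
      qed
    next
      case 10 show ?case by (rule dens_measurable)
    next
      case 11 show ?case using dens_nonneg by blast
    next
      case 12 show ?case using emeasure_Mu by blast
    next
      case 13 show ?case
      proof
        fix P assume P: "P \<in> cells K U J"
        show "\<exists>G g. open G \<and> P \<subseteq> G \<and> real_analytic_on g G \<and> (\<forall>x\<in>P. dens x = g x)"
        proof (cases "P \<inter> K0 = {}")
          case True
          then have "dens x = 0" if "x \<in> P" for x using that by (auto simp: dens_def)
          then show ?thesis using real_analytic_on_zero[of UNIV] by (intro exI[of _ UNIV] exI[of _ "\<lambda>_. 0"]) auto
        next
          case False
          then obtain x where "x \<in> K0" "P \<subseteq> cell x" using cells_sub[OF P] by blast
          then show ?thesis using dens_analytic open_cell' by blast
        qed
      qed
    next
      case 14 show ?case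
      proof (rule exI[of _ \<kappa>], intro conjI allI impI)
        fix f :: "'a \<Rightarrow> real"
        assume f: "\<exists>c>0. \<forall>x\<in>K. c \<le> f x \<and> f x \<le> 1 / c"
          and lip: "\<forall>P\<in>cells K U J. \<exists>L. \<forall>x\<in>P. \<forall>y\<in>P. \<bar>f x - f y\<bar> \<le> L * dist x y"
        have lip': "\<exists>L. \<forall>y\<in>cell x. \<forall>z\<in>cell x. \<bar>f y - f z\<bar> \<le> L * dist y z" if x: "x \<in> K0" for x
        proof -
          obtain P where P: "P \<in> cells K U J" "cell x \<subseteq> P" using cell_sub[OF x] by blast
          then obtain L where "\<forall>x\<in>P. \<forall>y\<in>P. \<bar>f x - f y\<bar> \<le> L * dist x y" using lip by blast
          then show ?thesis using P(2) by blast
        qed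
        then obtain Cst where Cst: "0 \<le> Cst" "\<And>n g. transfer_iter K T n f g \<Longrightarrow>
          AE x in lebesgue. x \<in> K \<longrightarrow> \<bar>g x - (LINT y:K|lebesgue. f y) * dens x\<bar> \<le> Cst * \<kappa> ^ n"
          using kuz[OF f] by blast
        \<comment> \<open>The geometric rate already found is below
          \<open>\<kappa> powr sqrt (real n)\<close>, and the two further error terms are
          nonnegative. For the supremum this uses that the diameters are bounded and that the word
          of zeros is a member.\<close>
        define \<sigma> where "\<sigma> m = (SUP s\<in>{s. set s \<subseteq> Z \<and> length s = m}. diameter (cyl s))" for m
        define \<gamma> where "\<gamma> m = infsum (\<lambda>s. measure lebesgue (cyl s))
            {s. set s \<subseteq> Z \<and> length s = m \<and> \<not> (\<exists>P\<in>cells K U J. cyl s \<subseteq> P)}" for m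
        have \<sigma>: "0 \<le> \<sigma> m" for m
        proof -
          have "bdd_above ((\<lambda>s. diameter (cyl s)) ` {s. set s \<subseteq> Z \<and> length s = m})"
            using diameter_subset[OF cyl_subset bounded_K] by (intro bdd_aboveI2[of _ _ "diameter K"])
          moreover have "replicate m 0 \<in> {s. set s \<subseteq> Z \<and> length s = m}" by auto
          ultimately have "diameter (cyl (replicate m 0)) \<le> \<sigma> m" unfolding \<sigma>_def by (intro cSUP_upper)
          moreover have "0 \<le> diameter (cyl (replicate m 0))"
            using bounded_subset[OF bounded_K cyl_subset] by (rule diameter_ge_0)
          ultimately show ?thesis by linarith
        qed
        have \<gamma>: "0 \<le> \<gamma> m" for m unfolding \<gamma>_def by (intro infsum_nonneg) auto
        have pow: "\<kappa> ^ n \<le> \<kappa> powr sqrt (real n)" for n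
        proof -
          have "sqrt (real n) \<le> real n" by (cases "n = 0") (auto intro!: real_le_lsqrt simp: self_le_power)
          then have "\<kappa> powr real n \<le> \<kappa> powr sqrt (real n)" using \<kappa> by (intro powr_mono') auto
          then show ?thesis using \<kappa> by (simp add: powr_realpow)
        qed
        have "AE x in lebesgue. x \<in> K \<longrightarrow> \<bar>g x - (LINT y:K|lebesgue. f y) * dens x\<bar> \<le>
            Cst * (\<kappa> powr sqrt (real n) + \<sigma> (nat \<lfloor>sqrt (real n)\<rfloor>) + \<gamma> (nat \<lfloor>sqrt (real n)\<rfloor>))"
          if "transfer_iter K T n f g" for n g
        proof -
          have "Cst * \<kappa> ^ n \<le> Cst * (\<kappa> powr sqrt (real n) + \<sigma> (nat \<lfloor>sqrt (real n)\<rfloor>) + \<gamma> (nat \<lfloor>sqrt (real n)\<rfloor>))"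
            using pow[of n] \<sigma>[of "nat \<lfloor>sqrt (real n)\<rfloor>"] \<gamma>[of "nat \<lfloor>sqrt (real n)\<rfloor>"] Cst(1)
            by (intro mult_left_mono) linarith+
          then show ?thesis using Cst(2)[OF that] by (auto elim!: eventually_mono)
        qed
        then show "\<exists>Cst. \<forall>n g. transfer_iter K T n f g \<longrightarrow>
          (AE x in lebesgue. x \<in> K \<longrightarrow> \<bar>g x - (LINT y:K|lebesgue. f y) * dens x\<bar> \<le>
             Cst * (\<kappa> powr sqrt (real n)
               + (SUP s\<in>{s. set s \<subseteq> Z \<and> length s = nat \<lfloor>sqrt (real n)\<rfloor>}. diameter (cyl s))
               + infsum (\<lambda>s. measure lebesgue (cyl s))
                   {s. set s \<subseteq> Z \<and> length s = nat \<lfloor>sqrt (real n)\<rfloor> \<and> \<not> (\<exists>P\<in>cells K U J. cyl s \<subseteq> P)}))"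
          unfolding \<sigma>_def \<gamma>_def by blast
      qed (use \<kappa> in auto)
    qed
  qed
qed


end
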